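(* Let $d\ge3$, $G^d=\mathbb Z^d\dashv\mathbb Z$ with adjacency operator $A$, $H=\|A\|I-A$, $\beta>0$ and $c\ge0$. Let $\omega^{(c)}$ be the quasi-free state on the CCR algebra $\mathrm{CCR}(\mathcal S_0)$ with two-point function $$\omega^{(c)}(a^+(\xi)a(\eta))=\langle\eta,(e^{\beta H}-I)^{-1}\xi\rangle+\frac c\beta\langle\eta,v\rangle\langle v,\xi\rangle,\qquad \xi,\eta\in\mathcal S_0 .$$ Then $\omega^{(c)}$ is a $\beta$-KMS state with respect to the time evolution $\alpha_t$ on $\mathrm{CCR}(\mathcal S_0)$ induced by $T_t:=e^{itH}$, i.e. $\alpha_t(W(\xi))=W(e^{itH}\xi)$.
   Context: Comb product: for graphs $G,K$ and a vertex $o\in VK$, $G\dashv(K,o)$ has vertex set $VG\times VK$, with $(g,h)\sim(g',h')$ iff ($g=g'$ and $h\sim h'$) or ($h=h'=o$ and $g\sim g'$). $G^d=\mathbb Z^d\dashv\mathbb Z$ with $o=0$, and $\ell^2(VG^d)=\ell^2(\mathbb Z^d)\otimes\ell^2(\mathbb Z)$. Every $\xi\in\ell^2(VG^d)$ is written $\xi=\sum_{\vec\jmath\in\mathbb Z^d}\delta_{\vec\jmath}\otimes\xi_{\vec\jmath}$; $\mathcal S_0$ is the set of $\xi$ for which $\vec\jmath\mapsto\|\xi_{\vec\jmath}\|$ is rapidly decreasing. One has $e^{itH}\mathcal S_0\subset\mathcal S_0$ for all $t\in\mathbb R$ and $\mathcal S_0\subset\mathcal D((e^{\beta H}-I)^{-1/2})$,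 and $\langle\eta,(e^{\beta H}-I)^{-1}\xi\rangle$ means $\langle(e^{\beta H}-I)^{-1/2}\eta,(e^{\beta H}-I)^{-1/2}\xi\rangle$. The vector $v=u\otimes w$ is the generalized Perron--Frobenius vector of $A$: $u\equiv1$ on $\mathbb Z^d$, $w=\|R\delta_0\|^{-1}R\delta_0\in\ell^2(\mathbb Z)$ with $R=(\|A\|I-A_{\mathbb Z})^{-1}$; $\langle v,\xi\rangle=\sum_{\vec\jmath}\langle w,\xi_{\vec\jmath}\rangle$. Inner products are linear in the second variable. $\mathrm{CCR}(\mathfrak h)$, for a pre-Hilbert space $\mathfrak h$, is the $C^*$-algebra generated by the unitary Weyl operators $W(f)$, $f\in\mathfrak h$, with $W(f)W(g)=e^{-\frac i2\mathrm{Im}\langle f,g\rangle}W(f+g)$. The quasi-free state $\omega$ with two-point function $\omega(a^+(\xi)a(\eta))$ is the state with $\omega(W(\xi))=\exp\{-\tfrac14\|\xi\|^2-\tfrac12\omega(a^+(\xi)a(\xi))\}$. A state $\omega$ on a $C^*$-algebra $\mathfrak A$ with one-parameter automorphism group $\alpha$ is $\beta$-KMS if $t\mapsto\omega(a\,\alpha_t(b))$ is continuous for all $a,b\in\mathfrak A$, and $\int\omega(a\,\alpha_t(b))f(t)\,dt=\int\omega(\alpha_t(b)\,a)f(t+i\beta)\,dt$ for every $f$ that is the Fourier transform of a smooth compactly supported function on $\mathbb R$. *)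

theory Defs
  imports "HOL-Analysis.Analysis"
begin

section \<open>Complex vector spaces, pre-Hilbert spaces and C*-algebras\<close>

class complex_vector = real_vector +
  fixes scaleC :: "complex \<Rightarrow> 'a \<Rightarrow> 'a" (infixr \<open>*\<^sub>C\<close> 75)
  assumes scaleC_add_right: "c *\<^sub>C (x + y) = c *\<^sub>C x + c *\<^sub>C y"
    and scaleC_add_left: "(b + c) *\<^sub>C x = b *\<^sub>C x + c *\<^sub>C x"
    and scaleC_scaleC: "b *\<^sub>C (c *\<^sub>C x) = (b * c) *\<^sub>C x"
    and scaleR_scaleC: "r *\<^sub>R x = complex_of_real r *\<^sub>C x"

text \<open>Inner products are linear in the second variable. The norm and the positivity of the inner
  product are those of \<^class>\<open>real_inner\<close>.\<close>

class complex_inner = complex_vector + real_inner +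
  fixes cinner :: "'a \<Rightarrow> 'a \<Rightarrow> complex"
  assumes cinner_commute: "cinner x y = cnj (cinner y x)"
    and cinner_add_right: "cinner x (y + z) = cinner x y + cinner x z"
    and cinner_scaleC_right: "cinner x (c *\<^sub>C y) = c * cinner x y"
    and inner_eq_Re_cinner: "inner x y = Re (cinner x y)"

class cstar_algebra = complex_vector + real_normed_algebra_1 + banach +
  fixes star :: "'a \<Rightarrow> 'a"
  assumes mult_scaleC_left: "(c *\<^sub>C a) * b = c *\<^sub>C (a * b)"
    and mult_scaleC_right: "a * (c *\<^sub>C b) = c *\<^sub>C (a * b)"
    and norm_scaleC: "norm (c *\<^sub>C a) = cmod c * norm a"
    and star_star: "star (star a) = a"
    and star_add: "star (a + b) = star a + star b"
    and star_scaleC: "star (c *\<^sub>C a) = cnj c *\<^sub>C star a"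
    and star_mult: "star (a * b) = star b * star a"
    and cstar_identity: "norm (star a * a) = (norm a)\<^sup>2"

definition is_unitary :: "'a::cstar_algebra \<Rightarrow> bool" where
  "is_unitary u \<longleftrightarrow> star u * u = 1 \<and> u * star u = 1"

definition cstar_subalgebra :: "'a::cstar_algebra set \<Rightarrow> bool" where
  "cstar_subalgebra B \<longleftrightarrow> closed B \<and> 0 \<in> B \<and>
     (\<forall>a\<in>B. \<forall>b\<in>B. a + b \<in> B \<and> a * b \<in> B) \<and>
     (\<forall>a\<in>B. \<forall>c. c *\<^sub>C a \<in> B \<and> star a \<in> B)"

definition is_state :: "('a::cstar_algebra \<Rightarrow> complex) \<Rightarrow> bool" where
  "is_state \<omega> \<longleftrightarrow>
     (\<forall>a b. \<omega> (a + b) = \<omega> a + \<omega> b) \<and> (\<forall>c a. \<omega> (c *\<^sub>C a) = c * \<omega> a) \<and>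
     (\<forall>a. \<omega> (star a * a) \<in> \<real>\<^sub>\<ge>\<^sub>0) \<and> \<omega> 1 = 1"

definition star_automorphism :: "('a::cstar_algebra \<Rightarrow> 'a) \<Rightarrow> bool" where
  "star_automorphism \<phi> \<longleftrightarrow> bij \<phi> \<and>
     (\<forall>a b. \<phi> (a + b) = \<phi> a + \<phi> b) \<and> (\<forall>c a. \<phi> (c *\<^sub>C a) = c *\<^sub>C \<phi> a) \<and>
     (\<forall>a b. \<phi> (a * b) = \<phi> a * \<phi> b) \<and> (\<forall>a. \<phi> (star a) = star (\<phi> a))"

definition automorphism_group :: "(real \<Rightarrow> 'a::cstar_algebra \<Rightarrow> 'a) \<Rightarrow> bool" where
  "automorphism_group \<alpha> \<longleftrightarrow>
     (\<forall>t. star_automorphism (\<alpha> t)) \<and> \<alpha> 0 = id \<and> (\<forall>s t. \<alpha> (s + t) = \<alpha> s \<circ> \<alpha> t)"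

section \<open>KMS states\<close>

definition test_function :: "(real \<Rightarrow> complex) \<Rightarrow> bool" where
  "test_function g \<longleftrightarrow>
     (\<exists>D. D 0 = g \<and> (\<forall>n x. (D n has_vector_derivative D (Suc n) x) (at x))) \<and>
     compact (closure {x. g x \<noteq> 0})"

text \<open>The Fourier transform of a test function, extended to an entire function of \<open>z\<close>. (The class
  of Fourier transforms of test functions does not depend on the normalization.)\<close>

definition fourier :: "(real \<Rightarrow> complex) \<Rightarrow> complex \<Rightarrow> complex" where
  "fourier g z = (LINT x|lborel. exp (- (\<i> * z * complex_of_real x)) * g x)"

definition kms_state ::
    "real \<Rightarrow> (real \<Rightarrow> 'a::cstar_algebra \<Rightarrow> 'a) \<Rightarrow> ('a \<Rightarrow> complex) \<Rightarrow> bool" where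
  "kms_state \<beta> \<alpha> \<omega> \<longleftrightarrow> is_state \<omega> \<and>
     (\<forall>a b. continuous_on UNIV (\<lambda>t. \<omega> (a * \<alpha> t b))) \<and>
     (\<forall>a b g. test_function g \<longrightarrow>
        (LINT t|lborel. \<omega> (a * \<alpha> t b) * fourier g (complex_of_real t)) =
        (LINT t|lborel. \<omega> (\<alpha> t b * a) * fourier g (complex_of_real t + \<i> * complex_of_real \<beta>)))"

section \<open>The CCR algebra and quasi-free states\<close>

text \<open>The whole type \<^typ>\<open>'a\<close>, with Weyl operators \<open>W f\<close> for \<open>f\<close> in the complex subspace \<open>S\<close>, is the
  C*-algebra \<open>CCR(S)\<close>. This determines it up to a unique isomorphism preserving the Weyl operators.
  The values of \<open>W\<close> outside \<open>S\<close> are irrelevant.\<close>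

definition is_CCR :: "'h::complex_inner set \<Rightarrow> ('h \<Rightarrow> 'a::cstar_algebra) \<Rightarrow> bool" where
  "is_CCR S W \<longleftrightarrow>
     (\<forall>f\<in>S. is_unitary (W f)) \<and>
     (\<forall>f\<in>S. \<forall>g\<in>S. W f * W g =
        exp (- (\<i> / 2) * complex_of_real (Im (cinner f g))) *\<^sub>C W (f + g)) \<and>
     cstar_subalgebra hull (W ` S) = UNIV"

text \<open>In the next definition \<open>q \<xi> \<eta>\<close> stands for \<open>\<omega>(a\<^sup>+(\<xi>) a(\<eta>))\<close>.\<close>

definition quasi_free_state ::
    "'h::complex_inner set \<Rightarrow> ('h \<Rightarrow> 'a::cstar_algebra) \<Rightarrow> ('h \<Rightarrow> 'h \<Rightarrow> complex) \<Rightarrow>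
     ('a \<Rightarrow> complex) \<Rightarrow> bool" where
  "quasi_free_state S W q \<omega> \<longleftrightarrow> is_state \<omega> \<and>
     (\<forall>\<xi>\<in>S. \<omega> (W \<xi>) = exp (- (complex_of_real ((norm \<xi>)\<^sup>2) / 4) - q \<xi> \<xi> / 2))"

definition induced_evolution ::
    "'h::complex_inner set \<Rightarrow> ('h \<Rightarrow> 'a::cstar_algebra) \<Rightarrow> (real \<Rightarrow> 'h \<Rightarrow> 'h) \<Rightarrow>
     (real \<Rightarrow> 'a \<Rightarrow> 'a) \<Rightarrow> bool" where
  "induced_evolution S W T \<alpha> \<longleftrightarrow> automorphism_group \<alpha> \<and>
     (\<forall>t. \<forall>\<xi>\<in>S. \<alpha> t (W \<xi>) = W (T t \<xi>))"

section \<open>The Hilbert space of square-summable functions\<close>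

typedef 'v ell2 = "{f :: 'v \<Rightarrow> complex. (\<lambda>x. (cmod (f x))\<^sup>2) summable_on UNIV}"
  morphisms apply_ell2 Abs_ell2
  by (rule exI[of _ "\<lambda>_. 0"]) simp

setup_lifting type_definition_ell2

lemma square_summable_mult:
  fixes f g :: "'v \<Rightarrow> complex"
  assumes "(\<lambda>x. (cmod (f x))\<^sup>2) summable_on UNIV" "(\<lambda>x. (cmod (g x))\<^sup>2) summable_on UNIV"
  shows "(\<lambda>x. cnj (f x) * g x) summable_on UNIV"
proof -
  have "(\<lambda>x. norm (cnj (f x) * g x)) summable_on UNIV"
    by (rule abs_summable_product)
      (use assms in \<open>simp_all add: norm_mult power2_eq_square\<close>)
  then show ?thesis by (rule abs_summable_summable)
qed

lemma square_summable_add: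
  fixes f g :: "'v \<Rightarrow> complex"
  assumes "(\<lambda>x. (cmod (f x))\<^sup>2) summable_on UNIV" "(\<lambda>x. (cmod (g x))\<^sup>2) summable_on UNIV"
  shows "(\<lambda>x. (cmod (f x + g x))\<^sup>2) summable_on UNIV"
proof (rule summable_on_comparison_test)
  show "(\<lambda>x. 2 * (cmod (f x))\<^sup>2 + 2 * (cmod (g x))\<^sup>2) summable_on UNIV"
    by (intro summable_on_add summable_on_cmult_right assms)
  show "(cmod (f x + g x))\<^sup>2 \<le> 2 * (cmod (f x))\<^sup>2 + 2 * (cmod (g x))\<^sup>2" for x
  proof -
    have "(cmod (f x + g x))\<^sup>2 \<le> (cmod (f x) + cmod (g x))\<^sup>2"
      by (intro power_mono norm_triangle_ineq) auto
    also have "\<dots> \<le> 2 * (cmod (f x))\<^sup>2 + 2 * (cmod (g x))\<^sup>2"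
      using sum_squares_bound[of "cmod (f x)" "cmod (g x)"] by (simp add: power2_sum)
    finally show ?thesis .
  qed
qed auto

lemma square_summable_scale:
  fixes f :: "'v \<Rightarrow> complex"
  assumes "(\<lambda>x. (cmod (f x))\<^sup>2) summable_on UNIV"
  shows "(\<lambda>x. (cmod (c * f x))\<^sup>2) summable_on UNIV"
  using summable_on_cmult_right[OF assms, of "(cmod c)\<^sup>2"] by (simp add: norm_mult power_mult_distrib)

instantiation ell2 :: (type) complex_inner
begin

lift_definition zero_ell2 :: "'a ell2" is "\<lambda>_. 0" by simp

lift_definition plus_ell2 :: "'a ell2 \<Rightarrow> 'a ell2 \<Rightarrow> 'a ell2" is "\<lambda>f g x. f x + g x"
  by (rule square_summable_add)

lift_definition uminus_ell2 :: "'a ell2 \<Rightarrow> 'a ell2" is "\<lambda>f x. - f x" by simp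

lift_definition minus_ell2 :: "'a ell2 \<Rightarrow> 'a ell2 \<Rightarrow> 'a ell2" is "\<lambda>f g x. f x - g x"
  using square_summable_add[of f "\<lambda>x. - g x" for f g] by simp

lift_definition scaleC_ell2 :: "complex \<Rightarrow> 'a ell2 \<Rightarrow> 'a ell2" is "\<lambda>c f x. c * f x"
  by (rule square_summable_scale)

lift_definition scaleR_ell2 :: "real \<Rightarrow> 'a ell2 \<Rightarrow> 'a ell2" is "\<lambda>r f x. complex_of_real r * f x"
  by (rule square_summable_scale)

definition cinner_ell2 :: "'a ell2 \<Rightarrow> 'a ell2 \<Rightarrow> complex" where
  "cinner_ell2 \<phi> \<psi> = (\<Sum>\<^sub>\<infinity>x. cnj (apply_ell2 \<phi> x) * apply_ell2 \<psi> x)"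

definition inner_ell2 :: "'a ell2 \<Rightarrow> 'a ell2 \<Rightarrow> real" where
  "inner_ell2 \<phi> \<psi> = Re (cinner \<phi> \<psi>)"

definition norm_ell2 :: "'a ell2 \<Rightarrow> real" where
  "norm_ell2 \<psi> = sqrt (\<Sum>\<^sub>\<infinity>x. (cmod (apply_ell2 \<psi> x))\<^sup>2)"

definition sgn_ell2 :: "'a ell2 \<Rightarrow> 'a ell2" where
  "sgn_ell2 \<psi> = inverse (norm \<psi>) *\<^sub>R \<psi>"

definition dist_ell2 :: "'a ell2 \<Rightarrow> 'a ell2 \<Rightarrow> real" where
  "dist_ell2 \<phi> \<psi> = norm (\<phi> - \<psi>)"

definition uniformity_ell2 :: "('a ell2 \<times> 'a ell2) filter" where
  "uniformity_ell2 = (INF e\<in>{0<..}. principal {(\<phi>, \<psi>). dist \<phi> \<psi> < e})"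

definition open_ell2 :: "'a ell2 set \<Rightarrow> bool" where
  "open_ell2 U = (\<forall>\<phi>\<in>U. \<forall>\<^sub>F (\<phi>', \<psi>) in uniformity. \<phi>' = \<phi> \<longrightarrow> \<psi> \<in> U)"

instance
proof
  fix x y z :: "'a ell2" and a b :: real and c d :: complex
  have summ: "(\<lambda>v. cnj (apply_ell2 \<phi> v) * apply_ell2 \<psi> v) summable_on UNIV" for \<phi> \<psi> :: "'a ell2"
    using apply_ell2[of \<phi>] apply_ell2[of \<psi>] by (intro square_summable_mult) auto
  have scale_eq: "a *\<^sub>R x = complex_of_real a *\<^sub>C x" for a and x :: "'a ell2"
    by transfer simp
  show "x + y + z = x + (y + z)" "x + y = y + x" "0 + x = x" "- x + x = 0" "x - y = x + - y"
    by (transfer, auto)+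
  show addr: "c *\<^sub>C (x + y) = c *\<^sub>C x + c *\<^sub>C y" for c :: complex and x y :: "'a ell2"
    by transfer (auto simp: algebra_simps)
  show addl: "(c + d) *\<^sub>C x = c *\<^sub>C x + d *\<^sub>C x" for c d :: complex and x :: "'a ell2"
    by transfer (auto simp: algebra_simps)
  show assoc: "c *\<^sub>C (d *\<^sub>C x) = (c * d) *\<^sub>C x" for c d :: complex and x :: "'a ell2"
    by transfer (auto simp: algebra_simps)
  show "a *\<^sub>R x = complex_of_real a *\<^sub>C x"
    by (fact scale_eq)
  show "a *\<^sub>R (x + y) = a *\<^sub>R x + a *\<^sub>R y" "(a + b) *\<^sub>R x = a *\<^sub>R x + b *\<^sub>R x"
    "a *\<^sub>R b *\<^sub>R x = (a * b) *\<^sub>R x"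
    by (simp_all add: scale_eq addr addl assoc)
  show "1 *\<^sub>R x = x"
    unfolding scale_eq by transfer simp
  show commute: "cinner x y = cnj (cinner y x)" for x y :: "'a ell2"
    unfolding cinner_ell2_def infsum_cnj[symmetric] by (simp add: mult.commute)
  show cadd: "cinner x (y + z) = cinner x y + cinner x z" for x y z :: "'a ell2"
    unfolding cinner_ell2_def plus_ell2.rep_eq by (simp add: distrib_left infsum_add summ)
  show cscale: "cinner x (c *\<^sub>C y) = c * cinner x y" for x y :: "'a ell2" and c
  proof -
    have "cinner x (c *\<^sub>C y) = (\<Sum>\<^sub>\<infinity>v. c * (cnj (apply_ell2 x v) * apply_ell2 y v))"
      unfolding cinner_ell2_def scaleC_ell2.rep_eq by (simp add: algebra_simps)
    then show ?thesis
      unfolding cinner_ell2_def by (simp add: infsum_cmult_right summ)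
  qed
  show "inner x y = Re (cinner x y)" by (fact inner_ell2_def)
  show comm: "inner x y = inner y x" for x y :: "'a ell2"
    unfolding inner_ell2_def by (subst commute) simp
  have addr': "inner x (y + z) = inner x y + inner x z" for x y z :: "'a ell2"
    unfolding inner_ell2_def by (simp add: cadd)
  show "inner (x + y) z = inner x z + inner y z"
    by (simp add: comm[of _ z] addr')
  show "inner (a *\<^sub>R x) y = a * inner x y"
    unfolding comm[of _ y] unfolding inner_ell2_def scale_eq by (simp add: cscale)
  have inner_self: "inner x x = (\<Sum>\<^sub>\<infinity>v. (cmod (apply_ell2 x v))\<^sup>2)" for x :: "'a ell2"
    unfolding inner_ell2_def cinner_ell2_def
    by (subst infsum_Re[OF summ, symmetric]) (simp add: cmod_power2, simp add: power2_eq_square)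
  show "0 \<le> inner x x"
    unfolding inner_self by (rule infsum_nonneg) simp
  show "norm x = sqrt (inner x x)"
    unfolding inner_self norm_ell2_def ..
  show "inner x x = 0 \<longleftrightarrow> x = 0"
  proof
    assume "inner x x = 0"
    then have "(cmod (apply_ell2 x v))\<^sup>2 = 0" for v
      using apply_ell2[of x] by (intro nonneg_infsum_le_0D[where A = UNIV]) (auto simp: inner_self)
    then show "x = 0" by transfer auto
  next
    assume "x = 0"
    then show "inner x x = 0" by (simp add: inner_self zero_ell2.rep_eq)
  qed
  show "sgn x = inverse (norm x) *\<^sub>R x" by (fact sgn_ell2_def)
  show "dist x y = norm (x - y)" by (fact dist_ell2_def)
  show "uniformity = (INF e\<in>{0<..}. principal {(\<phi>, \<psi> :: 'a ell2). dist \<phi> \<psi> < e})"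
    by (fact uniformity_ell2_def)
  show "open U = (\<forall>\<phi>\<in>U. \<forall>\<^sub>F (\<phi>', \<psi>) in uniformity. \<phi>' = \<phi> \<longrightarrow> \<psi> \<in> U)" for U :: "'a ell2 set"
    by (fact open_ell2_def)
qed

end

lift_definition delta :: "'v \<Rightarrow> 'v ell2" is "\<lambda>v x. if x = v then 1 else 0"
proof -
  fix v :: 'v
  have "(\<lambda>x. (cmod (if x = v then 1 else 0))\<^sup>2) summable_on UNIV \<longleftrightarrow>
      (\<lambda>x. (cmod (if x = v then 1 else 0))\<^sup>2) summable_on {v}"
    by (rule summable_on_cong_neutral) auto
  then show "(\<lambda>x. (cmod (if x = v then 1 else 0))\<^sup>2) summable_on UNIV"
    by simp
qed

text \<open>\<open>slice \<xi> j\<close> is the component \<open>\<xi>\<^sub>j\<close> in \<open>\<xi> = \<Sum>\<^sub>j \<delta>\<^sub>j \<otimes> \<xi>\<^sub>j\<close>.\<close>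

lift_definition slice :: "('a \<times> 'b) ell2 \<Rightarrow> 'a \<Rightarrow> 'b ell2" is "\<lambda>\<xi> j k. \<xi> (j, k)"
proof -
  fix \<xi> :: "'a \<times> 'b \<Rightarrow> complex" and j :: 'a
  assume "(\<lambda>x. (cmod (\<xi> x))\<^sup>2) summable_on UNIV"
  then have "(\<lambda>x. (cmod (\<xi> x))\<^sup>2) summable_on range (Pair j)"
    by (rule summable_on_subset_banach) simp
  then show "(\<lambda>k. (cmod (\<xi> (j, k)))\<^sup>2) summable_on UNIV"
    by (subst (asm) summable_on_reindex) (auto simp: o_def inj_on_def)
qed

section \<open>Operators\<close>

text \<open>Operators are plain functions on \<^typ>\<open>'v ell2\<close>. The norm of a bounded operator is
  \<^const>\<open>onorm\<close>.\<close>

definition exp_op :: "('v ell2 \<Rightarrow> 'v ell2) \<Rightarrow> 'v ell2 \<Rightarrow> 'v ell2" where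
  "exp_op T \<psi> = (\<Sum>n. (T ^^ n) \<psi> /\<^sub>R fact n)"

definition positive_op :: "('v ell2 \<Rightarrow> 'v ell2) \<Rightarrow> bool" where
  "positive_op T \<longleftrightarrow> bounded_linear T \<and> (\<forall>c \<psi>. T (c *\<^sub>C \<psi>) = c *\<^sub>C T \<psi>) \<and>
     (\<forall>\<psi>. cinner \<psi> (T \<psi>) \<in> \<real>\<^sub>\<ge>\<^sub>0)"

definition sqrt_op :: "('v ell2 \<Rightarrow> 'v ell2) \<Rightarrow> 'v ell2 \<Rightarrow> 'v ell2" where
  "sqrt_op T = (THE S. positive_op S \<and> S \<circ> S = T)"

text \<open>For an injective positive bounded operator \<open>T\<close>, the operator \<open>T\<^sup>-\<^sup>1\<^sup>/\<^sup>2\<close> has domain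
  \<^term>\<open>range (sqrt_op T)\<close>; the values of \<open>inv_sqrt_op T\<close> outside this domain are meaningless.\<close>

definition inv_sqrt_op :: "('v ell2 \<Rightarrow> 'v ell2) \<Rightarrow> 'v ell2 \<Rightarrow> 'v ell2" where
  "inv_sqrt_op T = inv (sqrt_op T)"

section \<open>Comb graphs\<close>

text \<open>A graph is given by its adjacency relation on a type of vertices.\<close>

definition comb ::
    "('a \<Rightarrow> 'a \<Rightarrow> bool) \<Rightarrow> ('b \<Rightarrow> 'b \<Rightarrow> bool) \<Rightarrow> 'b \<Rightarrow> 'a \<times> 'b \<Rightarrow> 'a \<times> 'b \<Rightarrow> bool" where
  "comb EG EK b0 = (\<lambda>(g, h) (g', h').
     (g = g' \<and> EK h h') \<or> (h = b0 \<and> h' = b0 \<and> EG g g'))"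

definition adj_Zd :: "(int ^ 'd) \<Rightarrow> (int ^ 'd) \<Rightarrow> bool" where
  "adj_Zd x y \<longleftrightarrow> (\<Sum>i\<in>UNIV. \<bar>x $ i - y $ i\<bar>) = 1"

definition adj_Z :: "int \<Rightarrow> int \<Rightarrow> bool" where
  "adj_Z x y \<longleftrightarrow> \<bar>x - y\<bar> = 1"

text \<open>For graphs of bounded degree, the function on the right-hand side is square-summable.\<close>

definition adj_op :: "('v \<Rightarrow> 'v \<Rightarrow> bool) \<Rightarrow> 'v ell2 \<Rightarrow> 'v ell2" where
  "adj_op E \<psi> = Abs_ell2 (\<lambda>x. \<Sum>y\<in>{y. E x y}. apply_ell2 \<psi> y)"

type_synonym 'd comb_vertex = "(int ^ 'd) \<times> int"

definition A_comb :: "'d::finite comb_vertex ell2 \<Rightarrow> 'd comb_vertex ell2" where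
  "A_comb = adj_op (comb adj_Zd adj_Z 0)"

definition H_comb :: "'d::finite comb_vertex ell2 \<Rightarrow> 'd comb_vertex ell2" where
  "H_comb \<psi> = onorm (A_comb :: 'd comb_vertex ell2 \<Rightarrow> _) *\<^sub>R \<psi> - A_comb \<psi>"

definition T_comb :: "real \<Rightarrow> 'd::finite comb_vertex ell2 \<Rightarrow> 'd comb_vertex ell2" where
  "T_comb t = exp_op (\<lambda>\<psi>. (\<i> * complex_of_real t) *\<^sub>C H_comb \<psi>)"

text \<open>\<open>e\<^sup>\<beta>\<^sup>H - I\<close>\<close>

definition bose_op :: "real \<Rightarrow> 'd::finite comb_vertex ell2 \<Rightarrow> 'd comb_vertex ell2" where
  "bose_op \<beta> \<psi> = exp_op (\<lambda>\<phi>. \<beta> *\<^sub>R H_comb \<phi>) \<psi> - \<psi>"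

definition S0 :: "'d::finite comb_vertex ell2 set" where
  "S0 = {\<xi>. \<forall>n::nat. \<exists>C. \<forall>j. (1 + norm (\<chi> i. real_of_int (j $ i))) ^ n * norm (slice \<xi> j) \<le> C}"

text \<open>The factor \<open>w\<close> of the generalized Perron--Frobenius vector \<open>v = u \<otimes> w\<close>, where \<open>a\<close> is the norm
  of the adjacency operator of the comb graph, and the pairing \<open>\<langle>v, \<xi>\<rangle>\<close> (\<open>u\<close> is constant \<open>1\<close>).\<close>

definition pf_w :: "real \<Rightarrow> int ell2" where
  "pf_w a = (let r = inv (\<lambda>\<psi>. a *\<^sub>R \<psi> - adj_op adj_Z \<psi>) (delta 0) in r /\<^sub>R norm r)"

definition pf_pairing :: "'d::finite comb_vertex ell2 \<Rightarrow> complex" where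
  "pf_pairing \<xi> =
     (\<Sum>\<^sub>\<infinity>j. cinner (pf_w (onorm (A_comb :: 'd comb_vertex ell2 \<Rightarrow> _))) (slice \<xi> j))"

text \<open>\<open>two_point \<beta> c \<xi> \<eta>\<close> is \<open>\<omega>(a\<^sup>+(\<xi>) a(\<eta>))\<close>; note that \<open>\<langle>\<eta>, v\<rangle>\<close> is the conjugate of \<open>\<langle>v, \<eta>\<rangle>\<close>.\<close>

definition two_point ::
    "real \<Rightarrow> real \<Rightarrow> 'd::finite comb_vertex ell2 \<Rightarrow> 'd comb_vertex ell2 \<Rightarrow> complex" where
  "two_point \<beta> c \<xi> \<eta> =
     cinner (inv_sqrt_op (bose_op \<beta>) \<eta>) (inv_sqrt_op (bose_op \<beta>) \<xi>) +
     complex_of_real (c / \<beta>) * cnj (pf_pairing \<eta>) * pf_pairing \<xi>"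

end

theory Submission
  imports Defs "HOL-Complex_Analysis.Complex_Analysis" "HOL-Probability.Sinc_Integral"
    "HOL-Real_Asymp.Real_Asymp"
begin

text \<open>
  Conjugation by \<open>W g\<close> multiplies \<open>W f\<close> by \<open>e\<^bsup>-i Im\<langle>g, f\<rangle>\<^esup>\<close>. Averaging over such conjugations kills
  frequencies, so in any C*-norm the coefficients of \<open>x = \<Sum> c\<^sub>f W f\<close> are bounded by \<open>\<parallel>x\<parallel>\<close>. Since finitely
  generated abelian groups grow polynomially, \<open>\<parallel>x\<parallel>\<^sup>2\<close> is therefore the limit of
  \<open>\<parallel>(x\<^sup>* x)\<^sup>n\<parallel>\<^sub>1\<^bsup>1/n\<^esup>\<close>, with the \<open>\<ell>\<^sup>1\<close>-norm of the coefficients. So every positive definite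
  function extends to a state and every symplectic map to an endomorphism.

  Positivity of the quasi-free functional is Schur's theorem for the exponential of a positive
  semidefinite kernel. The KMS condition on Weyl operators is a contour shift: the exponents of the two
  correlation functions are the values of one entire function on the two boundary lines of the strip
  \<open>0 \<le> Im z \<le> \<beta>\<close>.

  The Schur test gives both facts about the comb. The weight \<open>\<lambda>\<^bsup>|k|\<^esup>\<close> yields
  \<open>\<parallel>A\<parallel> = \<lambda> + 1/\<lambda> = 2\<lambda> + 2d\<close>. A superharmonic weight \<open>(63 + |j|\<^sup>2)\<^bsup>-1/4\<^esup> \<lambda>\<^bsup>|k|\<^esup>\<close>, which exists for
  \<open>d \<ge> 3\<close>, yields \<open>\<langle>\<psi>, H\<psi>\<rangle> \<ge> c \<parallel>\<psi>\<^sub>j\<parallel>\<^sup>2\<close> for every tooth \<open>j\<close>, and hence \<open>\<S>\<^sub>0 \<subseteq> \<D>((e\<^bsup>\<beta>H\<^esup> - I)\<^bsup>-1/2\<^esup>)\<close>.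
\<close>

section \<open>A square root in Banach algebras\<close>

text \<open>The algebra is given only through generators, relations and some C*-norm, so every
  estimate has to be extracted from that norm. Spectral calculus is replaced by one power series,
  that of the square root of 1 - h. In the C*-algebra it exhibits a multiple of 1 minus x* x as a
  square, which makes states contractive; among operators it produces the root of e^(beta H) - 1. An
  evolution is by definition only a group of algebraic automorphisms. Its continuity, on which both
  its uniqueness and the KMS integrals rest, is derived from the trace that vanishes on every W f
  with f nonzero: the evolution preserves it, and its GNS representation recovers the norm. Two
  points on the comb do not fit into Hilbert space methods. The vector v is not square-summable, so
  the invariance of the pairing under e^(itH) is proved by summing the exponential series in the
  decay seminorms that define \<open>S0\<close>. And e^(beta H) - 1 has no bounded inverse to work
  with, so membership in the domain of its inverse root is reduced to a bound by the quadratic form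
  of H, from which a preimage is found variationally.\<close>

definition sqrt_coeff :: "nat \<Rightarrow> real" where
  "sqrt_coeff n = (-1) ^ n * ((1/2) gchoose n)"

lemma sqrt_coeff_0 [simp]: "sqrt_coeff 0 = 1"
  by (simp add: sqrt_coeff_def)

lemma sqrt_coeff_Suc: "sqrt_coeff (Suc n) = sqrt_coeff n * (real n - 1/2) / (real n + 1)"
  by (simp add: sqrt_coeff_def gbinomial_absorption' gbinomial_prod_rev field_simps)

lemma sqrt_coeff_nonpos: "sqrt_coeff (Suc n) \<le> 0"
proof (induction n)
  case (Suc n)
  have "0 \<le> (real (Suc n) - 1/2) / (real (Suc n) + 1)"
    by simp
  with Suc show ?case
    by (subst sqrt_coeff_Suc) (metis mult_nonpos_nonneg times_divide_eq_right)
qed (simp add: sqrt_coeff_Suc)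

text \<open>The \<open>sqrt_coeff n\<close> are the Taylor coefficients of sqrt (1 - x). Their
  partial sums are those of (1 - x)^(-1/2), which is -2 times the derivative of sqrt (1 - x); hence
  the closed form, whose sign is known.\<close>

lemma sum_sqrt_coeff: "(\<Sum>k\<le>n. sqrt_coeff k) = - 2 * (real n + 1) * sqrt_coeff (Suc n)"
proof (induction n)
  case 0
  show ?case by (simp add: sqrt_coeff_Suc)
next
  case (Suc n)
  then show ?case
    using sqrt_coeff_Suc[of "Suc n"] by (simp add: field_simps)
qed

text \<open>Only the coefficient 1 at n = 0 is positive, so the absolute sum is 2 minus the signed
  one. This gives convergence on the whole closed unit ball, boundary included, and the value 2
  reappears in the positivity of the operator root.\<close>

lemma sum_abs_sqrt_coeff: "(\<Sum>k<n. \<bar>sqrt_coeff k\<bar>) \<le> 2"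
proof -
  have "(\<Sum>k<n. \<bar>sqrt_coeff k\<bar>) \<le> (\<Sum>k\<le>n. \<bar>sqrt_coeff k\<bar>)"
    by (rule sum_mono2) auto
  moreover
  have "(\<Sum>k\<le>n. \<bar>sqrt_coeff k\<bar>) = 2 - (\<Sum>k\<le>n. sqrt_coeff k)"
  proof (induction n)
    case (Suc n)
    then show ?case using sqrt_coeff_nonpos[of n] by simp
  qed simp
  moreover have "0 \<le> (\<Sum>k\<le>n. sqrt_coeff k)"
    unfolding sum_sqrt_coeff using sqrt_coeff_nonpos[of n] by (intro mult_nonpos_nonpos) simp_all
  ultimately show ?thesis by simp
qed

lemma summable_abs_sqrt_coeff: "summable (\<lambda>n. \<bar>sqrt_coeff n\<bar>)"
  by (rule summableI_nonneg_bounded[where x = 2])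
    (simp_all add: sum_abs_sqrt_coeff)

lemma suminf_abs_sqrt_coeff: "(\<Sum>n. \<bar>sqrt_coeff n\<bar>) \<le> 2"
  by (rule suminf_le_const[OF summable_abs_sqrt_coeff sum_abs_sqrt_coeff])

text \<open>Vandermonde's identity for 1/2 + 1/2 = 1: the square of the series is 1 - x.\<close>

lemma sqrt_coeff_convolution:
  "(\<Sum>i\<le>n. sqrt_coeff i * sqrt_coeff (n - i)) = (if n = 0 then 1 else if n = 1 then -1 else 0)"
proof -
  have "(\<Sum>i\<le>n. sqrt_coeff i * sqrt_coeff (n - i)) =
      (\<Sum>i=0..n. (-1) ^ n * (((1/2) gchoose i) * ((1/2) gchoose (n - i))))"
  proof (rule sum.cong)
    fix i assume "i \<in> {0..n}"
    then have "(-1::real) ^ n = (-1) ^ i * (-1) ^ (n - i)"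
      by (simp flip: power_add)
    then show "sqrt_coeff i * sqrt_coeff (n - i) =
        (-1) ^ n * (((1/2) gchoose i) * ((1/2) gchoose (n - i)))"
      by (simp add: sqrt_coeff_def)
  qed auto
  also have "\<dots> = (-1) ^ n * (1 gchoose n)"
    unfolding sum_distrib_left[symmetric] gbinomial_Vandermonde by simp
  also have "(1 gchoose n) = real (1 choose n)"
    by (metis binomial_gbinomial of_nat_1)
  finally show ?thesis
    by (auto simp: binomial_eq_0)
qed

definition sqrt_series :: "'a::{real_normed_algebra_1,banach} \<Rightarrow> 'a" where
  "sqrt_series h = (\<Sum>n. sqrt_coeff n *\<^sub>R h ^ n)"

lemma
  fixes h :: "'a::{real_normed_algebra_1,banach}"
  assumes "norm h \<le> 1"
  shows summable_norm_sqrt_series: "summable (\<lambda>n. norm (sqrt_coeff n *\<^sub>R h ^ n))"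
    and summable_sqrt_series: "summable (\<lambda>n. sqrt_coeff n *\<^sub>R h ^ n)"
proof -
  have "norm (h ^ n) \<le> 1" for n
    using norm_power_ineq[of h n] power_le_one[of "norm h" n] assms by simp
  then have "norm (sqrt_coeff n *\<^sub>R h ^ n) \<le> \<bar>sqrt_coeff n\<bar>" for n
    by (simp add: mult_left_le)
  then show 1: "summable (\<lambda>n. norm (sqrt_coeff n *\<^sub>R h ^ n))"
    by (intro summable_comparison_test'[OF summable_abs_sqrt_coeff]) simp
  show "summable (\<lambda>n. sqrt_coeff n *\<^sub>R h ^ n)"
    using 1 by (rule summable_norm_cancel)
qed

lemma sqrt_series_square:
  fixes h :: "'a::{real_normed_algebra_1,banach}"
  assumes "norm h \<le> 1"
  shows "sqrt_series h * sqrt_series h = 1 - h"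
proof -
  let ?f = "\<lambda>n. sqrt_coeff n *\<^sub>R h ^ n"
  have "(\<Sum>i\<le>n. ?f i * ?f (n - i)) = (if n \<in> {0, 1} then (if n = 0 then 1 else - h) else 0)" for n
  proof -
    have "(\<Sum>i\<le>n. ?f i * ?f (n - i)) = (\<Sum>i\<le>n. sqrt_coeff i * sqrt_coeff (n - i)) *\<^sub>R h ^ n"
      unfolding scaleR_left.sum by (rule sum.cong) (auto simp flip: power_add)
    then show ?thesis
      by (auto simp: sqrt_coeff_convolution)
  qed
  then have "(\<lambda>n. if n \<in> {0, 1} then (if n = 0 then 1 else - h) else 0) sums
      (sqrt_series h * sqrt_series h)"
    using Cauchy_product_sums[OF summable_norm_sqrt_series summable_norm_sqrt_series, OF assms assms]
    by (simp add: sqrt_series_def)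
  moreover have "(\<lambda>n. if n \<in> {0, 1::nat} then (if n = 0 then 1 else - h) else 0) sums
      (\<Sum>n\<in>{0, 1::nat}. if n = 0 then 1 else - h)"
    by (rule sums_If_finite_set) simp
  ultimately show ?thesis
    by (simp add: sums_iff)
qed

lemma sqrt_series_commute:
  fixes h x :: "'a::{real_normed_algebra_1,banach}"
  assumes "norm h \<le> 1" and "x * h = h * x"
  shows "x * sqrt_series h = sqrt_series h * x"
  unfolding sqrt_series_def
  by (simp add: suminf_mult[OF summable_sqrt_series[OF assms(1)], symmetric]
      suminf_mult2[OF summable_sqrt_series[OF assms(1)]] power_commuting_commutes[OF assms(2)[symmetric]])

section \<open>States\<close>

text \<open>The unit law is not among the axioms of \<open>complex_vector\<close>; it comes from the
  real scalar multiplication.\<close>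

interpretation CV: vector_space "scaleC :: complex \<Rightarrow> 'a::complex_vector \<Rightarrow> 'a"
  proof
  show "1 *\<^sub>C x = x" for x :: 'a
    using scaleR_scaleC[of 1 x] by simp
qed (simp_all add: scaleC_add_right scaleC_add_left scaleC_scaleC)

instantiation complex :: complex_vector
begin
definition scaleC_complex :: "complex \<Rightarrow> complex \<Rightarrow> complex" where
  "scaleC_complex c z = c * z"
instance
  by standard (simp_all add: scaleC_complex_def algebra_simps scaleR_conv_of_real)
end

text \<open>The core of every Cauchy-Schwarz inequality below: for positive functionals, for
  positive semidefinite kernels and for the inner product of l2. Degenerate forms with b = 0 are
  included, as seminorms require.\<close>

lemma discriminant_bound:
  fixes z :: complex
  assumes "b \<ge> 0" and nonneg: "\<And>t::complex. 0 \<le> a + 2 * Re (t * z) + (cmod t)\<^sup>2 * b"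
  shows "(cmod z)\<^sup>2 \<le> a * b"
proof (cases "b = 0")
  case False
  \<comment> \<open>The minimizer of the quadratic expression.\<close>
  define t where "t = - (cnj z / complex_of_real b)"
  have "Re (t * z) = - ((cmod z)\<^sup>2 / b)"
    by (simp add: t_def complex_norm_square[symmetric] mult.commute[of "cnj z"] divide_simps False
        flip: of_real_power)
  moreover have "(cmod t)\<^sup>2 * b = (cmod z)\<^sup>2 / b"
    using False assms(1) by (simp add: t_def norm_divide power_divide power2_eq_square)
  ultimately have "0 \<le> a - (cmod z)\<^sup>2 / b"
    using nonneg[of t] by simp
  then show ?thesis
    using False assms(1) by (simp add: field_simps)
next
  case True
  have "z = 0"
  proof (rule ccontr)
    assume "z \<noteq> 0"
    then have z: "(cmod z)\<^sup>2 > 0" by simp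
    \<comment> \<open>With b = 0 the expression is affine in t, so a large negative multiple of
      \<open>cnj z\<close> would make it negative.\<close>
    define s where "s = - ((\<bar>a\<bar> + 1) / (cmod z)\<^sup>2)"
    have "Re (complex_of_real s * cnj z * z) = s * (cmod z)\<^sup>2"
      by (simp add: mult.assoc mult.commute[of "cnj z"] complex_norm_square[symmetric]
          flip: of_real_power)
    then have "0 \<le> a + 2 * (s * (cmod z)\<^sup>2)"
      using nonneg[of "complex_of_real s * cnj z"] True by simp
    also have "s * (cmod z)\<^sup>2 = - (\<bar>a\<bar> + 1)"
      using z by (simp add: s_def)
    finally show False by simp
  qed
  then show ?thesis using True by simp
qed

lemma star_0 [simp]: "star (0::'a::cstar_algebra) = 0"
  by (metis add_cancel_right_right star_add)

lemma star_1 [simp]: "star (1::'a::cstar_algebra) = 1"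
  by (metis mult.right_neutral star_mult star_star)

lemma star_scaleR: "star (r *\<^sub>R x) = r *\<^sub>R star (x::'a::cstar_algebra)"
  by (simp add: scaleR_scaleC star_scaleC)

lemma star_power: "star (x ^ n) = star x ^ n" for x :: "'a::cstar_algebra"
  by (induction n) (simp_all add: star_mult power_commutes)

lemma norm_star [simp]: "norm (star x) = norm (x::'a::cstar_algebra)"
proof -
  have *: "norm x \<le> norm (star x)" for x :: 'a
    using norm_mult_ineq[of "star x" x] cstar_identity[of x]
    by (cases "norm x = 0") (auto simp: power2_eq_square)
  show ?thesis
    using *[of x] *[of "star x"] by (simp add: star_star)
qed

lemma bounded_linear_star: "bounded_linear (star :: 'a::cstar_algebra \<Rightarrow> 'a)"
  by (rule bounded_linear_intro[where K = 1]) (simp_all add: star_add star_scaleR)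

lemma bounded_linear_scaleC: "bounded_linear ((*\<^sub>C) c :: 'a::cstar_algebra \<Rightarrow> 'a)"
  by (rule bounded_linear_intro[where K = "cmod c"])
    (simp_all add: scaleC_add_right scaleR_scaleC scaleC_scaleC mult.commute norm_scaleC)

lemma star_sqrt_series:
  fixes h :: "'a::cstar_algebra"
  assumes "norm h \<le> 1" and "star h = h"
  shows "star (sqrt_series h) = sqrt_series h"
  unfolding sqrt_series_def
  by (simp add: bounded_linear.suminf[OF bounded_linear_star summable_sqrt_series[OF assms(1)]]
      star_scaleR star_power assms(2))

text \<open>By the C*-identity, x* x divided by the square of the norm of x has norm 1, which the
  square root series still admits. Evaluating a state on the resulting square gives bounds that
  otherwise need spectral theory.\<close>

lemma norm_square_minus_square:
  obtains s :: "'a::cstar_algebra" where "star s * s = (norm x)\<^sup>2 *\<^sub>R 1 - star x * x"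
proof (cases "x = 0")
  case True
  then show ?thesis using that[of 0] by simp
next
  case False
  define h where "h = (1 / (norm x)\<^sup>2) *\<^sub>R (star x * x)"
  have h: "norm h \<le> 1" "star h = h"
    using False by (simp_all add: h_def cstar_identity star_scaleR star_mult star_star)
  have "star (norm x *\<^sub>R sqrt_series h) * (norm x *\<^sub>R sqrt_series h) = (norm x)\<^sup>2 *\<^sub>R (1 - h)"
    by (simp add: star_scaleR star_sqrt_series[OF h] sqrt_series_square[OF h(1)] power2_eq_square)
  also have "\<dots> = (norm x)\<^sup>2 *\<^sub>R 1 - star x * x"
    using False by (simp add: h_def scaleR_diff_right)
  finally show ?thesis using that by blast
qed

text \<open>Linearity is global but positivity is asked only on M: a functional prescribed on Weyl
  operators is first positive on their span, and becomes a state only after it is known to be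
  bounded there. States are the case M = UNIV.\<close>

locale positive_functional =
  fixes \<omega> :: "'a::cstar_algebra \<Rightarrow> complex" and M :: "'a set"
  assumes add: "\<omega> (a + b) = \<omega> a + \<omega> b"
    and scaleC: "\<omega> (c *\<^sub>C a) = c * \<omega> a"
    and add_mem: "a \<in> M \<Longrightarrow> b \<in> M \<Longrightarrow> a + b \<in> M"
    and scaleC_mem: "a \<in> M \<Longrightarrow> c *\<^sub>C a \<in> M"
    and nonneg: "a \<in> M \<Longrightarrow> \<omega> (star a * a) \<in> \<real>\<^sub>\<ge>\<^sub>0"
begin

definition seminorm :: "'a \<Rightarrow> real" where
  "seminorm x = sqrt (Re (\<omega> (star x * x)))"

lemma Re_nonneg: "a \<in> M \<Longrightarrow> 0 \<le> Re (\<omega> (star a * a))"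
  and Im_eq_0: "a \<in> M \<Longrightarrow> Im (\<omega> (star a * a)) = 0"
  using nonneg[of a] by (simp_all add: complex_nonneg_Reals_iff)

lemma seminorm_nonneg: "x \<in> M \<Longrightarrow> 0 \<le> seminorm x"
  and seminorm_square: "x \<in> M \<Longrightarrow> (seminorm x)\<^sup>2 = Re (\<omega> (star x * x))"
  using Re_nonneg[of x] by (simp_all add: seminorm_def)

lemma scaleR: "\<omega> (r *\<^sub>R a) = of_real r * \<omega> a"
  by (simp add: scaleR_scaleC scaleC)

lemma minus: "\<omega> (- a) = - \<omega> a"
  using scaleR[of "-1" a] by simp

lemma diff: "\<omega> (a - b) = \<omega> a - \<omega> b"
  using add[of a "- b"] by (simp add: minus)

lemma expand_square:
  "\<omega> (star (x + t *\<^sub>C y) * (x + t *\<^sub>C y)) =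
   \<omega> (star x * x) + t * \<omega> (star x * y) + cnj t * \<omega> (star y * x)
     + of_real ((cmod t)\<^sup>2) * \<omega> (star y * y)"
proof -
  have "star (x + t *\<^sub>C y) * (x + t *\<^sub>C y) = star x * x + t *\<^sub>C (star x * y)
      + (cnj t *\<^sub>C (star y * x) + (cnj t * t) *\<^sub>C (star y * y))"
    by (simp add: star_add star_scaleC distrib_left distrib_right mult_scaleC_left mult_scaleC_right
        scaleC_scaleC scaleC_add_right mult.commute)
  then show ?thesis
    by (simp add: add scaleC complex_norm_square[symmetric] mult.commute[of "cnj t" t])
qed

lemma hermitian:
  assumes "x \<in> M" "y \<in> M"
  shows "\<omega> (star y * x) = cnj (\<omega> (star x * y))"
proof -
  have *: "Im (t * \<omega> (star x * y) + cnj t * \<omega> (star y * x)) = 0" for t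
    using Im_eq_0[OF assms(1)] Im_eq_0[OF assms(2)]
      Im_eq_0[OF add_mem[OF assms(1) scaleC_mem[OF assms(2), of t]]]
    unfolding expand_square by simp
  show ?thesis
    using *[of 1] *[of \<i>] by (simp add: complex_eq_iff)
qed

lemma cauchy_schwarz:
  assumes "x \<in> M" "y \<in> M"
  shows "cmod (\<omega> (star x * y)) \<le> seminorm x * seminorm y"
proof (rule power2_le_imp_le)
  have "(cmod (\<omega> (star x * y)))\<^sup>2 \<le> Re (\<omega> (star x * x)) * Re (\<omega> (star y * y))"
  proof (rule discriminant_bound)
    fix t
    have "Re (cnj t * \<omega> (star y * x)) = Re (t * \<omega> (star x * y))"
      unfolding hermitian[OF assms] by simp
    then show "0 \<le> Re (\<omega> (star x * x)) + 2 * Re (t * \<omega> (star x * y)) + (cmod t)\<^sup>2 * Re (\<omega> (star y * y))"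
      using Re_nonneg[OF add_mem[OF assms(1) scaleC_mem[OF assms(2), of t]]]
      unfolding expand_square by simp
  qed (rule Re_nonneg assms)+
  then show "(cmod (\<omega> (star x * y)))\<^sup>2 \<le> (seminorm x * seminorm y)\<^sup>2"
    using assms by (simp add: power_mult_distrib seminorm_square)
qed (simp add: seminorm_nonneg assms)

lemma seminorm_triangle:
  assumes "x \<in> M" "y \<in> M"
  shows "seminorm (x + y) \<le> seminorm x + seminorm y"
proof (rule power2_le_imp_le)
  have "Re (\<omega> (star y * x)) = Re (\<omega> (star x * y))"
    unfolding hermitian[OF assms] by simp
  then have "(seminorm (x + y))\<^sup>2 = (seminorm x)\<^sup>2 + 2 * Re (\<omega> (star x * y)) + (seminorm y)\<^sup>2"
    using expand_square[of x 1 y] assms by (simp add: seminorm_square add_mem)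
  also have "Re (\<omega> (star x * y)) \<le> seminorm x * seminorm y"
    using complex_Re_le_cmod cauchy_schwarz[OF assms] by (rule order_trans)
  finally show "(seminorm (x + y))\<^sup>2 \<le> (seminorm x + seminorm y)\<^sup>2"
    by (simp add: power2_sum)
qed (simp add: seminorm_nonneg assms)

end

lemma positive_functional_state: "is_state \<omega> \<Longrightarrow> positive_functional \<omega> UNIV"
  by (simp add: is_state_def positive_functional_def)

locale state =
  fixes \<omega> :: "'a::cstar_algebra \<Rightarrow> complex"
  assumes state: "is_state \<omega>"
begin

sublocale positive_functional \<omega> UNIV
  using state by (rule positive_functional_state)

lemma one: "\<omega> 1 = 1"
  using state by (simp add: is_state_def)

text \<open>Left multiplication is bounded on the GNS space: with s* s = norm(z)^2 - z* z, the value
  of the state at (s c)* (s c) is nonnegative. The case c = 1 yields contractivity of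
  states.\<close>

lemma seminorm_mult_le: "seminorm (z * c) \<le> norm z * seminorm c"
proof (rule power2_le_imp_le)
  obtain s where s: "star s * s = (norm z)\<^sup>2 *\<^sub>R 1 - star z * z"
    by (rule norm_square_minus_square)
  have "star (s * c) * (s * c) = star c * (star s * s) * c"
    by (simp add: star_mult mult.assoc)
  also have "\<dots> = (norm z)\<^sup>2 *\<^sub>R (star c * c) - star (z * c) * (z * c)"
    unfolding s by (simp add: algebra_simps star_mult)
  finally show "(seminorm (z * c))\<^sup>2 \<le> (norm z * seminorm c)\<^sup>2"
    using Re_nonneg[of "s * c"]
    by (simp add: diff scaleR seminorm_square power_mult_distrib)
qed (simp add: seminorm_nonneg)

lemma norm_le: "cmod (\<omega> a) \<le> norm a"
proof -
  have [simp]: "seminorm 1 = 1"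
    by (simp add: seminorm_def one)
  show ?thesis
    using cauchy_schwarz[of 1 a] seminorm_mult_le[of a 1] by simp
qed

lemma bounded_linear: "bounded_linear \<omega>"
  by (rule bounded_linear_intro[where K = 1])
    (simp_all only: add scaleR norm_le scaleR_conv_of_real[where 'a = complex] mult_1_right)

end

lemma bounded_linear_extension:
  fixes f :: "'a::real_normed_vector \<Rightarrow> 'b::banach"
  assumes M: "subspace M" "closure M = UNIV"
    and add: "\<And>x y. x \<in> M \<Longrightarrow> y \<in> M \<Longrightarrow> f (x + y) = f x + f y"
    and scaleR: "\<And>r x. x \<in> M \<Longrightarrow> f (r *\<^sub>R x) = r *\<^sub>R f x"
    and bound: "\<And>x. x \<in> M \<Longrightarrow> norm (f x) \<le> norm x"
  obtains g where "bounded_linear g" "\<And>x. x \<in> M \<Longrightarrow> g x = f x" "\<And>x. norm (g x) \<le> norm x"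
proof -
  have minus: "f (x - y) = f x - f y" if "x \<in> M" "y \<in> M" for x y
    using add[OF that(1) subspace_scale[OF M(1) that(2), of "-1"]] scaleR[OF that(2), of "-1"]
    by simp
  have "uniformly_continuous_on M f"
    unfolding uniformly_continuous_on_def dist_norm
  proof (intro allI impI)
    fix e :: real assume "e > 0"
    then show "\<exists>d>0. \<forall>x\<in>M. \<forall>x'\<in>M. norm (x' - x) < d \<longrightarrow> norm (f x' - f x) < e"
      using bound[OF subspace_diff[OF M(1)]] minus
      by (intro exI[of _ e]) (auto intro: order_le_less_trans)
  qed
  then obtain g where g: "uniformly_continuous_on (closure M) g"
      and fg: "\<And>x. x \<in> M \<Longrightarrow> f x = g x"
    by (rule uniformly_continuous_on_extension_on_closure) blast
  have cont: "continuous_on UNIV g"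
    using uniformly_continuous_imp_continuous[OF g] M(2) by simp
  have lim: "(\<lambda>n. g (s n)) \<longlonglongrightarrow> g x" if "s \<longlonglongrightarrow> x" for s x
    using continuous_on_tendsto_compose[OF cont that] by simp
  have approx: "\<exists>s. (\<forall>n::nat. s n \<in> M) \<and> s \<longlonglongrightarrow> x" for x
    using M(2) closure_sequential[of x M] by auto
  have bl: "norm (g x) \<le> norm x" for x
  proof -
    obtain s where s: "\<And>n::nat. s n \<in> M" "s \<longlonglongrightarrow> x" using approx by blast
    show ?thesis
      using bound fg s by (intro LIMSEQ_le[OF tendsto_norm[OF lim] tendsto_norm]) auto
  qed
  have "bounded_linear g"
  proof (rule bounded_linear_intro[where K = 1])
    fix x y r
    obtain s where s: "\<And>n::nat. s n \<in> M" "s \<longlonglongrightarrow> x" using approx by blast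
    obtain t where t: "\<And>n::nat. t n \<in> M" "t \<longlonglongrightarrow> y" using approx by blast
    have "g (s n + t n) = g (s n) + g (t n)" for n
      using add[of "s n" "t n"] s t by (simp add: fg subspace_add[OF M(1)])
    then have "(\<lambda>n. g (s n) + g (t n)) \<longlonglongrightarrow> g (x + y)"
      using lim[OF tendsto_add[OF s(2) t(2)]] by simp
    then show "g (x + y) = g x + g y"
      by (rule LIMSEQ_unique) (intro tendsto_add lim s t)
    have gr: "g (r *\<^sub>R s n) = r *\<^sub>R g (s n)" for n
      using scaleR[of "s n"] s by (simp add: fg subspace_scale[OF M(1)])
    have "(\<lambda>n. r *\<^sub>R g (s n)) \<longlonglongrightarrow> g (r *\<^sub>R x)"
      using lim[OF tendsto_scaleR[OF tendsto_const s(2)], of r] by (simp only: gr)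
    then show "g (r *\<^sub>R x) = r *\<^sub>R g x"
      by (rule LIMSEQ_unique) (intro tendsto_intros lim s)
  qed (simp add: bl)
  then show thesis
    using that[of g] bl fg by simp
qed

lemma bounded_linear_eq_on_dense:
  assumes "bounded_linear f" "bounded_linear g" "closure M = UNIV" "\<And>x. x \<in> M \<Longrightarrow> f x = g x"
  shows "f x = g x"
proof -
  have "closed {x. f x = g x}"
    by (intro closed_Collect_eq linear_continuous_on assms)
  then have "closure M \<subseteq> {x. f x = g x}"
    using assms(4) by (intro closure_minimal) auto
  then show ?thesis using assms(3) by auto
qed

section \<open>Weyl systems\<close>

locale weyl_system =
  fixes S :: "'h::complex_inner set" and W :: "'h \<Rightarrow> 'a::cstar_algebra"
  assumes CCR: "is_CCR S W"
    and zero_mem: "0 \<in> S"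
    and add_mem: "f \<in> S \<Longrightarrow> g \<in> S \<Longrightarrow> f + g \<in> S"
    and scaleC_mem: "f \<in> S \<Longrightarrow> c *\<^sub>C f \<in> S"

lemma cinner_add_left: "cinner (x + y) z = cinner x z + cinner y (z :: 'h::complex_inner)"
  by (subst (1 2 3) cinner_commute) (simp add: cinner_add_right)

lemma cinner_scaleC_left: "cinner (c *\<^sub>C x) y = cnj c * cinner x (y :: 'h::complex_inner)"
  by (subst (1 2) cinner_commute) (simp add: cinner_scaleC_right)

lemma cinner_0_right [simp]: "cinner x (0 :: 'h::complex_inner) = 0"
  using cinner_add_right[of x 0 0] by simp

lemma cinner_0_left [simp]: "cinner (0 :: 'h::complex_inner) x = 0"
  using cinner_add_left[of 0 0 x] by simp

lemma cinner_minus_right: "cinner x (- y :: 'h::complex_inner) = - cinner x y"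
  using cinner_add_right[of x y "- y"] by (simp add: eq_neg_iff_add_eq_0 add.commute)

lemma cinner_minus_left: "cinner (- x :: 'h::complex_inner) y = - cinner x y"
  using cinner_add_left[of x "- x" y] by (simp add: eq_neg_iff_add_eq_0 add.commute)

lemma cinner_diff_right: "cinner x (y - z :: 'h::complex_inner) = cinner x y - cinner x z"
  using cinner_add_right[of x y "- z"] by (simp add: cinner_minus_right)

lemma cinner_diff_left: "cinner (x - y :: 'h::complex_inner) z = cinner x z - cinner y z"
  using cinner_add_left[of x "- y" z] by (simp add: cinner_minus_left)

lemma cinner_self: "cinner x (x :: 'h::complex_inner) = of_real ((norm x)\<^sup>2)"
proof -
  have "Im (cinner x x) = 0"
    using cinner_commute[of x x] by (simp add: complex_eq_iff)
  then show ?thesis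
    by (simp add: complex_eq_iff power2_norm_eq_inner inner_eq_Re_cinner)
qed

lemma Im_cinner_self [simp]: "Im (cinner x (x :: 'h::complex_inner)) = 0"
  by (simp add: cinner_self)

lemma CV_minus_one: "(-1) *\<^sub>C x = - (x :: 'h::complex_vector)"
  using CV.scale_minus_left[of 1 x] by simp

context weyl_system
begin

lemma minus_mem: "f \<in> S \<Longrightarrow> - f \<in> S"
  using scaleC_mem[of f "-1"] by (simp only: CV_minus_one)

lemma diff_mem: "f \<in> S \<Longrightarrow> g \<in> S \<Longrightarrow> f - g \<in> S"
  using add_mem[of f "- g"] minus_mem by simp

definition phase :: "'h \<Rightarrow> 'h \<Rightarrow> complex" where
  "phase f g = exp (- (\<i> / 2) * complex_of_real (Im (cinner f g)))"

lemma weyl_mult: "f \<in> S \<Longrightarrow> g \<in> S \<Longrightarrow> W f * W g = phase f g *\<^sub>C W (f + g)"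
  using CCR by (simp add: is_CCR_def phase_def)

lemma unitary: "f \<in> S \<Longrightarrow> star (W f) * W f = 1" "f \<in> S \<Longrightarrow> W f * star (W f) = 1"
  using CCR by (simp_all add: is_CCR_def is_unitary_def)

lemma weyl_zero [simp]: "W 0 = 1"
proof -
  have "W 0 * W 0 = W 0"
    using weyl_mult[OF zero_mem zero_mem] by (simp add: phase_def)
  then have "star (W 0) * (W 0 * W 0) = star (W 0) * W 0"
    by simp
  then show ?thesis
    using unitary(1)[OF zero_mem] by (simp add: mult.assoc[symmetric])
qed

lemma weyl_minus_mult: "f \<in> S \<Longrightarrow> W f * W (- f) = 1" "f \<in> S \<Longrightarrow> W (- f) * W f = 1"
  using weyl_mult[of f "- f"] weyl_mult[of "- f" f] minus_mem[of f]
  by (simp_all add: phase_def cinner_minus_right cinner_minus_left)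

lemma star_weyl: "f \<in> S \<Longrightarrow> star (W f) = W (- f)"
  using unitary(1)[of f] weyl_minus_mult(1)[of f]
  by (metis mult.assoc mult_1 mult_1_right)

lemma norm_weyl: "f \<in> S \<Longrightarrow> norm (W f) = 1"
  using cstar_identity[of "W f"] norm_ge_zero[of "W f"] by (simp add: unitary power2_eq_1_iff)

lemma weyl_conjugate:
  assumes "f \<in> S" "g \<in> S"
  shows "W g * W f * W (- g) = exp (- \<i> * complex_of_real (Im (cinner g f))) *\<^sub>C W f"
proof -
  have "Im (cinner (g + f) (- g)) = Im (cinner g f)"
    using cinner_commute[of f g] by (simp add: cinner_add_left cinner_minus_right)
  then show ?thesis
    using assms
    by (simp add: weyl_mult add_mem minus_mem mult_scaleC_left scaleC_scaleC phase_def flip: exp_add)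
qed

lemma norm_weyl_conjugate_le:
  assumes "g \<in> S"
  shows "norm (W g * x * W (- g)) \<le> norm x"
proof -
  have "norm (W g * x * W (- g)) \<le> norm (W g) * norm x * norm (W (- g))"
    by (meson norm_mult_ineq mult_right_mono norm_ge_zero order_trans)
  then show ?thesis
    using assms by (simp add: norm_weyl minus_mem)
qed

text \<open>Averaging over conjugation by a suitable \<open>W g\<close> removes one nonzero frequency, does not
  increase the norm, and keeps the constant term.\<close>

lemma constant_term_bound:
  assumes "finite F" "F \<subseteq> S - {0}"
  shows "cmod a \<le> norm (a *\<^sub>C 1 + (\<Sum>f\<in>F. c f *\<^sub>C W f))"
  using assms
proof (induction F arbitrary: c rule: finite_induct)
  case empty
  then show ?case by (simp add: norm_scaleC)
next
  case (insert f F)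
  \<comment> \<open>Chosen so that Im of \<open>cinner g f\<close> is pi: conjugation by
    \<open>W g\<close> then reverses the sign of \<open>W f\<close>. This uses that S admits complex
    multiples.\<close>
  define g where "g = (- \<i> * complex_of_real (pi / (norm f)\<^sup>2)) *\<^sub>C f"
  define e where "e h = exp (- \<i> * complex_of_real (Im (cinner g h)))" for h
  have f: "f \<in> S" "f \<noteq> 0" and F: "F \<subseteq> S - {0}"
    using insert.prems by auto
  have g: "g \<in> S"
    unfolding g_def using f(1) by (rule scaleC_mem)
  have "cinner g f = \<i> * complex_of_real pi"
    using f unfolding g_def cinner_scaleC_left cinner_self by simp
  then have ef: "e f = -1"
    by (simp add: e_def exp_minus)
  define x where "x = a *\<^sub>C 1 + (\<Sum>h\<in>insert f F. c h *\<^sub>C W h)"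
  have "W g * x * W (- g) = a *\<^sub>C (W g * W (- g)) + (\<Sum>h\<in>insert f F. c h *\<^sub>C (W g * W h * W (- g)))"
    unfolding x_def
    by (simp add: distrib_left distrib_right sum_distrib_left sum_distrib_right mult_scaleC_left
        mult_scaleC_right del: sum.insert)
  also have "(\<Sum>h\<in>insert f F. c h *\<^sub>C (W g * W h * W (- g))) = (\<Sum>h\<in>insert f F. (c h * e h) *\<^sub>C W h)"
    using insert.prems g by (intro sum.cong) (auto simp: weyl_conjugate scaleC_scaleC e_def)
  finally have gx: "W g * x * W (- g) = a *\<^sub>C 1 + (\<Sum>h\<in>insert f F. (c h * e h) *\<^sub>C W h)"
    using g by (simp add: weyl_minus_mult)
  \<comment> \<open>The factor 1 + e h vanishes at h = f. The other coefficients change, which is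
    why the induction runs over arbitrary c.\<close>
  have "x + W g * x * W (- g) = 2 *\<^sub>R (a *\<^sub>C 1 + (\<Sum>h\<in>F. (c h * (1 + e h) / 2) *\<^sub>C W h))"
  proof -
    have "2 *\<^sub>R (\<Sum>h\<in>F. (c h * (1 + e h) / 2) *\<^sub>C W h) = (\<Sum>h\<in>F. (c h + c h * e h) *\<^sub>C W h)"
      unfolding scaleR_scaleC CV.scale_sum_right scaleC_scaleC
    proof (rule sum.cong[OF refl])
      fix h
      have "complex_of_real 2 * (c h * (1 + e h) / 2) = c h + c h * e h"
        by (simp add: distrib_left)
      then show "(complex_of_real 2 * (c h * (1 + e h) / 2)) *\<^sub>C W h = (c h + c h * e h) *\<^sub>C W h"
        by (simp only:)
    qed
    moreover have "a *\<^sub>C 1 + a *\<^sub>C 1 = 2 *\<^sub>R (a *\<^sub>C (1::'a))"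
      by (simp only: scaleR_2)
    ultimately show ?thesis
      unfolding gx unfolding x_def using insert.hyps
      by (simp add: ef scaleR_add_right scaleC_add_left sum.distrib CV.scale_minus_left)
  qed
  then have "2 * norm (a *\<^sub>C 1 + (\<Sum>h\<in>F. (c h * (1 + e h) / 2) *\<^sub>C W h)) = norm (x + W g * x * W (- g))"
    by simp
  also have "\<dots> \<le> norm x + norm (W g * x * W (- g))"
    by (rule norm_triangle_ineq)
  also have "\<dots> \<le> 2 * norm x"
    using norm_weyl_conjugate_le[OF g, of x] by simp
  finally show ?case
    using insert.IH[OF F, of "\<lambda>h. c h * (1 + e h) / 2"] by (simp add: x_def)
qed

text \<open>Multiplication by the unitary \<open>W (- f)\<close> turns the coefficient of f into the
  constant term, to which \<open>constant_term_bound\<close> applies.\<close>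

lemma coefficient_bound:
  assumes "finite F" "F \<subseteq> S" "f \<in> F"
  shows "cmod (c f) \<le> norm (\<Sum>h\<in>F. c h *\<^sub>C W h)"
proof -
  define x where "x = (\<Sum>h\<in>F. c h *\<^sub>C W h)"
  have f: "f \<in> S" using assms by auto
  have "x = c f *\<^sub>C W f + (\<Sum>h\<in>F - {f}. c h *\<^sub>C W h)"
    unfolding x_def using assms by (simp add: sum.remove)
  then have "x * W (- f) = c f *\<^sub>C 1 + (\<Sum>h\<in>F - {f}. c h *\<^sub>C (W h * W (- f)))"
    using f by (simp add: distrib_right sum_distrib_right mult_scaleC_left weyl_minus_mult)
  also have "(\<Sum>h\<in>F - {f}. c h *\<^sub>C (W h * W (- f))) =
      (\<Sum>h\<in>F - {f}. (c h * phase h (- f)) *\<^sub>C W (h - f))"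
    using assms f minus_mem by (intro sum.cong) (auto simp: weyl_mult scaleC_scaleC)
  also have "\<dots> = (\<Sum>k\<in>(\<lambda>h. h - f) ` (F - {f}). (c (k + f) * phase (k + f) (- f)) *\<^sub>C W k)"
    by (subst sum.reindex) (auto simp: inj_on_def)
  finally have "x * W (- f) = c f *\<^sub>C 1 +
      (\<Sum>k\<in>(\<lambda>h. h - f) ` (F - {f}). (c (k + f) * phase (k + f) (- f)) *\<^sub>C W k)" .
  moreover have "(\<lambda>h. h - f) ` (F - {f}) \<subseteq> S - {0}"
    using assms f diff_mem by auto
  ultimately have "cmod (c f) \<le> norm (x * W (- f))"
    using constant_term_bound[of "(\<lambda>h. h - f) ` (F - {f})" "c f"
        "\<lambda>k. c (k + f) * phase (k + f) (- f)"] assms(1) by simp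
  also have "\<dots> \<le> norm x"
    using norm_mult_ineq[of x "W (- f)"] f by (simp add: norm_weyl minus_mem)
  finally show ?thesis by (simp add: x_def)
qed

lemma inj_on_weyl: "inj_on W S"
proof (rule inj_onI, rule ccontr)
  fix f g assume fg: "f \<in> S" "g \<in> S" "W f = W g" "f \<noteq> g"
  have "(\<Sum>h\<in>{f, g}. (if h = f then 1 else -1) *\<^sub>C W h) = W f - W g"
    using fg(4) by (simp add: CV_minus_one)
  then show False
    using coefficient_bound[of "{f, g}" f "\<lambda>h. if h = f then 1 else -1"] fg by simp
qed

lemma span_finite_repr:
  assumes "finite F" "F \<subseteq> S" "x \<in> CV.span (W ` F)"
  obtains c where "x = (\<Sum>f\<in>F. c f *\<^sub>C W f)"
proof -
  obtain u where "x = (\<Sum>w\<in>W ` F. u w *\<^sub>C w)"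
    using assms(3) CV.span_finite[OF finite_imageI[OF assms(1)], of W] by auto
  also have "\<dots> = (\<Sum>f\<in>F. u (W f) *\<^sub>C W f)"
    using assms(2) inj_on_weyl by (subst sum.reindex) (auto intro: inj_on_subset)
  finally show thesis by (rule that)
qed

lemma span_repr:
  assumes "x \<in> CV.span (W ` S)"
  obtains F c where "finite F" "F \<subseteq> S" "x = (\<Sum>f\<in>F. c f *\<^sub>C W f)"
proof -
  obtain T u where T: "finite T" "T \<subseteq> W ` S" "x = (\<Sum>w\<in>T. u w *\<^sub>C w)"
    using assms unfolding CV.span_explicit by auto
  then obtain F where F: "finite F" "F \<subseteq> S" "T = W ` F"
    using finite_subset_image[OF T(1,2)] by metis
  have "x = (\<Sum>f\<in>F. u (W f) *\<^sub>C W f)"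
    using T(3) F inj_on_subset[OF inj_on_weyl F(2)] by (simp add: sum.reindex)
  then show thesis
    by (rule that[OF F(1,2)])
qed

lemma independent_weyl: "CV.independent (W ` S)"
proof -
  have "u v = 0" if fin: "finite T" and sub: "T \<subseteq> W ` S"
    and sum0: "(\<Sum>v\<in>T. u v *\<^sub>C v) = 0" and v: "v \<in> T" for T u v
  proof -
    obtain F where F: "F \<subseteq> S" "finite F" "T = W ` F"
      using finite_subset_image[OF fin sub] by metis
    obtain f where f: "f \<in> F" "v = W f"
      using v F by auto
    have "(\<Sum>f\<in>F. u (W f) *\<^sub>C W f) = 0"
      using sum0 F inj_on_subset[OF inj_on_weyl F(1)] by (simp add: sum.reindex)
    then show ?thesis
      using coefficient_bound[OF F(2,1) f(1), of "\<lambda>f. u (W f)"] f by simp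
  qed
  then show ?thesis
    unfolding CV.dependent_explicit by blast
qed

section \<open>The dense *-subalgebra of Weyl polynomials and the growth of its powers\<close>

abbreviation M where "M \<equiv> CV.span (W ` S)"

lemma weyl_mem: "f \<in> S \<Longrightarrow> W f \<in> M"
  by (simp add: CV.span_base)

lemma one_mem: "1 \<in> M"
  using weyl_mem[OF zero_mem] by simp

lemma subspace_M: "subspace M"
  by (simp add: subspace_def CV.span_zero CV.span_add scaleR_scaleC CV.span_scale)

lemma span_mult:
  assumes "\<And>f g. f \<in> F \<Longrightarrow> g \<in> G \<Longrightarrow> W f * W g \<in> CV.span U"
    and "x \<in> CV.span (W ` F)" "y \<in> CV.span (W ` G)"
  shows "x * y \<in> CV.span U"
  using assms(2)
proof (induction rule: CV.span_induct_alt)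
  case base
  then show ?case by (simp add: CV.span_zero)
next
  case (step c w z)
  obtain f where f: "f \<in> F" "w = W f" using step by auto
  have "W f * y \<in> CV.span U"
    using assms(3)
  proof (induction rule: CV.span_induct_alt)
    case base
    then show ?case by (simp add: CV.span_zero)
  next
    case (step c w z)
    then show ?case
      using assms(1)[OF f(1)]
      by (auto simp: distrib_left mult_scaleC_right intro!: CV.span_add CV.span_scale)
  qed
  then show ?case
    using f step by (simp add: distrib_right mult_scaleC_left CV.span_add CV.span_scale)
qed

lemma mult_mem: "x \<in> M \<Longrightarrow> y \<in> M \<Longrightarrow> x * y \<in> M"
  by (rule span_mult) (auto simp: weyl_mult add_mem weyl_mem CV.span_scale)

lemma star_mem: "x \<in> M \<Longrightarrow> star x \<in> M"
proof (induction rule: CV.span_induct_alt)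
  case (step c w z)
  then show ?case
    by (auto simp: star_add star_scaleC star_weyl minus_mem weyl_mem intro!: CV.span_add CV.span_scale)
qed (simp add: CV.span_zero)

lemma power_mem: "x \<in> M \<Longrightarrow> x ^ n \<in> M"
  by (induction n) (simp_all add: one_mem mult_mem)

lemma dense: "closure M = UNIV"
proof -
  have lim: "x \<in> closure M \<longleftrightarrow> (\<exists>s. (\<forall>n::nat. s n \<in> M) \<and> s \<longlonglongrightarrow> x)" for x
    by (rule closure_sequential)
  have "cstar_subalgebra (closure M)"
    unfolding cstar_subalgebra_def
  proof (intro conjI ballI allI)
    show "0 \<in> closure M"
      using closure_subset CV.span_zero by blast
    fix a b assume "a \<in> closure M" "b \<in> closure M"
    then obtain s t where st: "\<And>n::nat. s n \<in> M" "s \<longlonglongrightarrow> a" "\<And>n::nat. t n \<in> M" "t \<longlonglongrightarrow> b"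
      unfolding lim by blast
    show "a + b \<in> closure M"
      unfolding lim by (rule exI[of _ "\<lambda>n. s n + t n"]) (auto intro: CV.span_add st tendsto_add)
    show "a * b \<in> closure M"
      unfolding lim by (rule exI[of _ "\<lambda>n. s n * t n"]) (auto intro: mult_mem st tendsto_mult)
  next
    fix a c assume "a \<in> closure M"
    then obtain s where st: "\<And>n::nat. s n \<in> M" "s \<longlonglongrightarrow> a"
      unfolding lim by blast
    show "c *\<^sub>C a \<in> closure M"
      unfolding lim by (rule exI[of _ "\<lambda>n. c *\<^sub>C s n"])
        (auto intro: CV.span_scale st bounded_linear.tendsto[OF bounded_linear_scaleC])
    show "star a \<in> closure M"
      unfolding lim by (rule exI[of _ "\<lambda>n. star (s n)"])
        (auto intro: star_mem st bounded_linear.tendsto[OF bounded_linear_star])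
  qed simp
  moreover have "W ` S \<subseteq> closure M"
    using closure_subset weyl_mem by blast
  ultimately have "cstar_subalgebra hull (W ` S) \<subseteq> closure M"
    by (intro hull_minimal)
  then show ?thesis
    using CCR by (auto simp: is_CCR_def)
qed

lemma approx:
  obtains s where "\<And>n::nat. s n \<in> M" "s \<longlonglongrightarrow> x"
  using dense closure_sequential[of x M] by auto

text \<open>Finitely generated abelian groups have polynomial growth.\<close>

lemma powers_polynomial_growth:
  assumes "x \<in> M"
  obtains m :: nat where
    "\<And>n. \<exists>F. finite F \<and> F \<subseteq> S \<and> card F \<le> (n + 1) ^ m \<and> x ^ n \<in> CV.span (W ` F)"
proof -
  obtain G c where G: "finite G" "G \<subseteq> S" "x = (\<Sum>g\<in>G. c g *\<^sub>C W g)"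
    using span_repr[OF assms] by blast
  have xG: "x \<in> CV.span (W ` G)"
    unfolding G(3) by (intro CV.span_sum CV.span_scale CV.span_base) auto
  \<comment> \<open>The frequencies of x^n are sums of n elements of G. They lie in the box of
    combinations with every multiplicity at most n, which has at most (n + 1)^card G points.\<close>
  define P where "P n = (\<lambda>k. \<Sum>g\<in>G. complex_of_real (real (k g)) *\<^sub>C g) ` (G \<rightarrow>\<^sub>E {..n})" for n :: nat
  have sub: "P n \<subseteq> S" for n
  proof -
    have "(\<Sum>g\<in>G'. complex_of_real (real (k g)) *\<^sub>C g) \<in> S" if "finite G'" "G' \<subseteq> S" for G' and k :: "'h \<Rightarrow> nat"
      using that by (induction G' rule: finite_induct) (auto intro: zero_mem add_mem scaleC_mem)
    then show ?thesis using G by (auto simp: P_def)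
  qed
  have pow: "x ^ n \<in> CV.span (W ` P n)" for n
  proof (induction n)
    case 0
    have "0 \<in> P 0"
      unfolding P_def by (rule image_eqI[where x = "\<lambda>g\<in>G. 0"]) auto
    then show ?case
      using weyl_zero by (auto intro!: CV.span_base image_eqI[where x = 0])
  next
    case (Suc n)
    have "W f * W g \<in> CV.span (W ` P (Suc n))" if "f \<in> P n" "g \<in> G" for f g
    proof -
      obtain k where k: "k \<in> G \<rightarrow>\<^sub>E {..n}" "f = (\<Sum>g\<in>G. complex_of_real (real (k g)) *\<^sub>C g)"
        using \<open>f \<in> P n\<close> by (auto simp: P_def)
      have "(\<Sum>h\<in>G. complex_of_real (real ((k(g := Suc (k g))) h)) *\<^sub>C h) =
          (\<Sum>h\<in>G. complex_of_real (real (k h)) *\<^sub>C h + (if h = g then h else 0))"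
        by (rule sum.cong) (auto simp: scaleC_add_left)
      also have "\<dots> = f + g"
        using G(1) \<open>g \<in> G\<close> by (simp add: sum.distrib k(2))
      finally have "f + g \<in> P (Suc n)"
        unfolding P_def using k(1) \<open>g \<in> G\<close>
        by (intro image_eqI[where x = "k(g := Suc (k g))"]) (auto simp: PiE_iff extensional_def le_Suc_eq)
      moreover have "f \<in> S" "g \<in> S" using that sub G(2) by auto
      ultimately show ?thesis
        by (simp add: weyl_mult CV.span_scale CV.span_base)
    qed
    then have "x ^ n * x \<in> CV.span (W ` P (Suc n))"
      using Suc xG by (rule span_mult)
    then show ?case by (simp add: power_commutes)
  qed
  have fin: "finite (P n)" for n
    unfolding P_def using G(1) by (intro finite_imageI finite_PiE) auto
  have crd: "card (P n) \<le> (n + 1) ^ card G" for n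
  proof -
    have "card (P n) \<le> card (G \<rightarrow>\<^sub>E {..n})"
      unfolding P_def using G(1) by (intro card_image_le finite_PiE) auto
    then show ?thesis using G(1) by (simp add: card_PiE)
  qed
  show thesis
  proof (rule that[of "card G"])
    show "\<exists>F. finite F \<and> F \<subseteq> S \<and> card F \<le> (n + 1) ^ card G \<and> x ^ n \<in> CV.span (W ` F)" for n
      by (rule exI[of _ "P n"]) (intro conjI fin sub crd pow)
  qed
qed

end

text \<open>If b < a, then (b/a)^n beats any polynomial in n. Exponents 2^k suffice, and they are
  the ones reached by iterating the C*-identity.\<close>

lemma le_if_power_polynomial_bound:
  fixes a b :: real and m :: nat
  assumes "a \<ge> 0" "b \<ge> 0" and bound: "\<And>k. a ^ (2 ^ k) \<le> (real (2 ^ k) + 1) ^ m * b ^ (2 ^ k)"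
  shows "a \<le> b"
proof (rule ccontr)
  assume "\<not> a \<le> b"
  then have ab: "b < a" "a > 0" using assms by auto
  define q where "q = b / a"
  have q: "0 \<le> q" "q < 1" using ab assms by (auto simp: q_def)
  have "(\<lambda>n. (real n + 1) ^ m * q ^ n) \<longlonglongrightarrow> 0"
  proof (cases "q = 0")
    case True
    have "eventually (\<lambda>n. (real n + 1) ^ m * q ^ n = 0) sequentially"
      using eventually_gt_at_top[of 0] by eventually_elim (simp add: True)
    then show ?thesis by (rule tendsto_eventually)
  next
    case False
    then have "q > 0" using q by simp
    then show ?thesis using q by real_asymp
  qed
  moreover have "filterlim (\<lambda>k. 2 ^ k :: nat) sequentially sequentially"
    by (rule filterlim_subseq) (simp add: strict_mono_def)
  ultimately have "(\<lambda>k. (real (2 ^ k) + 1) ^ m * q ^ (2 ^ k)) \<longlonglongrightarrow> 0"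
    by (rule filterlim_compose)
  moreover have "1 \<le> (real (2 ^ k) + 1) ^ m * q ^ (2 ^ k)" for k
    using bound[of k] ab by (simp add: q_def power_divide field_simps)
  ultimately have "1 \<le> (0::real)"
    by (intro LIMSEQ_le_const) auto
  then show False by simp
qed

interpretation CVP: vector_space_pair
  "scaleC :: complex \<Rightarrow> 'a::complex_vector \<Rightarrow> 'a" "scaleC :: complex \<Rightarrow> 'b::complex_vector \<Rightarrow> 'b"
  by unfold_locales

section \<open>Extension of states and symplectic maps from the Weyl operators\<close>

context weyl_system
begin

text \<open>A spectral radius argument: iterating \<open>square\<close> bounds p(h)^n by p(h^n) for
  n = 2^k, and p(h^n) is at most the number of Weyl terms of h^n times norm(h^n), a polynomial
  factor that disappears under the n-th root. Applied to the GNS seminorm of a functional and to the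
  norm pulled back along a homomorphism.\<close>

lemma seminorm_le_norm:
  fixes p :: "'a \<Rightarrow> real"
  assumes nonneg: "\<And>x. x \<in> M \<Longrightarrow> 0 \<le> p x"
    and triangle: "\<And>x y. x \<in> M \<Longrightarrow> y \<in> M \<Longrightarrow> p (x + y) \<le> p x + p y"
    and weyl: "\<And>c f. f \<in> S \<Longrightarrow> p (c *\<^sub>C W f) \<le> cmod c"
    and square: "\<And>x. x \<in> M \<Longrightarrow> (p x)\<^sup>2 \<le> p (star x * x)"
    and x: "x \<in> M"
  shows "p x \<le> norm x"
proof (rule power2_le_imp_le)
  define h where "h = star x * x"
  have h: "h \<in> M" "star h = h"
    by (simp_all add: h_def x mult_mem star_mem star_mult star_star)
  obtain m where m: "\<And>n. \<exists>F. finite F \<and> F \<subseteq> S \<and> card F \<le> (n + 1) ^ m \<and> h ^ n \<in> CV.span (W ` F)"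
    using powers_polynomial_growth[OF h(1)] by metis
  have pow: "p h ^ (2 ^ k) \<le> p (h ^ (2 ^ k))" for k
  proof (induction k)
    case (Suc k)
    have "p h ^ (2 ^ Suc k) = (p h ^ (2 ^ k))\<^sup>2"
      by (simp add: power_mult[symmetric] mult.commute)
    also have "\<dots> \<le> (p (h ^ (2 ^ k)))\<^sup>2"
      using Suc nonneg[OF h(1)] by (intro power_mono) auto
    also have "\<dots> \<le> p (star (h ^ (2 ^ k)) * h ^ (2 ^ k))"
      by (rule square[OF power_mem[OF h(1)]])
    also have "star (h ^ (2 ^ k)) * h ^ (2 ^ k) = h ^ (2 ^ Suc k)"
      by (simp add: star_power h(2) mult_2 flip: power_add)
    finally show ?case .
  qed simp
  \<comment> \<open>The seminorm is bounded by the sum of the absolute coefficients, each of which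
    is at most \<open>norm y\<close>.\<close>
  have l1: "p y \<le> real (card F) * norm y"
    if fin: "finite F" and sub: "F \<subseteq> S" and y: "y \<in> CV.span (W ` F)" for F y
  proof -
    obtain c where c: "y = (\<Sum>f\<in>F. c f *\<^sub>C W f)"
      using span_finite_repr[OF fin sub y] by blast
    have "p (\<Sum>f\<in>G. c f *\<^sub>C W f) \<le> (\<Sum>f\<in>G. cmod (c f))" if "finite G" "G \<subseteq> S" for G
      using that
    proof (induction rule: finite_induct)
      case empty
      show ?case using weyl[OF zero_mem, of 0] by simp
    next
      case (insert f G)
      have "p (c f *\<^sub>C W f + (\<Sum>f\<in>G. c f *\<^sub>C W f)) \<le> p (c f *\<^sub>C W f) + p (\<Sum>f\<in>G. c f *\<^sub>C W f)"
        using insert.prems by (intro triangle CV.span_sum CV.span_scale weyl_mem) auto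
      also have "\<dots> \<le> cmod (c f) + (\<Sum>f\<in>G. cmod (c f))"
        using insert by (intro add_mono weyl) auto
      finally show ?case using insert by simp
    qed
    then have "p y \<le> (\<Sum>f\<in>F. cmod (c f))"
      using fin sub c by simp
    also have "\<dots> \<le> (\<Sum>f\<in>F. norm y)"
      unfolding c by (intro sum_mono coefficient_bound fin sub)
    finally show ?thesis by simp
  qed
  have "p h \<le> norm h"
  proof (rule le_if_power_polynomial_bound[where m = m])
    fix k
    obtain F where F: "finite F" "F \<subseteq> S" "card F \<le> (2 ^ k + 1) ^ m" "h ^ (2 ^ k) \<in> CV.span (W ` F)"
      using m by blast
    have "p h ^ (2 ^ k) \<le> real (card F) * norm (h ^ (2 ^ k))"
      using pow l1[OF F(1,2,4)] by (rule order_trans)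
    also have "\<dots> \<le> (real (2 ^ k) + 1) ^ m * norm h ^ (2 ^ k)"
      using F(3) norm_power_ineq[of h "2 ^ k"]
      by (intro mult_mono) (auto simp flip: of_nat_Suc of_nat_power simp: add.commute)
    finally show "p h ^ (2 ^ k) \<le> (real (2 ^ k) + 1) ^ m * norm h ^ (2 ^ k)" .
  qed (use nonneg h in auto)
  then show "(p x)\<^sup>2 \<le> (norm x)\<^sup>2"
    using square[OF x] by (simp add: h_def cstar_identity)
qed simp

text \<open>Possible because the Weyl operators are linearly independent. The extension to the whole
  algebra is purely algebraic and may be unbounded; only its restriction to M is used.\<close>

lemma extend_from_weyl:
  fixes \<phi> :: "'h \<Rightarrow> 'b::complex_vector"
  obtains g :: "'a \<Rightarrow> 'b" where "\<And>x y. g (x + y) = g x + g y" "\<And>c x. g (c *\<^sub>C x) = c *\<^sub>C g x"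
    "\<And>f. f \<in> S \<Longrightarrow> g (W f) = \<phi> f"
proof -
  obtain g :: "'a \<Rightarrow> 'b" where g: "Vector_Spaces.linear (*\<^sub>C) (*\<^sub>C) g"
      "\<forall>x\<in>W ` S. g x = \<phi> (inv_into S W x)"
    using CVP.linear_independent_extend[OF independent_weyl, of "\<lambda>x. \<phi> (inv_into S W x)"] by blast
  show thesis
    using g(2) inj_on_weyl
    by (intro that[of g]) (auto simp: CVP.linear_add[OF g(1)] CVP.linear_scale[OF g(1)])
qed

lemma additive_sum:
  fixes g :: "'a \<Rightarrow> 'b::complex_vector"
  assumes "\<And>x y. g (x + y) = g x + g y"
  shows "g (\<Sum>i\<in>I. h i) = (\<Sum>i\<in>I. g (h i))"
proof -
  have "g 0 = 0" using assms[of 0 0] by simp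
  then show ?thesis
    by (induction I rule: infinite_finite_induct) (simp_all add: assms)
qed

lemma star_mult_expand:
  assumes "finite F" "F \<subseteq> S" "x = (\<Sum>f\<in>F. c f *\<^sub>C W f)"
  shows "star x * x = (\<Sum>f\<in>F. \<Sum>g\<in>F. (cnj (c f) * c g * phase (- f) g) *\<^sub>C W (g - f))"
proof -
  have "star x = (\<Sum>f\<in>F. cnj (c f) *\<^sub>C W (- f))"
    unfolding assms(3) using assms(2)
    by (auto simp: additive_sum[of star, OF star_add] star_scaleC star_weyl intro!: sum.cong)
  then have "star x * x = (\<Sum>f\<in>F. \<Sum>g\<in>F. (cnj (c f) *\<^sub>C W (- f)) * (c g *\<^sub>C W g))"
    by (simp add: assms(3) sum_product)
  also have "\<dots> = (\<Sum>f\<in>F. \<Sum>g\<in>F. (cnj (c f) * c g * phase (- f) g) *\<^sub>C W (g - f))"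
    using assms(2) minus_mem
    by (intro sum.cong) (auto simp: mult_scaleC_left mult_scaleC_right weyl_mult scaleC_scaleC subset_iff)
  finally show ?thesis .
qed

lemma eq_if_eq_on_weyl:
  fixes g g' :: "'a \<Rightarrow> 'b::{complex_vector,real_normed_vector}"
  assumes "bounded_linear g" "bounded_linear g'"
    and "\<And>c x. g (c *\<^sub>C x) = c *\<^sub>C g x" "\<And>c x. g' (c *\<^sub>C x) = c *\<^sub>C g' x"
    and "\<And>f. f \<in> S \<Longrightarrow> g (W f) = g' (W f)"
  shows "g x = g' x"
proof (rule bounded_linear_eq_on_dense[OF assms(1,2) dense])
  fix x assume "x \<in> M"
  then show "g x = g' x"
    by (induction rule: CV.span_induct_alt)
      (auto simp: linear_simps[OF assms(1)] linear_simps[OF assms(2)] assms(3-5))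
qed

lemma state_eqI:
  assumes "is_state \<omega>" "is_state \<omega>'" "\<And>f. f \<in> S \<Longrightarrow> \<omega> (W f) = \<omega>' (W f)"
  shows "\<omega> = \<omega>'"
proof (rule ext, rule eq_if_eq_on_weyl)
  interpret a: state \<omega> by unfold_locales fact
  interpret b: state \<omega>' by unfold_locales fact
  show "bounded_linear \<omega>" "bounded_linear \<omega>'" by (rule a.bounded_linear b.bounded_linear)+
qed (use assms in \<open>auto simp: is_state_def scaleC_complex_def\<close>)

text \<open>The double sum is the value at x* x of the functional determined by
  \<open>\<phi>\<close>. Its GNS seminorm is dominated by the given norm through
  \<open>seminorm_le_norm\<close>, so the functional extends continuously from M, and positivity
  survives the limit.\<close>

lemma state_exists:
  fixes \<phi> :: "'h \<Rightarrow> complex"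
  assumes \<phi>0: "\<phi> 0 = 1"
    and pd: "\<And>F c. finite F \<Longrightarrow> F \<subseteq> S \<Longrightarrow>
      (\<Sum>f\<in>F. \<Sum>g\<in>F. cnj (c f) * c g * phase (- f) g * \<phi> (g - f)) \<in> \<real>\<^sub>\<ge>\<^sub>0"
  obtains \<omega> where "is_state \<omega>" "\<And>f. f \<in> S \<Longrightarrow> \<omega> (W f) = \<phi> f"
proof -
  obtain g :: "'a \<Rightarrow> complex" where g: "\<And>x y. g (x + y) = g x + g y" "\<And>c x. g (c *\<^sub>C x) = c * g x"
    "\<And>f. f \<in> S \<Longrightarrow> g (W f) = \<phi> f"
    using extend_from_weyl[of \<phi>] unfolding scaleC_complex_def by metis
  interpret positive_functional g M
  proof
    fix x assume "x \<in> M"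
    then obtain F c where F: "finite F" "F \<subseteq> S" "x = (\<Sum>f\<in>F. c f *\<^sub>C W f)"
      using span_repr by metis
    have "g (star x * x) = (\<Sum>f\<in>F. \<Sum>h\<in>F. cnj (c f) * c h * phase (- f) h * \<phi> (h - f))"
      unfolding star_mult_expand[OF F] additive_sum[of g, OF g(1)] g(2)
      using F(2) by (intro sum.cong) (auto simp: g(3) diff_mem subset_iff)
    then show "g (star x * x) \<in> \<real>\<^sub>\<ge>\<^sub>0"
      using pd[OF F(1,2)] by simp
  qed (simp_all add: g CV.span_add CV.span_scale)
  have one: "g 1 = 1"
    using g(3)[OF zero_mem] \<phi>0 by simp
  have s1: "seminorm 1 = 1"
    by (simp add: seminorm_def one)
  have le: "seminorm x \<le> norm x" if "x \<in> M" for x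
  proof (rule seminorm_le_norm[OF _ _ _ _ that])
    show "seminorm (c *\<^sub>C W f) \<le> cmod c" if "f \<in> S" for c f
    proof -
      have "star (c *\<^sub>C W f) * (c *\<^sub>C W f) = (cnj c * c) *\<^sub>C 1"
        using that by (simp add: star_scaleC mult_scaleC_left mult_scaleC_right scaleC_scaleC unitary
            mult.commute)
      then show ?thesis
        by (simp add: seminorm_def g(2) one mult.commute[of "cnj c"] complex_norm_square[symmetric]
            flip: of_real_power)
    qed
    \<comment> \<open>Cauchy-Schwarz against 1, whose seminorm is 1.\<close>
    show "(seminorm x)\<^sup>2 \<le> seminorm (star x * x)" if "x \<in> M" for x
      using complex_Re_le_cmod[of "g (star x * x)"]
        cauchy_schwarz[OF one_mem mult_mem[OF star_mem[OF that] that]] that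
      by (simp add: seminorm_square s1)
  qed (simp_all add: seminorm_nonneg seminorm_triangle)
  have bound: "norm (g x) \<le> norm x" if "x \<in> M" for x
    using cauchy_schwarz[OF one_mem that] le[OF that] by (simp add: s1)
  obtain \<omega> where \<omega>: "bounded_linear \<omega>" "\<And>x. x \<in> M \<Longrightarrow> \<omega> x = g x" "\<And>x. norm (\<omega> x) \<le> norm x"
    by (rule bounded_linear_extension[OF subspace_M dense, of g])
      (auto simp: g bound scaleR scaleR_conv_of_real[where 'a = complex])
  have "\<omega> (c *\<^sub>C x) = c * \<omega> x" for c x
    by (rule bounded_linear_eq_on_dense[OF _ _ dense])
      (auto intro!: bounded_linear_compose[OF \<omega>(1) bounded_linear_scaleC]
        bounded_linear_const_mult \<omega>(1) simp: \<omega>(2) CV.span_scale g(2))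
  moreover have "\<omega> (star x * x) \<in> \<real>\<^sub>\<ge>\<^sub>0" for x
  proof -
    obtain s where s: "\<And>n::nat. s n \<in> M" "s \<longlonglongrightarrow> x" using approx by blast
    have lim: "(\<lambda>n. \<omega> (star (s n) * s n)) \<longlonglongrightarrow> \<omega> (star x * x)"
      by (intro bounded_linear.tendsto[OF \<omega>(1)] tendsto_mult s
          bounded_linear.tendsto[OF bounded_linear_star])
    have "\<omega> (star (s n) * s n) \<in> \<real>\<^sub>\<ge>\<^sub>0" for n
      using s(1)[of n] by (simp add: \<omega>(2) mult_mem star_mem nonneg)
    then show ?thesis
      by (intro closed_sequentially[OF closed_nonneg_Reals_complex _ lim]) auto
  qed
  ultimately have "is_state \<omega>"
    by (simp add: is_state_def linear_simps[OF \<omega>(1)] \<omega>(2) one_mem one)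
  then show thesis
    using that \<omega>(2) g(3) weyl_mem by metis
qed

text \<open>The relations make the linear extension g a *-homomorphism on M, so the norm of g x is a
  C*-seminorm in x and \<open>seminorm_le_norm\<close> bounds it. Only additivity of T and
  preservation of the symplectic form enter the relations.\<close>

lemma homomorphism_exists:
  assumes T: "\<And>f. f \<in> S \<Longrightarrow> T f \<in> S"
    and T_add: "\<And>f g. f \<in> S \<Longrightarrow> g \<in> S \<Longrightarrow> T (f + g) = T f + T g"
    and T_symplectic: "\<And>f g. f \<in> S \<Longrightarrow> g \<in> S \<Longrightarrow> Im (cinner (T f) (T g)) = Im (cinner f g)"
  obtains \<phi> :: "'a \<Rightarrow> 'a" where "bounded_linear \<phi>" "\<And>x. norm (\<phi> x) \<le> norm x"
    "\<And>c x. \<phi> (c *\<^sub>C x) = c *\<^sub>C \<phi> x" "\<And>x y. \<phi> (x * y) = \<phi> x * \<phi> y"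
    "\<And>x. \<phi> (star x) = star (\<phi> x)" "\<And>f. f \<in> S \<Longrightarrow> \<phi> (W f) = W (T f)"
proof -
  obtain g :: "'a \<Rightarrow> 'a" where g: "\<And>x y. g (x + y) = g x + g y" "\<And>c x. g (c *\<^sub>C x) = c *\<^sub>C g x"
    "\<And>f. f \<in> S \<Longrightarrow> g (W f) = W (T f)"
    using extend_from_weyl[of "\<lambda>f. W (T f)"] by metis
  have g0: "g 0 = 0" using g(1)[of 0 0] by simp
  have T0: "T 0 = 0" using T_add[OF zero_mem zero_mem] by simp
  have T_minus: "T (- f) = - T f" if "f \<in> S" for f
    using T_add[OF that minus_mem[OF that]] T0 by (simp add: eq_neg_iff_add_eq_0 add.commute)
  have mult: "g (x * y) = g x * g y" if x: "x \<in> M" and y: "y \<in> M" for x y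
    using x
  proof (induction rule: CV.span_induct_alt)
    case (step c w z)
    obtain f where f: "f \<in> S" "w = W f" using step by auto
    have "g (W f * y) = g (W f) * g y"
      using y
    proof (induction rule: CV.span_induct_alt)
      case (step c w z)
      then show ?case
        using f(1)
        by (auto simp: distrib_left mult_scaleC_right g weyl_mult T add_mem phase_def T_symplectic T_add)
    qed (simp add: g0)
    then show ?case
      using step f by (simp add: distrib_right mult_scaleC_left g)
  qed (simp add: g0)
  have star: "g (star x) = star (g x)" if "x \<in> M" for x
    using that
  proof (induction rule: CV.span_induct_alt)
    case (step c w z)
    then show ?case
      by (auto simp: g star_add star_scaleC star_weyl minus_mem T T_minus)
  qed (simp add: g0)
  have bound: "norm (g x) \<le> norm x" if "x \<in> M" for x
  proof (rule seminorm_le_norm[OF _ _ _ _ that])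
    show "norm (g (c *\<^sub>C W f)) \<le> cmod c" if "f \<in> S" for c f
      using that by (simp add: g norm_scaleC norm_weyl T)
    show "(norm (g x))\<^sup>2 \<le> norm (g (star x * x))" if "x \<in> M" for x
      using that by (simp add: mult star star_mem cstar_identity)
  qed (simp_all add: g norm_triangle_ineq)
  obtain \<phi> where \<phi>: "bounded_linear \<phi>" "\<And>x. x \<in> M \<Longrightarrow> \<phi> x = g x" "\<And>x. norm (\<phi> x) \<le> norm x"
    by (rule bounded_linear_extension[OF subspace_M dense, of g])
      (auto simp: g bound scaleR_scaleC)
  have "\<phi> (c *\<^sub>C x) = c *\<^sub>C \<phi> x" for c x
    by (rule bounded_linear_eq_on_dense[OF _ _ dense])
      (auto intro!: bounded_linear_compose[OF \<phi>(1) bounded_linear_scaleC]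
        bounded_linear_compose[OF bounded_linear_scaleC \<phi>(1)] simp: \<phi>(2) CV.span_scale g(2))
  moreover have "\<phi> (star x) = star (\<phi> x)" for x
    by (rule bounded_linear_eq_on_dense[OF _ _ dense])
      (auto intro!: bounded_linear_compose[OF \<phi>(1) bounded_linear_star]
        bounded_linear_compose[OF bounded_linear_star \<phi>(1)] simp: \<phi>(2) star_mem star)
  moreover have "\<phi> (x * y) = \<phi> x * \<phi> y" for x y
  proof -
    obtain s where s: "\<And>n::nat. s n \<in> M" "s \<longlonglongrightarrow> x" using approx by blast
    obtain t where t: "\<And>n::nat. t n \<in> M" "t \<longlonglongrightarrow> y" using approx by blast
    have eq: "\<phi> (s n * t n) = \<phi> (s n) * \<phi> (t n)" for n
      using s(1) t(1) by (simp add: \<phi>(2) mult_mem mult)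
    have "(\<lambda>n. \<phi> (s n * t n)) \<longlonglongrightarrow> \<phi> (x * y)" "(\<lambda>n. \<phi> (s n) * \<phi> (t n)) \<longlonglongrightarrow> \<phi> x * \<phi> y"
      by (intro tendsto_mult bounded_linear.tendsto[OF \<phi>(1)] s t)+
    then show ?thesis
      unfolding eq by (rule LIMSEQ_unique)
  qed
  ultimately show thesis
    using that[of \<phi>] \<phi> g(3) weyl_mem by metis
qed

lemma evolution_exists:
  fixes T :: "real \<Rightarrow> 'h \<Rightarrow> 'h"
  assumes T: "\<And>t f. f \<in> S \<Longrightarrow> T t f \<in> S"
    and T_add: "\<And>t f g. f \<in> S \<Longrightarrow> g \<in> S \<Longrightarrow> T t (f + g) = T t f + T t g"
    and T_symplectic: "\<And>t f g. f \<in> S \<Longrightarrow> g \<in> S \<Longrightarrow> Im (cinner (T t f) (T t g)) = Im (cinner f g)"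
    and T_zero: "\<And>f. f \<in> S \<Longrightarrow> T 0 f = f"
    and T_group: "\<And>s t f. f \<in> S \<Longrightarrow> T (s + t) f = T s (T t f)"
  shows "\<exists>\<alpha>. induced_evolution S W T \<alpha>"
proof -
  have "\<exists>\<phi>. bounded_linear \<phi> \<and> (\<forall>c x. \<phi> (c *\<^sub>C x) = c *\<^sub>C \<phi> x) \<and> (\<forall>x y. \<phi> (x * y) = \<phi> x * \<phi> y) \<and>
     (\<forall>x. \<phi> (star x) = star (\<phi> x)) \<and> (\<forall>f\<in>S. \<phi> (W f) = W (T t f))" for t
    by (rule homomorphism_exists[of "T t"]) (use assms in auto)
  then obtain \<alpha> where \<alpha>: "\<And>t. bounded_linear (\<alpha> t)" "\<And>t c x. \<alpha> t (c *\<^sub>C x) = c *\<^sub>C \<alpha> t x"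
    "\<And>t x y. \<alpha> t (x * y) = \<alpha> t x * \<alpha> t y" "\<And>t x. \<alpha> t (star x) = star (\<alpha> t x)"
    "\<And>t f. f \<in> S \<Longrightarrow> \<alpha> t (W f) = W (T t f)"
    by metis
  have zero: "\<alpha> 0 x = x" for x
    by (rule eq_if_eq_on_weyl[OF \<alpha>(1) bounded_linear_ident]) (simp_all add: \<alpha> T_zero)
  have group: "\<alpha> (s + t) x = \<alpha> s (\<alpha> t x)" for s t x
    by (rule eq_if_eq_on_weyl[OF \<alpha>(1) bounded_linear_compose[OF \<alpha>(1) \<alpha>(1)]])
      (simp_all add: \<alpha> T T_group)
  have "bij (\<alpha> t)" for t
    by (rule bij_betw_byWitness[where f' = "\<alpha> (- t)"]) (auto simp flip: group simp: zero)
  then show ?thesis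
    by (intro exI[of _ \<alpha>]) (auto simp: induced_evolution_def automorphism_group_def star_automorphism_def \<alpha>
        linear_simps[OF \<alpha>(1)] zero group)
qed

text \<open>The canonical trace. Its kernel is diagonal, hence positive. It depends only on whether
  a frequency is 0, so every evolution with injective T preserves it.\<close>

lemma trace_exists:
  obtains \<tau> where "is_state \<tau>" "\<And>f. f \<in> S \<Longrightarrow> \<tau> (W f) = (if f = 0 then 1 else 0)"
proof (rule state_exists[of "\<lambda>f. if f = 0 then 1 else 0"])
  fix F and c :: "'h \<Rightarrow> complex" assume "finite F" "F \<subseteq> S"
  have "(\<Sum>f\<in>F. \<Sum>g\<in>F. cnj (c f) * c g * phase (- f) g * (if g - f = 0 then 1 else 0)) =
      (\<Sum>f\<in>F. \<Sum>g\<in>F. if g = f then cnj (c f) * c f else 0)"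
    by (intro sum.cong) (auto simp: phase_def cinner_minus_left)
  also have "\<dots> = (\<Sum>f\<in>F. of_real ((cmod (c f))\<^sup>2))"
    using \<open>finite F\<close> by (simp add: complex_norm_square mult.commute del: of_real_power)
  also have "\<dots> \<in> \<real>\<^sub>\<ge>\<^sub>0"
    unfolding of_real_sum[symmetric] by (simp add: sum_nonneg del: of_real_sum of_real_power)
  finally show "(\<Sum>f\<in>F. \<Sum>g\<in>F. cnj (c f) * c g * phase (- f) g * (if g - f = 0 then 1 else 0)) \<in> \<real>\<^sub>\<ge>\<^sub>0" .
qed (use that in auto)

end

section \<open>The GNS representation of the trace and automatic continuity of evolutions\<close>

locale weyl_trace = weyl_system S W + state \<tau>
  for S :: "'h::complex_inner set" and W :: "'h \<Rightarrow> 'a::cstar_algebra" and \<tau> :: "'a \<Rightarrow> complex" +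
  assumes trace_weyl: "f \<in> S \<Longrightarrow> \<tau> (W f) = (if f = 0 then 1 else 0)"
begin

text \<open>The trace seminorm is the l2-norm of the coefficients, while the norm is at most their
  l1-norm.\<close>

lemma norm_le_card_seminorm:
  assumes "finite F" "F \<subseteq> S" "x \<in> CV.span (W ` F)"
  shows "norm x \<le> real (card F) * seminorm x"
proof -
  obtain c where c: "x = (\<Sum>f\<in>F. c f *\<^sub>C W f)"
    using span_finite_repr[OF assms] by blast
  have "\<tau> (star x * x) = (\<Sum>f\<in>F. \<Sum>g\<in>F. if g = f then cnj (c f) * c f else 0)"
    unfolding star_mult_expand[OF assms(1,2) c] additive_sum[of \<tau>, OF add] scaleC
    using assms(2)
    by (intro sum.cong) (auto simp: trace_weyl diff_mem subset_iff phase_def cinner_minus_left zero_mem)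
  also have "\<dots> = of_real (\<Sum>f\<in>F. (cmod (c f))\<^sup>2)"
    using \<open>finite F\<close> by (simp add: complex_norm_square mult.commute del: of_real_power)
  finally have s: "seminorm x = sqrt (\<Sum>f\<in>F. (cmod (c f))\<^sup>2)"
    by (simp add: seminorm_def)
  have "norm x \<le> (\<Sum>f\<in>F. norm (c f *\<^sub>C W f))"
    unfolding c by (rule norm_sum)
  also have "\<dots> \<le> (\<Sum>f\<in>F. seminorm x)"
  proof (rule sum_mono)
    fix f assume "f \<in> F"
    then have "(cmod (c f))\<^sup>2 \<le> (\<Sum>f\<in>F. (cmod (c f))\<^sup>2)"
      using assms(1) by (intro member_le_sum) auto
    then show "norm (c f *\<^sub>C W f) \<le> seminorm x"
      using \<open>f \<in> F\<close> assms(2) norm_weyl[of f] real_le_rsqrt unfolding s norm_scaleC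
      by fastforce
  qed
  finally show ?thesis by simp
qed

text \<open>The growth argument again, with the roles of norm and seminorm exchanged: K controls the
  seminorm of h^n, and the norm of h^n exceeds that seminorm by a polynomial factor only.\<close>

lemma norm_le_if_seminorm_mult_le_dense:
  assumes x: "x \<in> M" and "K \<ge> 0" and K: "\<And>c. seminorm (x * c) \<le> K * seminorm c"
  shows "norm x \<le> K"
proof (rule power2_le_imp_le)
  define h where "h = star x * x"
  have h: "h \<in> M" "star h = h"
    by (simp_all add: h_def x mult_mem star_mem star_mult star_star)
  obtain m where m: "\<And>n. \<exists>F. finite F \<and> F \<subseteq> S \<and> card F \<le> (n + 1) ^ m \<and> h ^ n \<in> CV.span (W ` F)"
    using powers_polynomial_growth[OF h(1)] by metis
  have step: "seminorm (h * c) \<le> K\<^sup>2 * seminorm c" for c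
  proof (cases "seminorm (h * c) = 0")
    case False
    have "star (h * c) * (h * c) = star (x * c) * (x * (h * c))"
      by (simp add: star_mult star_star h_def mult.assoc)
    then have "(seminorm (h * c))\<^sup>2 \<le> seminorm (x * c) * seminorm (x * (h * c))"
      using cauchy_schwarz[of "x * c" "x * (h * c)"]
        complex_Re_le_cmod[of "\<tau> (star (x * c) * (x * (h * c)))"]
      by (simp add: seminorm_square)
    also have "\<dots> \<le> (K * seminorm c) * (K * seminorm (h * c))"
      using K \<open>K \<ge> 0\<close> by (intro mult_mono mult_nonneg_nonneg seminorm_nonneg) auto
    finally show ?thesis
      using False seminorm_nonneg[of "h * c"] by (simp add: power2_eq_square mult_ac)
  qed (simp add: seminorm_nonneg)
  have pow: "seminorm (h ^ n) \<le> (K\<^sup>2) ^ n" for n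
  proof (induction n)
    case 0
    show ?case by (simp add: seminorm_def one)
  next
    case (Suc n)
    have "seminorm (h ^ Suc n) \<le> K\<^sup>2 * seminorm (h ^ n)"
      using step by simp
    also have "\<dots> \<le> K\<^sup>2 * (K\<^sup>2) ^ n"
      using Suc by (intro mult_left_mono) auto
    finally show ?case by simp
  qed
  have norm_pow: "norm h ^ (2 ^ k) = norm (h ^ (2 ^ k))" for k
  proof (induction k)
    case (Suc k)
    have "norm h ^ (2 ^ Suc k) = (norm (h ^ (2 ^ k)))\<^sup>2"
      unfolding Suc[symmetric] by (simp add: power_mult[symmetric] mult.commute)
    also have "\<dots> = norm (star (h ^ (2 ^ k)) * h ^ (2 ^ k))"
      by (simp add: cstar_identity)
    also have "star (h ^ (2 ^ k)) * h ^ (2 ^ k) = h ^ (2 ^ Suc k)"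
      by (simp add: star_power h(2) mult_2 flip: power_add)
    finally show ?case .
  qed simp
  have "norm h \<le> K\<^sup>2"
  proof (rule le_if_power_polynomial_bound[where m = m])
    fix k
    obtain F where F: "finite F" "F \<subseteq> S" "card F \<le> (2 ^ k + 1) ^ m" "h ^ (2 ^ k) \<in> CV.span (W ` F)"
      using m by blast
    have "norm h ^ (2 ^ k) \<le> real (card F) * seminorm (h ^ (2 ^ k))"
      unfolding norm_pow by (rule norm_le_card_seminorm[OF F(1,2,4)])
    also have "\<dots> \<le> (real (2 ^ k) + 1) ^ m * (K\<^sup>2) ^ (2 ^ k)"
      using F(3) pow[of "2 ^ k"]
      by (intro mult_mono) (auto simp flip: of_nat_Suc of_nat_power simp: add.commute seminorm_nonneg)
    finally show "norm h ^ (2 ^ k) \<le> (real (2 ^ k) + 1) ^ m * (K\<^sup>2) ^ (2 ^ k)" .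
  qed auto
  then show "(norm x)\<^sup>2 \<le> K\<^sup>2"
    by (simp add: h_def cstar_identity)
qed fact

text \<open>The GNS representation of the trace is isometric.\<close>

lemma norm_le_if_seminorm_mult_le:
  assumes "K \<ge> 0" and K: "\<And>c. seminorm (x * c) \<le> K * seminorm c"
  shows "norm x \<le> K"
proof -
  obtain s where s: "\<And>n::nat. s n \<in> M" "s \<longlonglongrightarrow> x" using approx by blast
  have "norm (s n) \<le> K + norm (s n - x)" for n
  proof (rule norm_le_if_seminorm_mult_le_dense[OF s(1)])
    fix c
    have "seminorm (s n * c) \<le> seminorm (x * c) + seminorm ((s n - x) * c)"
      using seminorm_triangle[of "x * c" "(s n - x) * c"] by (simp add: algebra_simps)
    also have "\<dots> \<le> K * seminorm c + norm (s n - x) * seminorm c"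
      by (intro add_mono K seminorm_mult_le)
    finally show "seminorm (s n * c) \<le> (K + norm (s n - x)) * seminorm c"
      by (simp add: distrib_right)
  qed (simp add: \<open>K \<ge> 0\<close>)
  moreover have "(\<lambda>n. norm (s n)) \<longlonglongrightarrow> norm x" "(\<lambda>n. K + norm (s n - x)) \<longlonglongrightarrow> K + norm (x - x)"
    by (intro tendsto_intros s)+
  ultimately show ?thesis
    using LIMSEQ_le by fastforce
qed

end

context weyl_system
begin

text \<open>The trace composed with \<open>\<alpha> t\<close> is a state with the same values on
  Weyl operators, hence equal to the trace. So \<open>\<alpha> t\<close> is isometric for the GNS
  seminorm, and being surjective it carries the left multiplication bound of x over to
  \<open>\<alpha> t x\<close>. No continuity of the automorphism is assumed.\<close>

lemma evolution_contractive:
  assumes "induced_evolution S W T \<alpha>"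
    and T: "\<And>t f. f \<in> S \<Longrightarrow> T t f \<in> S"
    and T_inj: "\<And>t f. f \<in> S \<Longrightarrow> T t f = 0 \<longleftrightarrow> f = 0"
  shows "norm (\<alpha> t x) \<le> norm x"
proof -
  obtain \<tau> where \<tau>: "is_state \<tau>" "\<And>f. f \<in> S \<Longrightarrow> \<tau> (W f) = (if f = 0 then 1 else 0)"
    using trace_exists by blast
  interpret weyl_trace S W \<tau>
    by unfold_locales (use \<tau> in auto)
  have \<alpha>: "bij (\<alpha> t)" "\<And>a b. \<alpha> t (a + b) = \<alpha> t a + \<alpha> t b" "\<And>c a. \<alpha> t (c *\<^sub>C a) = c *\<^sub>C \<alpha> t a"
    "\<And>a b. \<alpha> t (a * b) = \<alpha> t a * \<alpha> t b" "\<And>a. \<alpha> t (star a) = star (\<alpha> t a)"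
    "\<And>f. f \<in> S \<Longrightarrow> \<alpha> t (W f) = W (T t f)"
    using assms(1)
    by (auto simp: induced_evolution_def automorphism_group_def star_automorphism_def)
  have surj: "\<exists>c. d = \<alpha> t c" for d
    using bij_is_surj[OF \<alpha>(1)] by (auto simp: surj_def)
  have "\<alpha> t 1 = 1"
    using surj[of 1] \<alpha>(4)[of _ 1] by (metis mult_1 mult_1_right)
  then have "is_state (\<lambda>a. \<tau> (\<alpha> t a))"
    using \<tau>(1) by (simp add: is_state_def \<alpha>(2-5))
  then have "(\<lambda>a. \<tau> (\<alpha> t a)) = \<tau>"
    by (rule state_eqI) (simp_all add: \<tau> \<alpha>(6) T T_inj)
  then have inv: "\<tau> (\<alpha> t a) = \<tau> a" for a
    by (rule fun_cong)
  have iso: "seminorm (\<alpha> t a) = seminorm a" for a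
    by (simp add: seminorm_def inv flip: \<alpha>(4,5))
  show ?thesis
  proof (rule norm_le_if_seminorm_mult_le)
    fix d
    obtain c where c: "d = \<alpha> t c"
      using surj by blast
    show "seminorm (\<alpha> t x * d) \<le> norm x * seminorm d"
      using seminorm_mult_le[of x c] by (simp add: c iso flip: \<alpha>(4))
  qed simp
qed

lemma evolution_bounded_linear:
  assumes "induced_evolution S W T \<alpha>"
    and "\<And>t f. f \<in> S \<Longrightarrow> T t f \<in> S" "\<And>t f. f \<in> S \<Longrightarrow> T t f = 0 \<longleftrightarrow> f = 0"
  shows "bounded_linear (\<alpha> t)"
  using assms(1) evolution_contractive[OF assms]
  by (intro bounded_linear_intro[where K = 1])
    (auto simp: induced_evolution_def automorphism_group_def star_automorphism_def scaleR_scaleC)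

lemma evolution_unique:
  assumes "induced_evolution S W T \<alpha>" "induced_evolution S W T \<alpha>'"
    and "\<And>t f. f \<in> S \<Longrightarrow> T t f \<in> S" "\<And>t f. f \<in> S \<Longrightarrow> T t f = 0 \<longleftrightarrow> f = 0"
  shows "\<alpha> = \<alpha>'"
proof (intro ext)
  fix t x
  show "\<alpha> t x = \<alpha>' t x"
    by (rule eq_if_eq_on_weyl)
      (use assms(1,2) evolution_bounded_linear[OF assms(1,3,4)] evolution_bounded_linear[OF assms(2-4)]
        in \<open>auto simp: induced_evolution_def automorphism_group_def star_automorphism_def\<close>)
qed

end

section \<open>Positive semidefinite kernels\<close>

text \<open>Hermitian symmetry is a clause of its own, so that only the real part of the quadratic
  form has to be tested.\<close>

definition psd_kernel :: "'i set \<Rightarrow> ('i \<Rightarrow> 'i \<Rightarrow> complex) \<Rightarrow> bool" where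
  "psd_kernel I K \<longleftrightarrow> (\<forall>i\<in>I. \<forall>j\<in>I. K j i = cnj (K i j)) \<and>
     (\<forall>F c. finite F \<longrightarrow> F \<subseteq> I \<longrightarrow> 0 \<le> Re (\<Sum>i\<in>F. \<Sum>j\<in>F. cnj (c i) * c j * K i j))"

lemma psd_kernelI:
  assumes "\<And>i j. i \<in> I \<Longrightarrow> j \<in> I \<Longrightarrow> K j i = cnj (K i j)"
    and "\<And>F c. finite F \<Longrightarrow> F \<subseteq> I \<Longrightarrow> 0 \<le> Re (\<Sum>i\<in>F. \<Sum>j\<in>F. cnj (c i) * c j * K i j)"
  shows "psd_kernel I K"
  using assms unfolding psd_kernel_def by blast

lemma psd_kernel_hermitian: "psd_kernel I K \<Longrightarrow> i \<in> I \<Longrightarrow> j \<in> I \<Longrightarrow> K j i = cnj (K i j)"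
  unfolding psd_kernel_def by blast

lemma psd_kernel_nonneg:
  "psd_kernel I K \<Longrightarrow> finite F \<Longrightarrow> F \<subseteq> I \<Longrightarrow> 0 \<le> Re (\<Sum>i\<in>F. \<Sum>j\<in>F. cnj (c i) * c j * K i j)"
  unfolding psd_kernel_def by blast

lemma psd_kernel_subset: "psd_kernel I K \<Longrightarrow> J \<subseteq> I \<Longrightarrow> psd_kernel J K"
  unfolding psd_kernel_def by blast

lemma psd_kernel_sum_Reals:
  assumes "psd_kernel I K" "finite F" "F \<subseteq> I"
  shows "(\<Sum>i\<in>F. \<Sum>j\<in>F. cnj (c i) * c j * K i j) \<in> \<real>\<^sub>\<ge>\<^sub>0"
proof -
  let ?s = "\<Sum>i\<in>F. \<Sum>j\<in>F. cnj (c i) * c j * K i j"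
  have "cnj ?s = (\<Sum>i\<in>F. \<Sum>j\<in>F. c i * cnj (c j) * K j i)"
    unfolding cnj_sum
  proof (intro sum.cong refl)
    fix i j assume "i \<in> F" "j \<in> F"
    then show "cnj (cnj (c i) * c j * K i j) = c i * cnj (c j) * K j i"
      using psd_kernel_hermitian[OF assms(1), of i j] assms(3) by (auto simp: subset_iff)
  qed
  also have "\<dots> = ?s"
    by (subst sum.swap) (simp add: mult_ac)
  finally have "cnj ?s = ?s" .
  moreover have "Im z = 0" if "cnj z = z" for z
    using that by (simp add: complex_eq_iff)
  ultimately have "Im ?s = 0"
    by blast
  then show ?thesis
    using psd_kernel_nonneg[OF assms, of c] by (simp only: complex_nonneg_Reals_iff)
qed

lemma psd_kernel_diag: "psd_kernel I K \<Longrightarrow> i \<in> I \<Longrightarrow> K i i = of_real (Re (K i i)) \<and> 0 \<le> Re (K i i)"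
  using arg_cong[OF psd_kernel_hermitian[of I K i i], of Im] psd_kernel_nonneg[of I K "{i}" "\<lambda>_. 1"]
  by (simp add: complex_eq_iff)

lemma psd_kernel_add:
  assumes K: "psd_kernel I K" and L: "psd_kernel I L"
  shows "psd_kernel I (\<lambda>i j. K i j + L i j)"
proof (rule psd_kernelI)
  fix F and c :: "_ \<Rightarrow> complex" assume F: "finite F" "F \<subseteq> I"
  show "0 \<le> Re (\<Sum>i\<in>F. \<Sum>j\<in>F. cnj (c i) * c j * (K i j + L i j))"
    using psd_kernel_nonneg[OF K F, of c] psd_kernel_nonneg[OF L F, of c]
    by (simp add: distrib_left sum.distrib)
next
  fix i j assume "i \<in> I" "j \<in> I"
  then show "K j i + L j i = cnj (K i j + L i j)"
    using psd_kernel_hermitian[OF K, of i j] psd_kernel_hermitian[OF L, of i j] by simp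
qed

lemma psd_kernel_scale:
  assumes "psd_kernel I K" "r \<ge> 0"
  shows "psd_kernel I (\<lambda>i j. of_real r * K i j)"
proof (rule psd_kernelI)
  fix F and c :: "_ \<Rightarrow> complex" assume F: "finite F" "F \<subseteq> I"
  have "(\<Sum>i\<in>F. \<Sum>j\<in>F. cnj (c i) * c j * (of_real r * K i j)) =
      of_real r * (\<Sum>i\<in>F. \<Sum>j\<in>F. cnj (c i) * c j * K i j)"
    by (simp add: sum_distrib_left mult_ac)
  then show "0 \<le> Re (\<Sum>i\<in>F. \<Sum>j\<in>F. cnj (c i) * c j * (of_real r * K i j))"
    using psd_kernel_nonneg[OF assms(1) F, of c] assms(2) by simp
next
  fix i j assume "i \<in> I" "j \<in> I"
  then show "of_real r * K j i = cnj (of_real r * K i j)"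
    using psd_kernel_hermitian[OF assms(1), of i j] by simp
qed

lemma psd_kernel_cnj:
  assumes "psd_kernel I K"
  shows "psd_kernel I (\<lambda>i j. K j i)"
proof (rule psd_kernelI)
  fix F and c :: "_ \<Rightarrow> complex" assume F: "finite F" "F \<subseteq> I"
  have "(\<Sum>i\<in>F. \<Sum>j\<in>F. cnj (c i) * c j * K j i) = (\<Sum>i\<in>F. \<Sum>j\<in>F. cnj (cnj (c i)) * cnj (c j) * K i j)"
    by (subst sum.swap) (simp add: mult_ac)
  then show "0 \<le> Re (\<Sum>i\<in>F. \<Sum>j\<in>F. cnj (c i) * c j * K j i)"
    using psd_kernel_nonneg[OF assms F, of "\<lambda>i. cnj (c i)"] by simp
next
  fix i j assume "i \<in> I" "j \<in> I"
  then show "K i j = cnj (K j i)"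
    using psd_kernel_hermitian[OF assms, of j i] by simp
qed

lemma psd_kernel_rank_one: "psd_kernel I (\<lambda>i j. cnj (a i) * a j)"
proof (rule psd_kernelI)
  fix F and c :: "_ \<Rightarrow> complex" assume F: "finite F" "F \<subseteq> I"
  have "(\<Sum>i\<in>F. \<Sum>j\<in>F. cnj (c i) * c j * (cnj (a i) * a j)) =
      cnj (\<Sum>i\<in>F. c i * a i) * (\<Sum>i\<in>F. c i * a i)"
    unfolding cnj_sum sum_product by (intro sum.cong refl) (simp add: mult_ac)
  also have "\<dots> = of_real ((cmod (\<Sum>i\<in>F. c i * a i))\<^sup>2)"
    by (simp only: complex_norm_square mult.commute)
  finally show "0 \<le> Re (\<Sum>i\<in>F. \<Sum>j\<in>F. cnj (c i) * c j * (cnj (a i) * a j))"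
    by simp
qed simp

lemma double_sum_insert:
  fixes f :: "'i \<Rightarrow> 'i \<Rightarrow> complex"
  assumes "finite G" "a \<notin> G"
  shows "(\<Sum>i\<in>insert a G. \<Sum>j\<in>insert a G. f i j) =
    f a a + (\<Sum>j\<in>G. f a j) + (\<Sum>i\<in>G. f i a) + (\<Sum>i\<in>G. \<Sum>j\<in>G. f i j)"
  using assms by (simp add: sum.distrib)

text \<open>Cauchy-Schwarz for the form of K between the vector c, supported in G, and the unit
  vector at a.\<close>

lemma psd_kernel_row_bound:
  assumes K: "psd_kernel I K" and G: "finite G" "G \<subseteq> I" "a \<in> I" "a \<notin> G"
  shows "(cmod (\<Sum>j\<in>G. c j * K a j))\<^sup>2 \<le> Re (\<Sum>i\<in>G. \<Sum>j\<in>G. cnj (c i) * c j * K i j) * Re (K a a)"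
proof (rule discriminant_bound)
  fix t :: complex
  \<comment> \<open>The conjugate makes the cross term come out as t times the row sum.\<close>
  define d where "d = c(a := cnj t)"
  have d: "d a = cnj t" "\<And>j. j \<in> G \<Longrightarrow> d j = c j"
    using G(4) by (auto simp: d_def)
  define X where "X = (\<Sum>j\<in>G. c j * K a j)"
  have e1: "(\<Sum>j\<in>G. cnj (d a) * d j * K a j) = t * X"
    by (simp add: X_def d sum_distrib_left mult_ac)
  have e2: "(\<Sum>i\<in>G. cnj (d i) * d a * K i a) = cnj (t * X)"
    unfolding e1[symmetric] cnj_sum
  proof (intro sum.cong refl)
    fix i assume "i \<in> G"
    then show "cnj (d i) * d a * K i a = cnj (cnj (d a) * d i * K a i)"
      using psd_kernel_hermitian[OF K, of a i] G(2,3) by (auto simp: subset_iff)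
  qed
  have e3: "(\<Sum>i\<in>G. \<Sum>j\<in>G. cnj (d i) * d j * K i j) = (\<Sum>i\<in>G. \<Sum>j\<in>G. cnj (c i) * c j * K i j)"
    by (simp add: d)
  have e4: "Re (cnj (d a) * d a * K a a) = (cmod t)\<^sup>2 * Re (K a a)"
    by (simp add: d complex_norm_square[symmetric] flip: of_real_power)
  have "Re (\<Sum>i\<in>insert a G. \<Sum>j\<in>insert a G. cnj (d i) * d j * K i j) =
      Re (\<Sum>i\<in>G. \<Sum>j\<in>G. cnj (c i) * c j * K i j) + 2 * Re (t * (\<Sum>j\<in>G. c j * K a j)) + (cmod t)\<^sup>2 * Re (K a a)"
    unfolding double_sum_insert[OF G(1,4)] e1 e2 e3 plus_complex.sel e4 X_def[symmetric] by simp
  then show "0 \<le> Re (\<Sum>i\<in>G. \<Sum>j\<in>G. cnj (c i) * c j * K i j) + 2 * Re (t * (\<Sum>j\<in>G. c j * K a j)) +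
      (cmod t)\<^sup>2 * Re (K a a)"
    using psd_kernel_nonneg[OF K, of "insert a G" d] G by simp
qed (use psd_kernel_diag[OF K] G in auto)

lemma psd_kernel_row_zero:
  assumes K: "psd_kernel I K" and "a \<in> I" "j \<in> I" "K a a = 0"
  shows "K a j = 0"
  using psd_kernel_row_bound[OF K, of "{j}" a "\<lambda>_. 1"] assms by (cases "j = a") auto

text \<open>Minimizing the form of K over the coefficient at a leaves exactly this kernel; its
  nonnegativity is the row bound divided by K a a. If K a a = 0, the convention x / 0 = 0 leaves K
  unchanged.\<close>

lemma psd_kernel_schur_complement:
  assumes K: "psd_kernel (insert a F) K" and a: "a \<notin> F"
  shows "psd_kernel F (\<lambda>i j. K i j - K i a * K a j / K a a)"
proof (rule psd_kernelI)
  fix i j assume "i \<in> F" "j \<in> F"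
  then show "K j i - K j a * K a i / K a a = cnj (K i j - K i a * K a j / K a a)"
    using psd_kernel_hermitian[OF K, of i j] psd_kernel_hermitian[OF K, of i a]
      psd_kernel_hermitian[OF K, of a j] psd_kernel_hermitian[OF K, of a a]
    by (simp add: mult_ac)
next
  fix G and c :: "_ \<Rightarrow> complex" assume G: "finite G" "G \<subseteq> F"
  define L where "L = (\<Sum>j\<in>G. c j * K a j)"
  have bound: "(cmod L)\<^sup>2 \<le> Re (\<Sum>i\<in>G. \<Sum>j\<in>G. cnj (c i) * c j * K i j) * Re (K a a)"
    unfolding L_def using G a by (intro psd_kernel_row_bound[OF K]) auto
  have "(\<Sum>i\<in>G. \<Sum>j\<in>G. cnj (c i) * c j * (K i a * K a j / K a a)) = cnj L * L / K a a"
  proof -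
    have "cnj L = (\<Sum>i\<in>G. cnj (c i) * K i a)"
      unfolding L_def cnj_sum
    proof (intro sum.cong refl)
      fix i assume "i \<in> G"
      then show "cnj (c i * K a i) = cnj (c i) * K i a"
        using psd_kernel_hermitian[OF K, of a i] G(2) by (auto simp: subset_iff)
    qed
    then have "cnj L * L / K a a = (\<Sum>i\<in>G. \<Sum>j\<in>G. (cnj (c i) * K i a) * (c j * K a j) / K a a)"
      by (simp add: L_def sum_product sum_divide_distrib)
    then show ?thesis by (simp add: mult_ac)
  qed
  also have "\<dots> = of_real ((cmod L)\<^sup>2 / Re (K a a))"
    using psd_kernel_diag[OF K, of a] by (metis complex_norm_square insertI1 mult.commute of_real_divide)
  finally have *: "Re (\<Sum>i\<in>G. \<Sum>j\<in>G. cnj (c i) * c j * (K i j - K i a * K a j / K a a)) =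
      Re (\<Sum>i\<in>G. \<Sum>j\<in>G. cnj (c i) * c j * K i j) - (cmod L)\<^sup>2 / Re (K a a)"
    by (simp add: right_diff_distrib sum_subtractf)
  show "0 \<le> Re (\<Sum>i\<in>G. \<Sum>j\<in>G. cnj (c i) * c j * (K i j - K i a * K a j / K a a))"
    unfolding * using bound psd_kernel_diag[OF K, of a] psd_kernel_nonneg[OF K G(1), of c] G
    by (cases "Re (K a a) = 0") (auto simp: field_simps)
qed

text \<open>Schur's theorem by induction on the index set. K is the sum of a rank-one kernel and its
  Schur complement at a. The product of the former with L is L tested on rescaled coefficients; the
  latter has zero row and column at a, so the induction hypothesis applies to it.\<close>

theorem psd_kernel_mult:
  assumes K: "psd_kernel I K" and L: "psd_kernel I L"
  shows "psd_kernel I (\<lambda>i j. K i j * L i j)"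
proof (rule psd_kernelI)
  fix F and c :: "_ \<Rightarrow> complex" assume "finite F" "F \<subseteq> I"
  then show "0 \<le> Re (\<Sum>i\<in>F. \<Sum>j\<in>F. cnj (c i) * c j * (K i j * L i j))"
    using psd_kernel_subset[OF K \<open>F \<subseteq> I\<close>]
  proof (induction F arbitrary: K rule: finite_induct)
    case (insert a F)
    let ?I = "insert a F"
    define K' where "K' i j = K i j - K i a * K a j / K a a" for i j
    have K': "psd_kernel F K'"
      unfolding K'_def using insert by (intro psd_kernel_schur_complement) auto
    have zero: "K' a j = 0" "K' j a = 0" if "j \<in> ?I" for j
      using psd_kernel_row_zero[OF insert.prems(2), of a j] psd_kernel_hermitian[OF insert.prems(2), of a j] that
      by (auto simp: K'_def)
    have "(\<Sum>i\<in>?I. \<Sum>j\<in>?I. cnj (c i) * c j * (K' i j * L i j)) =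
        (\<Sum>i\<in>F. \<Sum>j\<in>F. cnj (c i) * c j * (K' i j * L i j))"
      unfolding double_sum_insert[OF insert.hyps(1,2)] by (simp add: zero)
    moreover have "0 \<le> Re (\<Sum>i\<in>F. \<Sum>j\<in>F. cnj (c i) * c j * (K' i j * L i j))"
      using insert.prems(1) K' by (intro insert.IH) auto
    moreover have "(\<Sum>i\<in>?I. \<Sum>j\<in>?I. cnj (c i) * c j * (K i a * K a j / K a a * L i j)) =
        of_real (1 / Re (K a a)) * (\<Sum>i\<in>?I. \<Sum>j\<in>?I. cnj (c i * K a i) * (c j * K a j) * L i j)"
    proof -
      have Kaa: "K a a = of_real (Re (K a a))"
        using psd_kernel_diag[OF insert.prems(2), of a] by simp
      have "cnj (c i) * c j * (K i a * K a j / K a a * L i j) =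
          of_real (1 / Re (K a a)) * (cnj (c i * K a i) * (c j * K a j) * L i j)" if "i \<in> ?I" for i j
        using psd_kernel_hermitian[OF insert.prems(2) insertI1 that]
        by (subst Kaa) (simp add: mult_ac)
      then show ?thesis
        unfolding sum_distrib_left by (intro sum.cong refl) blast
    qed
    moreover have "0 \<le> Re (of_real (1 / Re (K a a)) * (\<Sum>i\<in>?I. \<Sum>j\<in>?I. cnj (c i * K a i) * (c j * K a j) * L i j))"
    proof -
      have "0 \<le> Re (\<Sum>i\<in>?I. \<Sum>j\<in>?I. cnj (c i * K a i) * (c j * K a j) * L i j)"
        using insert.hyps(1) insert.prems(1) by (intro psd_kernel_nonneg[OF L]) auto
      moreover have "0 \<le> 1 / Re (K a a)"
        using psd_kernel_diag[OF insert.prems(2), of a] by simp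
      ultimately show ?thesis
        unfolding Re_complex_of_real[symmetric] using mult_nonneg_nonneg by (simp del: sum.insert)
    qed
    moreover have "(\<Sum>i\<in>?I. \<Sum>j\<in>?I. cnj (c i) * c j * (K i j * L i j)) =
      (\<Sum>i\<in>?I. \<Sum>j\<in>?I. cnj (c i) * c j * (K' i j * L i j)) +
      (\<Sum>i\<in>?I. \<Sum>j\<in>?I. cnj (c i) * c j * (K i a * K a j / K a a * L i j))"
      unfolding sum.distrib[symmetric] by (intro sum.cong refl) (simp add: K'_def algebra_simps)
    ultimately show ?case by (simp del: sum.insert)
  qed simp
next
  fix i j assume "i \<in> I" "j \<in> I"
  then show "K j i * L j i = cnj (K i j * L i j)"
    using psd_kernel_hermitian[OF K, of i j] psd_kernel_hermitian[OF L, of i j] by simp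
qed

lemma psd_kernel_power: "psd_kernel I K \<Longrightarrow> psd_kernel I (\<lambda>i j. K i j ^ n)"
proof (induction n)
  case 0
  show ?case using psd_kernel_rank_one[of I "\<lambda>_. 1"] by simp
next
  case (Suc n)
  then show ?case by (simp add: psd_kernel_mult)
qed

text \<open>The exponential series has nonnegative coefficients, and its terms are positive
  semidefinite by Schur's theorem.\<close>

lemma psd_kernel_exp:
  assumes K: "psd_kernel I K"
  shows "psd_kernel I (\<lambda>i j. exp (K i j))"
proof (rule psd_kernelI)
  fix F and c :: "_ \<Rightarrow> complex" assume F: "finite F" "F \<subseteq> I"
  have "(\<lambda>n. \<Sum>i\<in>F. \<Sum>j\<in>F. cnj (c i) * c j * (K i j ^ n /\<^sub>R fact n)) sums
      (\<Sum>i\<in>F. \<Sum>j\<in>F. cnj (c i) * c j * exp (K i j))"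
    by (intro sums_sum sums_mult exp_converges)
  then have sums: "(\<lambda>n. Re (\<Sum>i\<in>F. \<Sum>j\<in>F. cnj (c i) * c j * (K i j ^ n /\<^sub>R fact n))) sums
      Re (\<Sum>i\<in>F. \<Sum>j\<in>F. cnj (c i) * c j * exp (K i j))"
    by (rule sums_Re)
  have "0 \<le> Re (\<Sum>i\<in>F. \<Sum>j\<in>F. cnj (c i) * c j * (K i j ^ n /\<^sub>R fact n))" for n
    using psd_kernel_nonneg[OF psd_kernel_scale[OF psd_kernel_power[OF K], of "inverse (fact n)" n] F, of c]
    by (simp add: scaleR_conv_of_real)
  then show "0 \<le> Re (\<Sum>i\<in>F. \<Sum>j\<in>F. cnj (c i) * c j * exp (K i j))"
    using sums_le[OF _ sums_zero sums] by blast
next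
  fix i j assume "i \<in> I" "j \<in> I"
  then show "exp (K j i) = cnj (exp (K i j))"
    using psd_kernel_hermitian[OF K, of i j] by (simp add: exp_cnj)
qed

section \<open>Fourier transforms of test functions\<close>

lemma test_function_support:
  assumes "test_function g"
  obtains K where "K > 0" "\<And>x. K \<le> \<bar>x\<bar> \<Longrightarrow> g x = 0"
proof -
  have "bounded {x. g x \<noteq> 0}"
    using assms compact_imp_bounded bounded_subset closure_subset by (auto simp: test_function_def)
  then obtain b where b: "b > 0" "\<And>x. g x \<noteq> 0 \<Longrightarrow> \<bar>x\<bar> \<le> b"
    unfolding bounded_pos by auto
  show thesis
    by (rule that[of "b + 1"]) (use b in force)+
qed

lemma test_function_derivative:
  assumes "test_function g"
  obtains g' where "test_function g'" "\<And>x. (g has_vector_derivative g' x) (at x)"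
proof -
  obtain D where D: "D 0 = g" "\<And>n x. (D n has_vector_derivative D (Suc n) x) (at x)"
    using assms by (auto simp: test_function_def)
  have "D (Suc 0) x = 0" if "x \<notin> closure {x. g x \<noteq> 0}" for x
  proof -
    have "(g has_vector_derivative 0) (at x)"
    proof (rule has_vector_derivative_transform_within_open)
      show "((\<lambda>_. 0) has_vector_derivative 0) (at x)" by simp
      show "open (- closure {x. g x \<noteq> 0})" by auto
      show "x \<in> - closure {x. g x \<noteq> 0}" using that by simp
      show "0 = g y" if "y \<in> - closure {x. g x \<noteq> 0}" for y
        using that closure_subset[of "{x. g x \<noteq> 0}"] by auto
    qed
    moreover have "(g has_vector_derivative D (Suc 0) x) (at x)"
      using D(2)[of 0 x] by (simp only: D(1))
    ultimately show ?thesis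
      by (metis vector_derivative_unique_at)
  qed
  then have "closure {x. D (Suc 0) x \<noteq> 0} \<subseteq> closure {x. g x \<noteq> 0}"
    by (intro closure_minimal) auto
  then have "compact (closure {x. D (Suc 0) x \<noteq> 0})"
    using assms compact_Int_closed[of "closure {x. g x \<noteq> 0}" "closure {x. D (Suc 0) x \<noteq> 0}"]
    by (auto simp: test_function_def Int_absorb1)
  then have "test_function (D (Suc 0))"
    unfolding test_function_def using D(2) by (intro conjI exI[of _ "\<lambda>n. D (Suc n)"]) auto
  moreover have "(g has_vector_derivative D (Suc 0) x) (at x)" for x
    using D(2)[of 0 x] by (simp only: D(1))
  ultimately show thesis
    by (rule that)
qed

lemma test_function_continuous: "test_function g \<Longrightarrow> continuous_on A g"
  using test_function_derivative has_vector_derivative_continuous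
  by (metis continuous_at_imp_continuous_on)

lemma fourier_eq_integral:
  assumes g: "test_function g" and K: "K > 0" "\<And>x. K \<le> \<bar>x\<bar> \<Longrightarrow> g x = 0"
  shows "fourier g z = integral {-K..K} (\<lambda>x. exp (- (\<i> * z * complex_of_real x)) * g x)"
proof -
  let ?f = "\<lambda>x. exp (- (\<i> * z * complex_of_real x)) * g x"
  have "continuous_on {-K..K} ?f"
    by (intro continuous_intros test_function_continuous[OF g])
  then have "set_integrable lborel {-K..K} ?f"
    by (rule borel_integrable_atLeastAtMost')
  then have "(LINT x:{-K..K}|lborel. ?f x) = integral {-K..K} ?f"
    by (rule set_borel_integral_eq_integral)
  moreover have "(LINT x:{-K..K}|lborel. ?f x) = fourier g z"
    unfolding fourier_def set_lebesgue_integral_def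
    by (intro Bochner_Integration.integral_cong) (auto simp: indicator_def K(2) abs_if)
  ultimately show ?thesis by simp
qed

lemma fourier_bound:
  assumes g: "test_function g"
  obtains C where "\<And>z. 0 \<le> Im z \<Longrightarrow> Im z \<le> \<beta> \<Longrightarrow> cmod (fourier g z) \<le> C"
proof -
  obtain K where K: "K > 0" "\<And>x. K \<le> \<bar>x\<bar> \<Longrightarrow> g x = 0"
    using test_function_support[OF g] by blast
  have "compact (g ` {-K..K})"
    by (intro compact_continuous_image test_function_continuous g) auto
  then obtain B where B: "B > 0" "\<And>x. x \<in> {-K..K} \<Longrightarrow> cmod (g x) \<le> B"
    using compact_imp_bounded bounded_pos by (metis imageI)
  have "cmod (fourier g z) \<le> exp (\<beta> * K) * B * (K - (- K))" if z: "0 \<le> Im z" "Im z \<le> \<beta>" for z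
  proof (subst fourier_eq_integral[OF g K], assumption, rule integral_bound)
    show "continuous_on {-K..K} (\<lambda>x. exp (- (\<i> * z * complex_of_real x)) * g x)"
      by (intro continuous_intros test_function_continuous[OF g])
    fix x assume x: "x \<in> {-K..K}"
    have "Im z * x \<le> \<beta> * K"
    proof -
      have "Im z * x \<le> Im z * K" using x z by (intro mult_left_mono) auto
      also have "\<dots> \<le> \<beta> * K" using z K by (intro mult_right_mono) auto
      finally show ?thesis .
    qed
    then have "cmod (exp (- (\<i> * z * complex_of_real x))) \<le> exp (\<beta> * K)"
      by (simp add: norm_exp_eq_Re)
    then show "cmod (exp (- (\<i> * z * complex_of_real x)) * g x) \<le> exp (\<beta> * K) * B"
      unfolding norm_mult using B(2)[OF x] by (intro mult_mono) auto
  qed (use K in auto)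
  then show thesis by (rule that)
qed

lemma fourier_derivative:
  assumes g: "test_function g" and g': "test_function g'" "\<And>x. (g has_vector_derivative g' x) (at x)"
  shows "fourier g' z = \<i> * z * fourier g z"
proof -
  obtain K1 where K1: "K1 > 0" "\<And>x. K1 \<le> \<bar>x\<bar> \<Longrightarrow> g x = 0"
    using test_function_support[OF g] by blast
  obtain K2 where K2: "K2 > 0" "\<And>x. K2 \<le> \<bar>x\<bar> \<Longrightarrow> g' x = 0"
    using test_function_support[OF g'(1)] by blast
  define K where "K = max K1 K2"
  have K: "K > 0" "\<And>x. K \<le> \<bar>x\<bar> \<Longrightarrow> g x = 0" "\<And>x. K \<le> \<bar>x\<bar> \<Longrightarrow> g' x = 0"
    using K1 K2 by (auto simp: K_def)
  let ?e = "\<lambda>x. exp (- (\<i> * z * complex_of_real x))"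
  have "((\<lambda>x. ?e x * g' x + (- \<i> * z) * (?e x * g x)) has_integral (?e K * g K - ?e (-K) * g (-K))) {-K..K}"
  proof (rule fundamental_theorem_of_calculus)
    fix x
    have "(?e has_vector_derivative (- \<i> * z) * ?e x) (at x)"
      by (rule has_vector_derivative_eq_rhs, rule has_vector_derivative_real_field)
        (auto intro!: derivative_eq_intros)
    then have "((\<lambda>x. ?e x * g x) has_vector_derivative (?e x * g' x + (- \<i> * z) * ?e x * g x)) (at x)"
      by (rule has_vector_derivative_mult[OF _ g'(2)])
    then show "((\<lambda>x. ?e x * g x) has_vector_derivative (?e x * g' x + (- \<i> * z) * (?e x * g x)))
        (at x within {-K..K})"
      by (simp add: mult.assoc has_vector_derivative_at_within)
  qed (use K in auto)
  then have "integral {-K..K} (\<lambda>x. ?e x * g' x + (- \<i> * z) * (?e x * g x)) = 0"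
    using K by (simp add: integral_unique)
  moreover have "(\<lambda>x. ?e x * g' x) integrable_on {-K..K}" "(\<lambda>x. ?e x * g x) integrable_on {-K..K}"
    by (intro integrable_continuous_interval continuous_intros test_function_continuous g g'(1))+
  ultimately have "integral {-K..K} (\<lambda>x. ?e x * g' x) + (- \<i> * z) * integral {-K..K} (\<lambda>x. ?e x * g x) = 0"
    using integral_add[of "\<lambda>x. ?e x * g' x" "{-K..K}" "\<lambda>x. (- \<i> * z) * (?e x * g x)"]
    by (simp only: integral_mult_right integrable_on_mult_right)
  moreover have "fourier g z = integral {-K..K} (\<lambda>x. ?e x * g x)"
      "fourier g' z = integral {-K..K} (\<lambda>x. ?e x * g' x)"
    by (rule fourier_eq_integral[OF g K(1,2)] fourier_eq_integral[OF g'(1) K(1,3)]; assumption)+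
  ultimately show ?thesis
    by (simp add: add_eq_0_iff2)
qed

text \<open>Integrating by parts twice turns multiplication by -z^2 into a second derivative, whose
  transform is bounded on the strip. Quadratic decay is what integrability on horizontal lines and
  the vanishing of the vertical sides require.\<close>

lemma fourier_decay:
  assumes g: "test_function g"
  obtains C where "\<And>z. 0 \<le> Im z \<Longrightarrow> Im z \<le> \<beta> \<Longrightarrow> (1 + (Re z)\<^sup>2) * cmod (fourier g z) \<le> C"
proof -
  obtain g' where g': "test_function g'" "\<And>x. (g has_vector_derivative g' x) (at x)"
    using test_function_derivative[OF g] by blast
  obtain g'' where g'': "test_function g''" "\<And>x. (g' has_vector_derivative g'' x) (at x)"
    using test_function_derivative[OF g'(1)] by blast
  obtain C0 where C0: "\<And>z. 0 \<le> Im z \<Longrightarrow> Im z \<le> \<beta> \<Longrightarrow> cmod (fourier g z) \<le> C0"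
    using fourier_bound[OF g] by blast
  obtain C2 where C2: "\<And>z. 0 \<le> Im z \<Longrightarrow> Im z \<le> \<beta> \<Longrightarrow> cmod (fourier g'' z) \<le> C2"
    using fourier_bound[OF g''(1)] by blast
  have "(1 + (Re z)\<^sup>2) * cmod (fourier g z) \<le> C0 + C2" if z: "0 \<le> Im z" "Im z \<le> \<beta>" for z
  proof -
    have "cmod (fourier g'' z) = (cmod z)\<^sup>2 * cmod (fourier g z)"
      unfolding fourier_derivative[OF g'(1) g''] fourier_derivative[OF g g']
      by (simp add: norm_mult power2_eq_square)
    moreover have "(Re z)\<^sup>2 * cmod (fourier g z) \<le> (cmod z)\<^sup>2 * cmod (fourier g z)"
      by (intro mult_right_mono) (simp_all add: cmod_power2)
    ultimately show ?thesis
      using C0[OF z] C2[OF z] by (simp add: distrib_right)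
  qed
  then show thesis by (rule that)
qed

lemma fourier_holomorphic:
  assumes g: "test_function g"
  shows "fourier g holomorphic_on UNIV"
proof -
  obtain K where K: "K > 0" "\<And>x. K \<le> \<bar>x\<bar> \<Longrightarrow> g x = 0"
    using test_function_support[OF g] by blast
  have g2: "continuous_on (UNIV \<times> {-K..K}) (\<lambda>p. g (snd p))"
    by (rule continuous_on_compose2[OF test_function_continuous[OF g, of UNIV]])
      (auto intro: continuous_intros)
  have "(\<lambda>z. integral (cbox (-K) K) (\<lambda>x. exp (- (\<i> * z * complex_of_real x)) * g x)) holomorphic_on UNIV"
  proof (rule leibniz_rule_holomorphic)
    show "((\<lambda>z. exp (- (\<i> * z * complex_of_real t)) * g t) has_field_derivative
        - \<i> * complex_of_real t * exp (- (\<i> * z * complex_of_real t)) * g t) (at z within UNIV)" for z t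
      by (auto intro!: derivative_eq_intros)
    show "(\<lambda>x. exp (- (\<i> * z * complex_of_real x)) * g x) integrable_on cbox (-K) K" for z
      by (intro integrable_continuous continuous_intros test_function_continuous[OF g])
    show "continuous_on (UNIV \<times> cbox (-K) K)
        (\<lambda>(z, t). - \<i> * complex_of_real t * exp (- (\<i> * z * complex_of_real t)) * g t)"
      using g2 by (auto simp: case_prod_unfold intro!: continuous_intros)
  qed auto
  then show ?thesis
    using fourier_eq_integral[OF g K] by (simp add: fun_eq_iff[symmetric] cong: holomorphic_cong)
qed

section \<open>Shifting the line of integration\<close>

lemma integrable_decay:
  fixes f :: "real \<Rightarrow> complex"
  assumes "continuous_on UNIV f" "\<And>t. (1 + t\<^sup>2) * cmod (f t) \<le> C"
  shows "integrable lborel f"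
proof (rule Bochner_Integration.integrable_bound)
  show "integrable lborel (\<lambda>t::real. C * inverse (1 + t\<^sup>2))"
    using integrable_inverse_1_plus_square by (simp add: set_integrable_def)
  show "f \<in> borel_measurable lborel"
    using borel_measurable_continuous_onI[OF assms(1)] by simp
  have "cmod (f t) \<le> norm (C * inverse (1 + t\<^sup>2))" for t
  proof -
    have "0 < 1 + t\<^sup>2" by (simp add: add_pos_nonneg)
    then have "cmod (f t) \<le> C * inverse (1 + t\<^sup>2)"
      using assms(2)[of t] by (simp add: field_simps)
    then show ?thesis by simp
  qed
  then show "AE t in lborel. cmod (f t) \<le> norm (C * inverse (1 + t\<^sup>2))"
    by simp
qed

lemma LIMSEQ_integral_symmetric:
  fixes f :: "real \<Rightarrow> complex"
  assumes "integrable lborel f"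
  shows "(\<lambda>n. LINT t|lborel. indicator {- real n..real n} t *\<^sub>R f t) \<longlonglongrightarrow> (LINT t|lborel. f t)"
proof (rule integral_dominated_convergence)
  show "integrable lborel (\<lambda>t. norm (f t))" using assms by simp
  have "(\<lambda>n. indicator {- real n..real n} t *\<^sub>R f t) \<longlonglongrightarrow> f t" for t
  proof (rule tendsto_eventually)
    obtain N where "\<bar>t\<bar> \<le> real N" by (meson real_arch_simple)
    then show "\<forall>\<^sub>F n in sequentially. indicator {- real n..real n} t *\<^sub>R f t = f t"
      by (intro eventually_sequentiallyI[of N]) (auto simp: indicator_def)
  qed
  then show "AE t in lborel. (\<lambda>n. indicator {- real n..real n} t *\<^sub>R f t) \<longlonglongrightarrow> f t"
    by simp
qed (use assms in \<open>auto simp: indicator_def intro!: borel_measurable_integrable\<close>)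

text \<open>Cauchy's theorem for rectangles through a primitive P: the integral over [-n, n] on a
  horizontal line is an increment of P, and the two lines differ by increments of P along vertical
  segments, of size at most C beta / (1 + n^2).\<close>

lemma contour_shift:
  fixes F :: "complex \<Rightarrow> complex"
  assumes holo: "F holomorphic_on UNIV" and "\<beta> > 0"
    and decay: "\<And>z. 0 \<le> Im z \<Longrightarrow> Im z \<le> \<beta> \<Longrightarrow> (1 + (Re z)\<^sup>2) * cmod (F z) \<le> C"
  shows "(LINT t|lborel. F (complex_of_real t)) = (LINT t|lborel. F (complex_of_real t + \<i> * complex_of_real \<beta>))"
proof -
  obtain P where P: "\<And>z. (P has_field_derivative F z) (at z)"
    using holomorphic_convex_primitive'[OF convex_UNIV open_UNIV holo] by auto
  have cont: "continuous_on UNIV (\<lambda>t. F (complex_of_real t + \<i> * complex_of_real s))" for s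
    by (rule continuous_on_compose2[OF holomorphic_on_imp_continuous_on[OF holo]])
      (auto intro!: continuous_intros)
  have lim: "(\<lambda>n. P (of_real (real n) + \<i> * of_real s) - P (of_real (- real n) + \<i> * of_real s))
      \<longlonglongrightarrow> (LINT t|lborel. F (of_real t + \<i> * of_real s))" if "0 \<le> s" "s \<le> \<beta>" for s
  proof -
    have "integrable lborel (\<lambda>t. F (of_real t + \<i> * of_real s))"
      using decay[of "of_real _ + \<i> * of_real s"] that by (intro integrable_decay[OF cont]) auto
    note LIMSEQ_integral_symmetric[OF this]
    moreover have "(LINT t|lborel. indicator {- real n..real n} t *\<^sub>R F (of_real t + \<i> * of_real s)) =
        P (of_real (real n) + \<i> * of_real s) - P (of_real (- real n) + \<i> * of_real s)" for n
    proof (rule integral_FTC_Icc)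
      fix t
      have "((\<lambda>t. P (of_real t + \<i> * of_real s)) has_vector_derivative
          F (of_real t + \<i> * of_real s) * 1) (at t)"
      proof (rule has_vector_derivative_real_field[where f = "\<lambda>z. P (z + \<i> * of_real s)"])
        show "((\<lambda>z. P (z + \<i> * of_real s)) has_field_derivative F (of_real t + \<i> * of_real s) * 1) (at (of_real t))"
          by (rule DERIV_chain2[where g = "\<lambda>z. z + \<i> * of_real s", OF P]) (auto intro!: derivative_eq_intros)
      qed
      then show "((\<lambda>t. P (of_real t + \<i> * of_real s)) has_vector_derivative
          F (of_real t + \<i> * of_real s)) (at t within {- real n..real n})"
        by (simp add: has_vector_derivative_at_within)
    qed (auto intro: continuous_on_subset[OF cont])
    ultimately show ?thesis by simp
  qed
  have vert: "cmod (P (of_real x + \<i> * of_real \<beta>) - P (of_real x)) \<le> C / (1 + x\<^sup>2) * \<beta>" for x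
  proof -
    have "cmod (P (of_real x + \<i> * of_real \<beta>) - P (of_real x)) \<le>
        C / (1 + x\<^sup>2) * cmod (of_real x + \<i> * of_real \<beta> - of_real x)"
    proof (rule field_differentiable_bound)
      show "convex (closed_segment (of_real x) (of_real x + \<i> * of_real \<beta>))"
        by (rule convex_closed_segment)
      fix z assume z: "z \<in> closed_segment (complex_of_real x) (of_real x + \<i> * of_real \<beta>)"
      show "(P has_field_derivative F z) (at z within closed_segment (of_real x) (of_real x + \<i> * of_real \<beta>))"
        by (rule has_field_derivative_at_within[OF P])
      obtain u where u: "0 \<le> u" "u \<le> 1" "z = (1 - u) *\<^sub>R of_real x + u *\<^sub>R (of_real x + \<i> * of_real \<beta>)"
        using z by (auto simp: closed_segment_def)
      have "Re z = x" "Im z = u * \<beta>" "u * \<beta> \<le> 1 * \<beta>"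
        using u \<open>\<beta> > 0\<close> by (auto simp: algebra_simps intro: mult_right_mono)
      then have "(1 + x\<^sup>2) * cmod (F z) \<le> C"
        using decay[of z] u \<open>\<beta> > 0\<close> by simp
      moreover have "0 < 1 + x\<^sup>2" by (simp add: add_pos_nonneg)
      ultimately show "cmod (F z) \<le> C / (1 + x\<^sup>2)"
        by (simp add: field_simps)
    qed auto
    then show ?thesis using \<open>\<beta> > 0\<close> by (simp add: norm_mult)
  qed
  have small: "(\<lambda>n. P (of_real (x n) + \<i> * of_real \<beta>) - P (of_real (x n))) \<longlonglongrightarrow> 0"
    if x: "\<And>n. (x n)\<^sup>2 = (real n)\<^sup>2" for x
  proof (rule Lim_null_comparison)
    show "\<forall>\<^sub>F n in sequentially. cmod (P (of_real (x n) + \<i> * of_real \<beta>) - P (of_real (x n))) \<le> C / (1 + (real n)\<^sup>2) * \<beta>"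
      using vert[of "x _"] by (simp add: x)
    show "(\<lambda>n. C / (1 + (real n)\<^sup>2) * \<beta>) \<longlonglongrightarrow> 0"
      by real_asymp
  qed
  have "(\<lambda>n. (P (of_real (real n)) - P (of_real (- real n))) +
      ((P (of_real (real n) + \<i> * of_real \<beta>) - P (of_real (real n))) -
       (P (of_real (- real n) + \<i> * of_real \<beta>) - P (of_real (- real n)))))
      \<longlonglongrightarrow> (LINT t|lborel. F (of_real t)) + (0 - 0)"
    using lim[of 0] \<open>\<beta> > 0\<close> by (intro tendsto_add tendsto_diff small) simp_all
  then have shifted: "(\<lambda>n. P (of_real (real n) + \<i> * of_real \<beta>) - P (of_real (- real n) + \<i> * of_real \<beta>))
      \<longlonglongrightarrow> (LINT t|lborel. F (of_real t))"
    by (simp add: algebra_simps)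
  show ?thesis
    using \<open>\<beta> > 0\<close> by (intro LIMSEQ_unique[OF shifted lim]) auto
qed

section \<open>Reduction of the KMS condition to Weyl operators\<close>

context weyl_system
begin

text \<open>The bound is uniform in t, so approximation of a by Weyl polynomials is a uniform limit
  in t. P is kept abstract because the lemma is applied to each of the two arguments of the
  correlation function in turn.\<close>

lemma continuous_if_continuous_on_weyl:
  fixes P :: "'a \<Rightarrow> real \<Rightarrow> complex"
  assumes add: "\<And>a b t. P (a + b) t = P a t + P b t"
    and scale: "\<And>c a t. P (c *\<^sub>C a) t = c * P a t"
    and bound: "\<And>a t. cmod (P a t) \<le> C * norm a"
    and weyl: "\<And>f. f \<in> S \<Longrightarrow> continuous_on UNIV (P (W f))"
  shows "continuous_on UNIV (P a)"
proof -
  have zero: "P 0 = (\<lambda>t. 0)" using bound[of 0] by auto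
  have diff: "P (a - b) t = P a t - P b t" for a b t
    using add[of a "- b" t] scale[of "-1" b t] by (simp add: CV_minus_one)
  have M: "continuous_on UNIV (P a)" if "a \<in> M" for a
    using that
  proof (induction rule: CV.span_induct_alt)
    case (step c w z)
    then have "continuous_on UNIV (\<lambda>t. c * P w t + P z t)"
      using weyl by (auto intro!: continuous_intros)
    then show ?case by (simp add: add scale)
  qed (simp add: zero)
  obtain s where s: "\<And>n::nat. s n \<in> M" "s \<longlonglongrightarrow> a" using approx by blast
  have "uniform_limit UNIV (\<lambda>n. P (s n)) (P a) sequentially"
  proof (rule uniform_limitI)
    fix e :: real assume "e > 0"
    have "(\<lambda>n. C * norm (s n - a)) \<longlonglongrightarrow> C * norm (a - a)"
      by (intro tendsto_intros s)
    then have "\<forall>\<^sub>F n in sequentially. C * norm (s n - a) < e"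
      using \<open>e > 0\<close> by (intro order_tendstoD) auto
    then show "\<forall>\<^sub>F n in sequentially. \<forall>t\<in>UNIV. dist (P (s n) t) (P a t) < e"
      by eventually_elim (metis bound diff dist_norm order_le_less_trans)
  qed
  then show ?thesis
    by (rule uniform_limit_theorem[rotated]) (auto intro: M s always_eventually)
qed

lemma integrable_bounded_mult:
  fixes p h :: "real \<Rightarrow> complex"
  assumes "continuous_on UNIV p" "\<And>t. cmod (p t) \<le> C" "integrable lborel h"
  shows "integrable lborel (\<lambda>t. p t * h t)"
proof (rule Bochner_Integration.integrable_bound)
  show "integrable lborel (\<lambda>t. of_real C * h t)"
    using assms(3) by simp
  show "(\<lambda>t. p t * h t) \<in> borel_measurable lborel"
    using borel_measurable_continuous_onI[OF assms(1)] assms(3) by simp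
  have "cmod (p t * h t) \<le> norm (of_real C * h t)" for t
    using order_trans[OF assms(2)[of t] abs_ge_self] by (simp add: norm_mult mult_right_mono)
  then show "AE t in lborel. cmod (p t * h t) \<le> norm (of_real C * h t)"
    by simp
qed

text \<open>Both integrals are bounded complex linear functionals of a, and such functionals are
  determined by their values on Weyl operators.\<close>

lemma integral_eq_if_eq_on_weyl:
  fixes P Q :: "'a \<Rightarrow> real \<Rightarrow> complex"
  assumes P: "\<And>a b t. P (a + b) t = P a t + P b t" "\<And>c a t. P (c *\<^sub>C a) t = c * P a t"
      "\<And>a t. cmod (P a t) \<le> C * norm a" "\<And>a. continuous_on UNIV (P a)"
    and Q: "\<And>a b t. Q (a + b) t = Q a t + Q b t" "\<And>c a t. Q (c *\<^sub>C a) t = c * Q a t"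
      "\<And>a t. cmod (Q a t) \<le> C * norm a" "\<And>a. continuous_on UNIV (Q a)"
    and h: "integrable lborel h" "integrable lborel k"
    and weyl: "\<And>f. f \<in> S \<Longrightarrow> (LINT t|lborel. P (W f) t * h t) = (LINT t|lborel. Q (W f) t * k t)"
  shows "(LINT t|lborel. P a t * h t) = (LINT t|lborel. Q a t * k t)"
proof -
  have bl: "bounded_linear (\<lambda>a. LINT t|lborel. R a t * l t)"
    and sc: "(LINT t|lborel. R (c *\<^sub>C a) t * l t) = c *\<^sub>C (LINT t|lborel. R a t * l t)"
    if R: "\<And>a b t. R (a + b) t = R a t + R b t" "\<And>c a t. R (c *\<^sub>C a) t = c * R a t"
      "\<And>a t. cmod (R a t) \<le> C * norm a" "\<And>a. continuous_on UNIV (R a)" "integrable lborel l"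
    for R :: "'a \<Rightarrow> real \<Rightarrow> complex" and l c a
  proof -
    have int: "integrable lborel (\<lambda>t. R a t * l t)" for a
      by (rule integrable_bounded_mult[OF R(4,3,5)])
    show sc: "(LINT t|lborel. R (c *\<^sub>C a) t * l t) = c *\<^sub>C (LINT t|lborel. R a t * l t)" for c a
      by (simp add: R(2) scaleC_complex_def mult.assoc)
    show "bounded_linear (\<lambda>a. LINT t|lborel. R a t * l t)"
    proof (rule bounded_linear_intro)
      show "(LINT t|lborel. R (a + b) t * l t) = (LINT t|lborel. R a t * l t) + (LINT t|lborel. R b t * l t)" for a b
        by (simp add: R(1) distrib_right int)
      show "(LINT t|lborel. R (r *\<^sub>R a) t * l t) = r *\<^sub>R (LINT t|lborel. R a t * l t)" for r a
        by (simp only: scaleR_scaleC sc)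
      fix a
      have "norm (LINT t|lborel. R a t * l t) \<le> (LINT t|lborel. C * norm a * norm (l t))"
      proof (rule Bochner_Integration.integral_norm_bound[THEN order_trans], rule integral_mono)
        show "norm (R a t * l t) \<le> C * norm a * norm (l t)" for t
          unfolding norm_mult by (intro mult_right_mono R) auto
      qed (use int R(5) in auto)
      then show "norm (LINT t|lborel. R a t * l t) \<le> norm a * (C * (LINT t|lborel. norm (l t)))"
        by (simp add: mult_ac)
    qed
  qed
  show ?thesis
    by (rule eq_if_eq_on_weyl[OF bl[OF P h(1)] bl[OF Q h(2)] sc[OF P h(1)] sc[OF Q h(2)] weyl])
qed

text \<open>For Weyl operators the identity is a contour shift of the entire function times the
  transform of the test function. Density extends it one argument at a time; for the argument that
  is evolved this needs the contractivity of the evolution.\<close>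

lemma kms_state_if_kms_on_weyl:
  assumes \<omega>: "is_state \<omega>" and \<alpha>: "induced_evolution S W T \<alpha>"
    and T: "\<And>t f. f \<in> S \<Longrightarrow> T t f \<in> S" "\<And>t f. f \<in> S \<Longrightarrow> T t f = 0 \<longleftrightarrow> f = 0"
    and "\<beta> > 0"
    and entire: "\<And>f g. f \<in> S \<Longrightarrow> g \<in> S \<Longrightarrow> \<exists>\<Phi> B. \<Phi> holomorphic_on UNIV \<and>
      (\<forall>z. 0 \<le> Im z \<longrightarrow> Im z \<le> \<beta> \<longrightarrow> cmod (\<Phi> z) \<le> B) \<and>
      (\<forall>t. \<omega> (W f * W (T t g)) = \<Phi> (complex_of_real t)) \<and>
      (\<forall>t. \<omega> (W (T t g) * W f) = \<Phi> (complex_of_real t + \<i> * complex_of_real \<beta>))"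
  shows "kms_state \<beta> \<alpha> \<omega>"
proof -
  interpret state \<omega> by unfold_locales fact
  have \<alpha>W: "\<alpha> t (W f) = W (T t f)" if "f \<in> S" for t f
    using \<alpha> that by (simp add: induced_evolution_def)
  have \<alpha>lin: "\<alpha> t (a + b) = \<alpha> t a + \<alpha> t b" "\<alpha> t (c *\<^sub>C a) = c *\<^sub>C \<alpha> t a" for t a b c
    using \<alpha> by (auto simp: induced_evolution_def automorphism_group_def star_automorphism_def)
  have \<alpha>le: "norm (\<alpha> t a) \<le> norm a" for t a
    by (rule evolution_contractive[OF \<alpha> T])
  define P where "P a b t = \<omega> (a * \<alpha> t b)" for a b t
  define Q where "Q a b t = \<omega> (\<alpha> t b * a)" for a b t
  have P: "P (a + a') b t = P a b t + P a' b t" "P (c *\<^sub>C a) b t = c * P a b t"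
      "P a (b + b') t = P a b t + P a b' t" "P a (c *\<^sub>C b) t = c * P a b t" for a a' b b' c t
    by (simp_all add: P_def \<alpha>lin distrib_left distrib_right mult_scaleC_left mult_scaleC_right add scaleC)
  have Q: "Q (a + a') b t = Q a b t + Q a' b t" "Q (c *\<^sub>C a) b t = c * Q a b t"
      "Q a (b + b') t = Q a b t + Q a b' t" "Q a (c *\<^sub>C b) t = c * Q a b t" for a a' b b' c t
    by (simp_all add: Q_def \<alpha>lin distrib_left distrib_right mult_scaleC_left mult_scaleC_right add scaleC)
  have "norm (a * \<alpha> t b) \<le> norm b * norm a" "norm (\<alpha> t b * a) \<le> norm b * norm a" for a b t
    using norm_mult_ineq[of a "\<alpha> t b"] norm_mult_ineq[of "\<alpha> t b" a] mult_left_mono[OF \<alpha>le[of t b], of "norm a"]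
    by (simp_all add: mult.commute)
  then have bound: "cmod (P a b t) \<le> norm b * norm a" "cmod (Q a b t) \<le> norm b * norm a" for a b t
    unfolding P_def Q_def by (meson norm_le order_trans)+
  then have bound': "cmod (P a b t) \<le> norm a * norm b" "cmod (Q a b t) \<le> norm a * norm b" for a b t
    by (simp_all add: mult.commute)
  have ent: "continuous_on UNIV (P (W f) (W g))" "continuous_on UNIV (Q (W f) (W g))"
      "test_function k \<Longrightarrow> (LINT t|lborel. P (W f) (W g) t * fourier k (of_real t)) =
        (LINT t|lborel. Q (W f) (W g) t * fourier k (of_real t + \<i> * of_real \<beta>))"
    if fg: "f \<in> S" "g \<in> S" for f g k
  proof -
    obtain \<Phi> B where \<Phi>: "\<Phi> holomorphic_on UNIV" "\<And>z. 0 \<le> Im z \<Longrightarrow> Im z \<le> \<beta> \<Longrightarrow> cmod (\<Phi> z) \<le> B"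
      "\<And>t. \<omega> (W f * W (T t g)) = \<Phi> (complex_of_real t)"
      "\<And>t. \<omega> (W (T t g) * W f) = \<Phi> (complex_of_real t + \<i> * complex_of_real \<beta>)"
      using entire[OF fg] by blast
    have PQ: "P (W f) (W g) = (\<lambda>t. \<Phi> (of_real t))" "Q (W f) (W g) = (\<lambda>t. \<Phi> (of_real t + \<i> * of_real \<beta>))"
      using fg by (auto simp: P_def Q_def \<alpha>W \<Phi>)
    show "continuous_on UNIV (P (W f) (W g))" "continuous_on UNIV (Q (W f) (W g))"
      unfolding PQ
      by (rule continuous_on_compose2[OF holomorphic_on_imp_continuous_on[OF \<Phi>(1)]];
          auto intro!: continuous_intros)+
    assume k: "test_function k"
    obtain C where C: "\<And>z. 0 \<le> Im z \<Longrightarrow> Im z \<le> \<beta> \<Longrightarrow> (1 + (Re z)\<^sup>2) * cmod (fourier k z) \<le> C"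
      using fourier_decay[OF k] by blast
    show "(LINT t|lborel. P (W f) (W g) t * fourier k (of_real t)) =
        (LINT t|lborel. Q (W f) (W g) t * fourier k (of_real t + \<i> * of_real \<beta>))"
      unfolding PQ
    proof (rule contour_shift[where F = "\<lambda>z. \<Phi> z * fourier k z"])
      show "(\<lambda>z. \<Phi> z * fourier k z) holomorphic_on UNIV"
        by (intro holomorphic_intros \<Phi>(1) fourier_holomorphic[OF k])
      fix z assume z: "0 \<le> Im z" "Im z \<le> \<beta>"
      have "cmod (\<Phi> z) * ((1 + (Re z)\<^sup>2) * cmod (fourier k z)) \<le> B * C"
        using \<Phi>(2)[OF z] C[OF z] order_trans[OF norm_ge_zero \<Phi>(2)[OF z]] by (intro mult_mono) simp_all
      then show "(1 + (Re z)\<^sup>2) * cmod (\<Phi> z * fourier k z) \<le> B * C"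
        by (simp add: norm_mult mult_ac)
    qed fact
  qed
  have contP: "continuous_on UNIV (P a b)" for a b
  proof (rule continuous_if_continuous_on_weyl[where P = "P a" and C = "norm a"])
    show "continuous_on UNIV (P a (W g))" if "g \<in> S" for g
      by (rule continuous_if_continuous_on_weyl[where P = "\<lambda>a. P a (W g)" and C = "norm (W g)"])
        (simp_all add: P bound(1) ent that)
  qed (simp_all add: P bound'(1))
  have contQ: "continuous_on UNIV (Q a b)" for a b
  proof (rule continuous_if_continuous_on_weyl[where P = "Q a" and C = "norm a"])
    show "continuous_on UNIV (Q a (W g))" if "g \<in> S" for g
      by (rule continuous_if_continuous_on_weyl[where P = "\<lambda>a. Q a (W g)" and C = "norm (W g)"])
        (simp_all add: Q bound(2) ent that)
  qed (simp_all add: Q bound'(2))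
  have "(LINT t|lborel. P a b t * fourier k (of_real t)) =
        (LINT t|lborel. Q a b t * fourier k (of_real t + \<i> * of_real \<beta>))"
    if k: "test_function k" for a b k
  proof -
    obtain C where C: "\<And>z. 0 \<le> Im z \<Longrightarrow> Im z \<le> \<beta> \<Longrightarrow> (1 + (Re z)\<^sup>2) * cmod (fourier k z) \<le> C"
      using fourier_decay[OF k] by blast
    have "integrable lborel (\<lambda>t. fourier k (of_real t + \<i> * of_real s))" if "0 \<le> s" "s \<le> \<beta>" for s
    proof (rule integrable_decay)
      show "continuous_on UNIV (\<lambda>t. fourier k (of_real t + \<i> * of_real s))"
        by (rule continuous_on_compose2[OF holomorphic_on_imp_continuous_on[OF fourier_holomorphic[OF k]]])
          (auto intro!: continuous_intros)
      show "(1 + t\<^sup>2) * cmod (fourier k (of_real t + \<i> * of_real s)) \<le> C" for t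
        using C[of "of_real t + \<i> * of_real s"] that by simp
    qed
    from this[of 0] this[of \<beta>] have h: "integrable lborel (\<lambda>t. fourier k (of_real t))"
        "integrable lborel (\<lambda>t. fourier k (of_real t + \<i> * of_real \<beta>))"
      using \<open>\<beta> > 0\<close> by simp_all
    show ?thesis
    proof (rule integral_eq_if_eq_on_weyl[of "P a" "norm a" "Q a"])
      show "(LINT t|lborel. P a (W g) t * fourier k (of_real t)) =
        (LINT t|lborel. Q a (W g) t * fourier k (of_real t + \<i> * of_real \<beta>))" if "g \<in> S" for g
        by (rule integral_eq_if_eq_on_weyl[of "\<lambda>a. P a (W g)" "norm (W g)" "\<lambda>a. Q a (W g)"])
          (simp_all add: P Q bound contP contQ h ent(3) k that)
    qed (simp_all add: P Q bound' contP contQ h)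
  qed
  then show ?thesis
    using \<omega> contP by (simp add: kms_state_def P_def Q_def)
qed

end

section \<open>Quasi-free states\<close>

lemma psd_kernel_gram:
  fixes v :: "'i \<Rightarrow> 'h::complex_inner"
  shows "psd_kernel I (\<lambda>i j. cinner (v i) (v j))"
proof (rule psd_kernelI)
  fix F :: "'i set" and c :: "'i \<Rightarrow> complex" assume F: "finite F"
  have left: "cinner (\<Sum>i\<in>F. c i *\<^sub>C v i) y = (\<Sum>i\<in>F. cnj (c i) * cinner (v i) y)" for y
    using F by (induction F rule: finite_induct) (simp_all add: cinner_add_left cinner_scaleC_left)
  have right: "cinner y (\<Sum>i\<in>F. c i *\<^sub>C v i) = (\<Sum>i\<in>F. c i * cinner y (v i))" for y
    using F by (induction F rule: finite_induct) (simp_all add: cinner_add_right cinner_scaleC_right)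
  have "(\<Sum>i\<in>F. \<Sum>j\<in>F. cnj (c i) * c j * cinner (v i) (v j)) =
      cinner (\<Sum>i\<in>F. c i *\<^sub>C v i) (\<Sum>i\<in>F. c i *\<^sub>C v i)"
    unfolding left unfolding right sum_distrib_left by (simp add: mult.assoc)
  then show "0 \<le> Re (\<Sum>i\<in>F. \<Sum>j\<in>F. cnj (c i) * c j * cinner (v i) (v j))"
    by (simp add: cinner_self)
qed (rule cinner_commute)

context weyl_system
begin

text \<open>The Weyl phase contributes the imaginary part of \<open>cinner f g\<close> and the norm
  of f + g its real part, so the exponent contains the full complex inner product.\<close>

lemma quasi_free_kernel:
  fixes q :: "'h \<Rightarrow> 'h \<Rightarrow> complex"
  assumes psd: "psd_kernel S (\<lambda>f g. q g f)"
    and q_add: "\<And>f g. f \<in> S \<Longrightarrow> g \<in> S \<Longrightarrow> q (f + g) (f + g) = q f f + q f g + q g f + q g g"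
    and q_minus: "\<And>f g. f \<in> S \<Longrightarrow> g \<in> S \<Longrightarrow> q (- f) g = - q f g" "\<And>f g. f \<in> S \<Longrightarrow> g \<in> S \<Longrightarrow> q f (- g) = - q f g"
    and fg: "f \<in> S" "g \<in> S"
  defines "\<phi> \<equiv> \<lambda>f. exp (- (complex_of_real ((norm f)\<^sup>2) / 4) - q f f / 2)"
  shows "phase f g * \<phi> (f + g) = \<phi> f * \<phi> g * exp (- (cinner f g + q f g + q g f) / 2)"
proof -
  define r s where "r = Re (cinner f g)" and "s = Im (cinner f g)"
  have "(norm (f + g))\<^sup>2 = (norm f)\<^sup>2 + (norm g)\<^sup>2 + 2 * r"
    by (simp add: power2_norm_eq_inner inner_add_left inner_add_right inner_commute r_def
        flip: inner_eq_Re_cinner)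
  then have norm: "complex_of_real ((norm (f + g))\<^sup>2) =
      complex_of_real ((norm f)\<^sup>2) + complex_of_real ((norm g)\<^sup>2) + 2 * complex_of_real r"
    by simp
  have cinner: "cinner f g = complex_of_real r + \<i> * complex_of_real s"
    by (simp add: complex_eq_iff r_def s_def)
  have "- (\<i> / 2) * complex_of_real s + (- (complex_of_real ((norm (f + g))\<^sup>2) / 4) - q (f + g) (f + g) / 2) =
      (- (complex_of_real ((norm f)\<^sup>2) / 4) - q f f / 2) + (- (complex_of_real ((norm g)\<^sup>2) / 4) - q g g / 2)
      + (- (cinner f g + q f g + q g f) / 2)"
    unfolding norm cinner q_add[OF fg] by (simp add: field_simps)
  then show ?thesis
    unfolding \<phi>_def phase_def exp_add[symmetric] s_def by (simp only:)
qed

text \<open>By \<open>quasi_free_kernel\<close> the kernel of the functional is a rank-one kernel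
  times the exponential of half the sum of the Gram kernel and of q in both orders, all positive
  semidefinite.\<close>

lemma quasi_free_state_exists:
  fixes q :: "'h \<Rightarrow> 'h \<Rightarrow> complex"
  assumes psd: "psd_kernel S (\<lambda>f g. q g f)"
    and q_add: "\<And>f g. f \<in> S \<Longrightarrow> g \<in> S \<Longrightarrow> q (f + g) (f + g) = q f f + q f g + q g f + q g g"
    and q_minus: "\<And>f g. f \<in> S \<Longrightarrow> g \<in> S \<Longrightarrow> q (- f) g = - q f g" "\<And>f g. f \<in> S \<Longrightarrow> g \<in> S \<Longrightarrow> q f (- g) = - q f g"
  shows "\<exists>\<omega>. quasi_free_state S W q \<omega>"
proof -
  define \<phi> where "\<phi> f = exp (- (complex_of_real ((norm f)\<^sup>2) / 4) - q f f / 2)" for f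
  have q0: "q 0 0 = 0"
    using q_minus(1)[OF zero_mem zero_mem] by simp
  have real: "cnj (\<phi> f) = \<phi> f" and even: "\<phi> (- f) = \<phi> f" if "f \<in> S" for f
    using psd_kernel_hermitian[OF psd that that] q_minus that minus_mem[OF that]
    by (simp_all add: \<phi>_def exp_cnj)
  have K: "psd_kernel S (\<lambda>f g. of_real (1/2) * (cinner f g + (q g f + q f g)))"
    by (intro psd_kernel_scale psd_kernel_add psd_kernel_gram psd psd_kernel_cnj[OF psd]) simp
  have kernel: "phase (- f) g * \<phi> (g - f) = (cnj (\<phi> f) * \<phi> g) * exp (of_real (1/2) * (cinner f g + (q g f + q f g)))"
    if "f \<in> S" "g \<in> S" for f g
  proof -
    have "phase (- f) g * \<phi> (- f + g) =
        \<phi> (- f) * \<phi> g * exp (- (cinner (- f) g + q (- f) g + q g (- f)) / 2)"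
      unfolding \<phi>_def using that by (intro quasi_free_kernel[OF psd q_add q_minus] minus_mem)
    moreover have "- (cinner (- f) g + q (- f) g + q g (- f)) / 2 =
        of_real (1/2) * (cinner f g + (q g f + q f g))"
      using that by (simp add: cinner_minus_left q_minus)
    ultimately show ?thesis
      using that by (simp only: real even uminus_add_conv_diff)
  qed
  obtain \<omega> where \<omega>: "is_state \<omega>" "\<And>f. f \<in> S \<Longrightarrow> \<omega> (W f) = \<phi> f"
  proof (rule state_exists[of \<phi>])
    show "\<phi> 0 = 1" by (simp add: \<phi>_def q0)
    fix F and c :: "'h \<Rightarrow> complex" assume F: "finite F" "F \<subseteq> S"
    have "(\<Sum>f\<in>F. \<Sum>g\<in>F. cnj (c f) * c g * phase (- f) g * \<phi> (g - f)) =
       (\<Sum>f\<in>F. \<Sum>g\<in>F. cnj (c f) * c g *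
         ((cnj (\<phi> f) * \<phi> g) * exp (of_real (1/2) * (cinner f g + (q g f + q f g)))))"
    proof (intro sum.cong refl)
      fix f g assume "f \<in> F" "g \<in> F"
      then have "f \<in> S" "g \<in> S" using F(2) by auto
      then show "cnj (c f) * c g * phase (- f) g * \<phi> (g - f) = cnj (c f) * c g *
          ((cnj (\<phi> f) * \<phi> g) * exp (of_real (1/2) * (cinner f g + (q g f + q f g))))"
        using arg_cong[OF kernel[of f g], of "\<lambda>x. cnj (c f) * c g * x"] by (simp only: mult.assoc)
    qed
    also have "\<dots> \<in> \<real>\<^sub>\<ge>\<^sub>0"
      by (rule psd_kernel_sum_Reals[OF psd_kernel_mult[OF psd_kernel_rank_one psd_kernel_exp[OF K]] F])
    finally show "(\<Sum>f\<in>F. \<Sum>g\<in>F. cnj (c f) * c g * phase (- f) g * \<phi> (g - f)) \<in> \<real>\<^sub>\<ge>\<^sub>0" .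
  qed (use that in blast)
  then show ?thesis
    by (intro exI[of _ \<omega>]) (auto simp: quasi_free_state_def \<phi>_def)
qed

lemma quasi_free_state_unique:
  "quasi_free_state S W q \<omega> \<Longrightarrow> quasi_free_state S W q \<omega>' \<Longrightarrow> \<omega> = \<omega>'"
  by (rule state_eqI) (auto simp: quasi_free_state_def)

lemma quasi_free_state_weyl_mult:
  assumes "quasi_free_state S W q \<omega>"
    and psd: "psd_kernel S (\<lambda>f g. q g f)"
    and q_add: "\<And>f g. f \<in> S \<Longrightarrow> g \<in> S \<Longrightarrow> q (f + g) (f + g) = q f f + q f g + q g f + q g g"
    and q_minus: "\<And>f g. f \<in> S \<Longrightarrow> g \<in> S \<Longrightarrow> q (- f) g = - q f g" "\<And>f g. f \<in> S \<Longrightarrow> g \<in> S \<Longrightarrow> q f (- g) = - q f g"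
    and fg: "f \<in> S" "g \<in> S"
  shows "\<omega> (W f * W g) = \<omega> (W f) * \<omega> (W g) * exp (- (cinner f g + q f g + q g f) / 2)"
proof -
  have \<omega>: "\<omega> (W f) = exp (- (complex_of_real ((norm f)\<^sup>2) / 4) - q f f / 2)" if "f \<in> S" for f
    using assms(1) that by (simp add: quasi_free_state_def)
  have "\<omega> (W f * W g) = phase f g * \<omega> (W (f + g))"
    using assms(1) fg by (simp add: weyl_mult quasi_free_state_def is_state_def)
  then show ?thesis
    using quasi_free_kernel[OF psd q_add q_minus fg] fg by (simp add: \<omega> add_mem)
qed

end

section \<open>The Hilbert space of square-summable functions\<close>

lemma ell2_summable: "(\<lambda>x. (cmod (apply_ell2 \<psi> x))\<^sup>2) summable_on UNIV"
  using apply_ell2[of \<psi>] by simp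

lemma norm_ell2_square: "(norm \<psi>)\<^sup>2 = (\<Sum>\<^sub>\<infinity>x. (cmod (apply_ell2 \<psi> x))\<^sup>2)" for \<psi> :: "'v ell2"
  unfolding norm_ell2_def by (simp add: infsum_nonneg)

lemma cinner_ell2_summable: "(\<lambda>x. cnj (apply_ell2 \<phi> x) * apply_ell2 \<psi> x) summable_on UNIV"
  by (rule square_summable_mult) (rule ell2_summable)+

lemma cmod_apply_ell2_le: "cmod (apply_ell2 \<psi> x) \<le> norm \<psi>"
proof (rule power2_le_imp_le)
  have "(\<Sum>\<^sub>\<infinity>y\<in>{x}. (cmod (apply_ell2 \<psi> y))\<^sup>2) \<le> (\<Sum>\<^sub>\<infinity>y. (cmod (apply_ell2 \<psi> y))\<^sup>2)"
    by (intro infsum_mono_neutral ell2_summable) auto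
  then show "(cmod (apply_ell2 \<psi> x))\<^sup>2 \<le> (norm \<psi>)\<^sup>2"
    by (simp add: norm_ell2_square)
qed simp

lemma ell2_eqI: "(\<And>x. apply_ell2 \<phi> x = apply_ell2 \<psi> x) \<Longrightarrow> \<phi> = \<psi>"
  by (metis apply_ell2_inject ext)

lemma sum_square_le_norm_ell2:
  assumes "finite F"
  shows "(\<Sum>x\<in>F. (cmod (apply_ell2 \<psi> x))\<^sup>2) \<le> (norm \<psi>)\<^sup>2"
  unfolding norm_ell2_square by (rule finite_sum_le_infsum[OF ell2_summable assms]) auto

text \<open>The limit is taken at each vertex; the Cauchy bounds pass to it on finite vertex sets
  uniformly, which gives both square-summability and convergence in norm.\<close>

instance ell2 :: (type) banach
proof
  fix X :: "nat \<Rightarrow> 'a ell2" assume X: "Cauchy X"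
  have "Cauchy (\<lambda>n. apply_ell2 (X n) x)" for x
  proof (rule CauchyI)
    fix e :: real assume "e > 0"
    then obtain N where N: "\<And>m n. m \<ge> N \<Longrightarrow> n \<ge> N \<Longrightarrow> norm (X m - X n) < e"
      using CauchyD[OF X] by blast
    have "cmod (apply_ell2 (X m) x - apply_ell2 (X n) x) < e" if "m \<ge> N" "n \<ge> N" for m n
      using cmod_apply_ell2_le[of "X m - X n" x] N[OF that] by (simp add: minus_ell2.rep_eq)
    then show "\<exists>N. \<forall>m\<ge>N. \<forall>n\<ge>N. cmod (apply_ell2 (X m) x - apply_ell2 (X n) x) < e"
      by blast
  qed
  then have "\<exists>l. (\<lambda>n. apply_ell2 (X n) x) \<longlonglongrightarrow> l" for x
    using Cauchy_convergent convergent_def by blast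
  then obtain f where f: "\<And>x. (\<lambda>n. apply_ell2 (X n) x) \<longlonglongrightarrow> f x"
    by metis
  have bound: "(\<Sum>x\<in>F. (cmod (apply_ell2 (X n) x - f x))\<^sup>2) \<le> e\<^sup>2"
    if F: "finite F" and N: "\<And>m. m \<ge> N \<Longrightarrow> norm (X n - X m) < e" for F n N and e :: real
  proof (rule LIMSEQ_le_const2)
    show "(\<lambda>m. \<Sum>x\<in>F. (cmod (apply_ell2 (X n) x - apply_ell2 (X m) x))\<^sup>2) \<longlonglongrightarrow>
        (\<Sum>x\<in>F. (cmod (apply_ell2 (X n) x - f x))\<^sup>2)"
      by (intro tendsto_intros f)
    have "(\<Sum>x\<in>F. (cmod (apply_ell2 (X n) x - apply_ell2 (X m) x))\<^sup>2) \<le> e\<^sup>2" if "m \<ge> N" for m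
    proof -
      have "(\<Sum>x\<in>F. (cmod (apply_ell2 (X n) x - apply_ell2 (X m) x))\<^sup>2) \<le> (norm (X n - X m))\<^sup>2"
        using sum_square_le_norm_ell2[OF F, of "X n - X m"] by (simp add: minus_ell2.rep_eq)
      also have "\<dots> \<le> e\<^sup>2"
        using N[OF that] by (intro power_mono) auto
      finally show ?thesis .
    qed
    then show "\<exists>N. \<forall>m\<ge>N. (\<Sum>x\<in>F. (cmod (apply_ell2 (X n) x - apply_ell2 (X m) x))\<^sup>2) \<le> e\<^sup>2"
      by blast
  qed
  have diff: "(\<lambda>x. (cmod (apply_ell2 (X n) x - f x))\<^sup>2) summable_on UNIV"
    "(\<Sum>\<^sub>\<infinity>x. (cmod (apply_ell2 (X n) x - f x))\<^sup>2) \<le> e\<^sup>2"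
    if N: "\<And>m. m \<ge> N \<Longrightarrow> norm (X n - X m) < e" for n N and e :: real
  proof -
    show s: "(\<lambda>x. (cmod (apply_ell2 (X n) x - f x))\<^sup>2) summable_on UNIV"
      by (rule nonneg_bounded_partial_sums_imp_summable_on[where C = "e\<^sup>2"])
        (auto intro!: eventually_finite_subsets_at_top_weakI bound N)
    show "(\<Sum>\<^sub>\<infinity>x. (cmod (apply_ell2 (X n) x - f x))\<^sup>2) \<le> e\<^sup>2"
      by (rule infsum_le_finite_sums[OF s]) (auto intro: bound N)
  qed
  obtain N1 where N1: "\<And>m n. m \<ge> N1 \<Longrightarrow> n \<ge> N1 \<Longrightarrow> norm (X m - X n) < 1"
    using CauchyD[OF X zero_less_one] by blast
  have "(\<lambda>x. (cmod (apply_ell2 (X N1) x + (- 1) * (apply_ell2 (X N1) x - f x)))\<^sup>2) summable_on UNIV"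
    by (intro square_summable_add square_summable_scale ell2_summable diff(1)[of N1 N1 1] N1) auto
  then have "f \<in> {f. (\<lambda>x. (cmod (f x))\<^sup>2) summable_on UNIV}"
    by simp
  then have L: "apply_ell2 (Abs_ell2 f) = f"
    by (rule Abs_ell2_inverse)
  have "X \<longlonglongrightarrow> Abs_ell2 f"
  proof (rule LIMSEQ_I)
    fix e :: real assume e: "e > 0"
    then obtain N where N: "\<And>m n. m \<ge> N \<Longrightarrow> n \<ge> N \<Longrightarrow> norm (X m - X n) < e / 2"
      using CauchyD[OF X, of "e / 2"] by auto
    have "norm (X n - Abs_ell2 f) < e" if "n \<ge> N" for n
    proof -
      have "(norm (X n - Abs_ell2 f))\<^sup>2 \<le> (e / 2)\<^sup>2"
        unfolding norm_ell2_square minus_ell2.rep_eq L using that by (intro diff(2)[of N] N) auto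
      then have "norm (X n - Abs_ell2 f) \<le> e / 2"
        using e by (simp add: abs_le_square_iff[symmetric])
      then show ?thesis using e by simp
    qed
    then show "\<exists>N. \<forall>n\<ge>N. norm (X n - Abs_ell2 f) < e" by blast
  qed
  then show "convergent X" by (rule convergentI)
qed

lemma norm_scaleC_ell2: "norm (c *\<^sub>C \<psi>) = cmod c * norm \<psi>" for \<psi> :: "'v ell2"
proof -
  have "(norm (c *\<^sub>C \<psi>))\<^sup>2 = (cmod c * norm \<psi>)\<^sup>2"
    unfolding power_mult_distrib norm_ell2_square scaleC_ell2.rep_eq norm_mult
    by (rule infsum_cmult_right') 
  then show ?thesis by (simp add: power2_eq_iff_nonneg)
qed

lemma cauchy_schwarz_ell2: "cmod (cinner x y) \<le> norm x * norm y" for x y :: "'v ell2"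
proof (rule power2_le_imp_le)
  have "(cmod (cinner x y))\<^sup>2 \<le> (norm x)\<^sup>2 * (norm y)\<^sup>2"
  proof (rule discriminant_bound)
    fix t
    have "cinner (x + t *\<^sub>C y) (x + t *\<^sub>C y) =
        cinner x x + t * cinner x y + cnj (t * cinner x y) + (t * cnj t) * cinner y y"
      by (simp add: cinner_add_left cinner_add_right cinner_scaleC_left cinner_scaleC_right
          cinner_commute[of y x] algebra_simps)
    then have "Re (cinner (x + t *\<^sub>C y) (x + t *\<^sub>C y)) =
        (norm x)\<^sup>2 + 2 * Re (t * cinner x y) + (cmod t)\<^sup>2 * (norm y)\<^sup>2"
      unfolding cinner_self complex_norm_square[symmetric] by (simp flip: of_real_mult of_real_power)
    moreover have "0 \<le> Re (cinner (x + t *\<^sub>C y) (x + t *\<^sub>C y))"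
      by (simp add: cinner_self)
    ultimately show "0 \<le> (norm x)\<^sup>2 + 2 * Re (t * cinner x y) + (cmod t)\<^sup>2 * (norm y)\<^sup>2"
      by simp
  qed simp
  then show "(cmod (cinner x y))\<^sup>2 \<le> (norm x * norm y)\<^sup>2"
    by (simp add: power_mult_distrib)
qed simp

lemma bounded_linear_cinner_right: "bounded_linear (cinner x :: 'v ell2 \<Rightarrow> complex)"
proof (rule bounded_linear_intro[where K = "norm x"])
  show "cinner x (r *\<^sub>R y) = r *\<^sub>R cinner x y" for r y
    by (simp only: scaleR_scaleC[of r y] cinner_scaleC_right scaleR_conv_of_real)
  show "norm (cinner x y) \<le> norm y * norm x" for y
    using cauchy_schwarz_ell2[of x y] by (simp add: mult.commute)
qed (rule cinner_add_right)

lemma bounded_linear_scaleC_ell2: "bounded_linear ((*\<^sub>C) c :: 'v ell2 \<Rightarrow> 'v ell2)"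
  by (rule bounded_linear_intro[where K = "cmod c"])
    (simp_all add: scaleC_add_right scaleR_scaleC scaleC_scaleC mult.commute norm_scaleC_ell2)

text \<open>A preimage of \<open>\<xi>\<close> is obtained by minimizing \<open>\<parallel>Sx\<parallel>\<^sup>2 - 2\<langle>\<xi>, x\<rangle>\<close>.\<close>

lemma mem_range_if_bounded_by_image:
  fixes S :: "'a::{real_inner,banach} \<Rightarrow> 'a"
  assumes S: "bounded_linear S" and sym: "\<And>x y. inner (S x) y = inner x (S y)"
    and bound: "\<And>x. \<bar>inner \<xi> x\<bar> \<le> C * norm (S x)"
  shows "\<xi> \<in> range S"
proof -
  define J where "J x = (norm (S x))\<^sup>2 - 2 * inner \<xi> x" for x
  have lower: "- C\<^sup>2 \<le> J x" for x
  proof -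
    have "0 \<le> (norm (S x) - C)\<^sup>2" by simp
    then show ?thesis
      using bound[of x] by (simp add: J_def power2_diff mult.commute[of C])
  qed
  define m where "m = Inf (range J)"
  have bdd: "bdd_below (range J)"
    using lower by (intro bdd_belowI[of _ "- C\<^sup>2"]) auto
  have m: "m \<le> J x" for x
    unfolding m_def using bdd by (intro cInf_lower) auto
  have "\<exists>x. J x < m + e" if "e > 0" for e
    using cInf_lessD[of "range J" "m + e"] that by (auto simp: m_def)
  then have "\<exists>x. J x < m + 1 / real (Suc n)" for n
    by simp
  then obtain y where y: "\<And>n. J (y n) < m + 1 / real (Suc n)"
    by metis
  \<comment> \<open>The parallelogram law: J is a squared seminorm plus a linear functional, so
    near-minimizers have images close to each other.\<close>
  have par: "(norm (S a - S b))\<^sup>2 = 2 * J a + 2 * J b - 4 * J ((1/2) *\<^sub>R (a + b))" for a b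
    by (simp add: J_def linear_simps[OF S] inner_add_right power2_norm_eq_inner inner_diff_left
        inner_diff_right inner_add_left inner_commute[of "S b" "S a"] algebra_simps)
  have cau: "(norm (S (y k) - S (y n)))\<^sup>2 \<le> 2 * (1 / real (Suc k)) + 2 * (1 / real (Suc n))" for k n
    using par[of "y k" "y n"] y[of k] y[of n] m[of "(1/2) *\<^sub>R (y k + y n)"] by linarith
  have "Cauchy (\<lambda>n. S (y n))"
  proof (rule CauchyI)
    fix e :: real assume e: "e > 0"
    obtain N where N: "4 / e\<^sup>2 < real N" using reals_Archimedean2 by blast
    have "norm (S (y k) - S (y n)) < e" if "k \<ge> N" "n \<ge> N" for k n
    proof -
      have small: "1 / real (Suc j) < e\<^sup>2 / 4" if "j \<ge> N" for j
      proof -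
        have "4 / e\<^sup>2 < real (Suc j)" using N that by linarith
        then show ?thesis using e by (simp add: field_simps)
      qed
      have "(norm (S (y k) - S (y n)))\<^sup>2 < e\<^sup>2"
        using cau[of k n] small[OF that(1)] small[OF that(2)] by linarith
      then show ?thesis
        using e by (simp add: power2_less_imp_less)
    qed
    then show "\<exists>N. \<forall>k\<ge>N. \<forall>n\<ge>N. norm (S (y k) - S (y n)) < e" by blast
  qed
  \<comment> \<open>The minimizing sequence itself need not converge, only its image. The Euler
    equation formally reads S(Sx) = \<xi>, so l, in the role of Sx, is the preimage.\<close>
  then obtain l where l: "(\<lambda>n. S (y n)) \<longlonglongrightarrow> l"
    using Cauchy_convergent convergent_def by blast
  have quad: "0 \<le> t\<^sup>2 * (norm (S x))\<^sup>2 + 2 * t * (inner l (S x) - inner \<xi> x)" for t x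
  proof -
    have expand: "J (a + t *\<^sub>R x) = J a + (t\<^sup>2 * (norm (S x))\<^sup>2 + 2 * t * (inner (S a) (S x) - inner \<xi> x))" for a
      unfolding J_def linear_simps[OF S] power2_norm_eq_inner
      by (simp add: inner_add_left inner_add_right inner_commute[of "S x" "S a"] power2_eq_square
          algebra_simps)
    have "- (1 / real (Suc n)) \<le> t\<^sup>2 * (norm (S x))\<^sup>2 + 2 * t * (inner (S (y n)) (S x) - inner \<xi> x)" for n
      using m[of "y n + t *\<^sub>R x"] y[of n] unfolding expand by linarith
    moreover have "(\<lambda>n. t\<^sup>2 * (norm (S x))\<^sup>2 + 2 * t * (inner (S (y n)) (S x) - inner \<xi> x)) \<longlonglongrightarrow>
        t\<^sup>2 * (norm (S x))\<^sup>2 + 2 * t * (inner l (S x) - inner \<xi> x)"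
      by (intro tendsto_intros l)
    moreover have "(\<lambda>n. - (1 / real (Suc n))) \<longlonglongrightarrow> 0"
      by real_asymp
    ultimately show ?thesis
      using LIMSEQ_le by blast
  qed
  have "inner (S l - \<xi>) x = 0" for x
  proof -
    define b where "b = inner l (S x) - inner \<xi> x"
    have "b\<^sup>2 \<le> 0"
    proof (rule ccontr)
      assume "\<not> b\<^sup>2 \<le> 0"
      then have b: "b\<^sup>2 > 0" by simp
      \<comment> \<open>The summand 1 keeps N positive when S x = 0.\<close>
      define N where "N = (norm (S x))\<^sup>2 + 1"
      have N: "N > 0" by (simp add: N_def add_nonneg_pos)
      have "0 \<le> (- b / N)\<^sup>2 * (norm (S x))\<^sup>2 + 2 * (- b / N) * b"
        using quad[of "- b / N" x] by (simp add: b_def)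
      also have "(- b / N)\<^sup>2 * (norm (S x))\<^sup>2 \<le> (- b / N)\<^sup>2 * N"
        by (intro mult_left_mono) (auto simp: N_def)
      also have "(- b / N)\<^sup>2 * N + 2 * (- b / N) * b = - b\<^sup>2 / N"
        using N by (simp add: power2_eq_square field_simps)
      finally show False using b N by (simp add: field_simps)
    qed
    then show ?thesis
      by (simp add: b_def inner_diff_left sym)
  qed
  then have "S l = \<xi>"
    by (metis inner_eq_zero_iff right_minus_eq)
  then show ?thesis by blast
qed

section \<open>The Banach algebra of bounded operators\<close>

text \<open>A copy of the bounded operators with composition as multiplication, so that
  \<open>exp\<close> and \<open>sqrt_series\<close> apply to operators. Its elements are only real
  linear; complex linearity is a separate predicate.\<close>

typedef 'v bop = "UNIV :: ('v ell2 \<Rightarrow>\<^sub>L 'v ell2) set"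
  morphisms blinfun_of_bop bop_of_blinfun ..

setup_lifting type_definition_bop

definition app :: "'v bop \<Rightarrow> 'v ell2 \<Rightarrow> 'v ell2" where
  "app T = blinfun_apply (blinfun_of_bop T)"

lemma norm_delta [simp]: "norm (delta v) = 1"
proof -
  have "(norm (delta v))\<^sup>2 = (\<Sum>\<^sub>\<infinity>x\<in>{v}. (cmod (apply_ell2 (delta v) x))\<^sup>2)"
    unfolding norm_ell2_square by (rule infsum_cong_neutral) (auto simp: delta.rep_eq)
  then have "(norm (delta v))\<^sup>2 = 1\<^sup>2"
    by (simp add: delta.rep_eq)
  then show ?thesis
    by (rule power2_eq_imp_eq) simp_all
qed

instantiation bop :: (type) real_normed_algebra_1
begin

lift_definition zero_bop :: "'a bop" is 0 .
lift_definition one_bop :: "'a bop" is id_blinfun .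
lift_definition plus_bop :: "'a bop \<Rightarrow> 'a bop \<Rightarrow> 'a bop" is "(+)" .
lift_definition minus_bop :: "'a bop \<Rightarrow> 'a bop \<Rightarrow> 'a bop" is "(-)" .
lift_definition uminus_bop :: "'a bop \<Rightarrow> 'a bop" is uminus .
lift_definition times_bop :: "'a bop \<Rightarrow> 'a bop \<Rightarrow> 'a bop" is "(o\<^sub>L)" .
lift_definition scaleR_bop :: "real \<Rightarrow> 'a bop \<Rightarrow> 'a bop" is "scaleR" .
lift_definition norm_bop :: "'a bop \<Rightarrow> real" is norm .
lift_definition dist_bop :: "'a bop \<Rightarrow> 'a bop \<Rightarrow> real" is dist .
lift_definition sgn_bop :: "'a bop \<Rightarrow> 'a bop" is sgn .

definition uniformity_bop :: "('a bop \<times> 'a bop) filter" where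
  "uniformity_bop = (INF e\<in>{0<..}. principal {(x, y). dist x y < e})"

definition open_bop :: "'a bop set \<Rightarrow> bool" where
  "open_bop U = (\<forall>x\<in>U. \<forall>\<^sub>F (x', y) in uniformity. x' = x \<longrightarrow> y \<in> U)"

instance
proof
  fix x y z :: "'a bop" and a b :: real
  show "x + y + z = x + (y + z)" "x + y = y + x" "0 + x = x" "- x + x = 0" "x - y = x + - y"
    "a *\<^sub>R (x + y) = a *\<^sub>R x + a *\<^sub>R y" "(a + b) *\<^sub>R x = a *\<^sub>R x + b *\<^sub>R x"
    "a *\<^sub>R b *\<^sub>R x = (a * b) *\<^sub>R x" "1 *\<^sub>R x = x"
    by (transfer; simp add: algebra_simps)+
  show "x * y * z = x * (y * z)" "(x + y) * z = x * z + y * z" "x * (y + z) = x * y + x * z"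
    "a *\<^sub>R x * y = a *\<^sub>R (x * y)" "x * a *\<^sub>R y = a *\<^sub>R (x * y)" "1 * x = x" "x * 1 = x"
    by (transfer; rule blinfun_eqI; simp add: blinfun.bilinear_simps)+
  show "norm x = 0 \<longleftrightarrow> x = 0" "norm (x + y) \<le> norm x + norm y" "norm (a *\<^sub>R x) = \<bar>a\<bar> * norm x"
    "sgn x = inverse (norm x) *\<^sub>R x" "dist x y = norm (x - y)"
    by (transfer; simp add: norm_triangle_ineq sgn_div_norm dist_norm)+
  show "norm (x * y) \<le> norm x * norm y"
    by transfer (rule norm_blinfun_compose)
  have ne: "\<exists>v :: 'a ell2. v \<noteq> 0"
    by (rule exI[of _ "delta undefined"]) (metis norm_delta norm_zero zero_neq_one)
  show one: "norm (1 :: 'a bop) = 1"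
  proof transfer
    obtain v :: "'a ell2" where "v \<noteq> 0" using ne by blast
    then have "1 \<le> norm (id_blinfun :: 'a ell2 \<Rightarrow>\<^sub>L 'a ell2)"
      using norm_blinfun[of id_blinfun v] by simp
    moreover have "norm (id_blinfun :: 'a ell2 \<Rightarrow>\<^sub>L 'a ell2) \<le> 1"
      by (rule norm_blinfun_bound) auto
    ultimately show "norm (id_blinfun :: 'a ell2 \<Rightarrow>\<^sub>L 'a ell2) = 1" by simp
  qed
  show "(0 :: 'a bop) \<noteq> 1"
  proof
    assume "(0 :: 'a bop) = 1"
    moreover have "norm (0 :: 'a bop) = 0"
      by transfer simp
    ultimately show False
      using one by simp
  qed
  show "uniformity = (INF e\<in>{0<..}. principal {(x, y :: 'a bop). dist x y < e})"
    by (fact uniformity_bop_def)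
  show "open U = (\<forall>x\<in>U. \<forall>\<^sub>F (x', y) in uniformity. x' = x \<longrightarrow> y \<in> U)" for U :: "'a bop set"
    by (fact open_bop_def)
qed

end

instance bop :: (type) banach
proof
  fix X :: "nat \<Rightarrow> 'a bop" assume X: "Cauchy X"
  have d: "dist (bop_of_blinfun f) (bop_of_blinfun g) = dist f g" for f g :: "'a ell2 \<Rightarrow>\<^sub>L 'a ell2"
    by (simp add: dist_bop.abs_eq eq_onp_def)
  have d': "dist (blinfun_of_bop x) (blinfun_of_bop y) = dist x y" for x y :: "'a bop"
    by (simp add: dist_bop.rep_eq)
  have "Cauchy (\<lambda>n. blinfun_of_bop (X n))"
    using X unfolding Cauchy_altdef2 Cauchy_def d' by blast
  then obtain L where "(\<lambda>n. blinfun_of_bop (X n)) \<longlonglongrightarrow> L"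
    using Cauchy_convergent convergent_def by blast
  then have "X \<longlonglongrightarrow> bop_of_blinfun L"
    unfolding lim_sequentially by (metis d blinfun_of_bop_inverse)
  then show "convergent X" by (rule convergentI)
qed

lemma app_bounded_linear: "bounded_linear (app T)"
  unfolding app_def by (rule blinfun.bounded_linear_right)

lemma app_simps [simp]:
  "app 0 \<psi> = 0" "app 1 \<psi> = \<psi>" "app (S + T) \<psi> = app S \<psi> + app T \<psi>"
  "app (S - T) \<psi> = app S \<psi> - app T \<psi>" "app (- T) \<psi> = - app T \<psi>"
  "app (r *\<^sub>R T) \<psi> = r *\<^sub>R app T \<psi>" "app (S * T) \<psi> = app S (app T \<psi>)"
  by (simp_all add: app_def zero_bop.rep_eq one_bop.rep_eq plus_bop.rep_eq minus_bop.rep_eq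
      uminus_bop.rep_eq scaleR_bop.rep_eq times_bop.rep_eq blinfun.bilinear_simps)

lemma app_power: "app (T ^ n) \<psi> = (app T ^^ n) \<psi>"
  by (induction n) simp_all

lemma app_eqI: "(\<And>\<psi>. app S \<psi> = app T \<psi>) \<Longrightarrow> S = T"
  unfolding app_def using blinfun_eqI blinfun_of_bop_inject by metis

lemma norm_app: "norm (app T \<psi>) \<le> norm T * norm \<psi>"
  unfolding app_def norm_bop.rep_eq by (rule norm_blinfun)

lemma bounded_linear_app_left: "bounded_linear (\<lambda>T. app T \<psi>)"
  by (rule bounded_linear_intro[where K = "norm \<psi>"]) (simp_all add: norm_app mult.commute[of "norm \<psi>"])

lemma bop_exists:
  assumes "bounded_linear f"
  obtains T where "app T = f"
proof (rule that)
  show "app (bop_of_blinfun (Blinfun f)) = f"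
    by (simp add: app_def bop_of_blinfun_inverse bounded_linear_Blinfun_apply[OF assms])
qed

lemma exp_op_app: "exp_op (app T) = app (exp T)"
proof
  fix \<psi>
  have "app (exp T) \<psi> = (\<Sum>n. app (T ^ n /\<^sub>R fact n) \<psi>)"
    unfolding exp_def by (rule bounded_linear.suminf[OF bounded_linear_app_left summable_exp_generic])
  then show "exp_op (app T) \<psi> = app (exp T) \<psi>"
    by (simp add: exp_op_def app_power)
qed

lemma exp_sums_app: "(\<lambda>n. app (T ^ n) \<psi> /\<^sub>R fact n) sums app (exp T) \<psi>"
  using bounded_linear.sums[OF bounded_linear_app_left exp_converges[of T], of \<psi>] by simp

definition complex_linear :: "'v bop \<Rightarrow> bool" where
  "complex_linear T \<longleftrightarrow> (\<forall>c \<psi>. app T (c *\<^sub>C \<psi>) = c *\<^sub>C app T \<psi>)"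

text \<open>A relation in place of an adjoint operation. It is stable under powers, real multiples
  and convergent series, which suffices for exponentials and roots.\<close>

definition adjoint_pair :: "'v bop \<Rightarrow> 'v bop \<Rightarrow> bool" where
  "adjoint_pair S T \<longleftrightarrow> (\<forall>\<phi> \<psi>. cinner \<phi> (app S \<psi>) = cinner (app T \<phi>) \<psi>)"

lemma adjoint_pair_power: "adjoint_pair S T \<Longrightarrow> adjoint_pair (S ^ n) (T ^ n)"
proof (induction n)
  case (Suc n)
  then show ?case
    unfolding adjoint_pair_def by (simp add: power_commutes) (metis app_simps(7) power_Suc power_Suc2)
qed (simp add: adjoint_pair_def)

lemma adjoint_pair_scaleR: "adjoint_pair S T \<Longrightarrow> adjoint_pair (r *\<^sub>R S) (r *\<^sub>R T)"
  by (simp add: adjoint_pair_def scaleR_scaleC cinner_scaleC_left cinner_scaleC_right)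

lemma adjoint_pair_sums:
  assumes "\<And>n. adjoint_pair (S n) (T n)" "S sums s" "T sums t"
  shows "adjoint_pair s t"
  unfolding adjoint_pair_def
proof (intro allI)
  fix \<phi> \<psi> :: "'a ell2"
  have "(\<lambda>n. cinner \<phi> (app (S n) \<psi>)) sums cinner \<phi> (app s \<psi>)"
    by (intro bounded_linear.sums[OF bounded_linear_cinner_right]
        bounded_linear.sums[OF bounded_linear_app_left] assms)
  moreover have "(\<lambda>n. cnj (cinner \<psi> (app (T n) \<phi>))) sums cnj (cinner \<psi> (app t \<phi>))"
    by (intro sums_cnj[THEN iffD2] bounded_linear.sums[OF bounded_linear_cinner_right]
        bounded_linear.sums[OF bounded_linear_app_left] assms)
  ultimately show "cinner \<phi> (app s \<psi>) = cinner (app t \<phi>) \<psi>"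
    using assms(1) unfolding adjoint_pair_def cinner_commute[symmetric] by (simp add: sums_unique2)
qed

lemma adjoint_pair_exp: "adjoint_pair S T \<Longrightarrow> adjoint_pair (exp S) (exp T)"
  using adjoint_pair_sums[OF _ exp_converges exp_converges] adjoint_pair_scaleR adjoint_pair_power
  by blast

lemma complex_linear_sums:
  assumes "\<And>n. complex_linear (T n)" "T sums t"
  shows "complex_linear t"
  unfolding complex_linear_def
proof (intro allI)
  fix c and \<psi> :: "'a ell2"
  have "(\<lambda>n. app (T n) (c *\<^sub>C \<psi>)) sums app t (c *\<^sub>C \<psi>)" "(\<lambda>n. c *\<^sub>C app (T n) \<psi>) sums (c *\<^sub>C app t \<psi>)"
    by (intro bounded_linear.sums[OF bounded_linear_scaleC_ell2]
        bounded_linear.sums[OF bounded_linear_app_left] assms)+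
  then show "app t (c *\<^sub>C \<psi>) = c *\<^sub>C app t \<psi>"
    using assms(1) by (simp add: complex_linear_def sums_unique2)
qed

lemma complex_linear_power: "complex_linear T \<Longrightarrow> complex_linear (T ^ n)"
  by (induction n) (simp_all add: complex_linear_def)

lemma complex_linear_scaleR: "complex_linear T \<Longrightarrow> complex_linear (r *\<^sub>R T)"
  by (simp add: complex_linear_def scaleR_scaleC scaleC_scaleC mult.commute)

lemma complex_linear_exp: "complex_linear T \<Longrightarrow> complex_linear (exp T)"
  using complex_linear_sums[OF _ exp_converges] complex_linear_scaleR complex_linear_power by blast

section \<open>Positive operators and square roots\<close>

definition pos :: "'v bop \<Rightarrow> bool" where
  "pos P \<longleftrightarrow> complex_linear P \<and> adjoint_pair P P \<and> (\<forall>\<psi>. 0 \<le> Re (cinner \<psi> (app P \<psi>)))"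

lemma pos_adjoint: "pos P \<Longrightarrow> cinner \<phi> (app P \<psi>) = cinner (app P \<phi>) \<psi>"
  by (simp add: pos_def adjoint_pair_def)

lemma pos_nonneg: "pos P \<Longrightarrow> 0 \<le> Re (cinner \<psi> (app P \<psi>))"
  by (simp add: pos_def)

lemma cinner_scaleR_right: "cinner x (r *\<^sub>R y) = of_real r * cinner x (y :: 'h::complex_inner)"
  by (simp add: scaleR_scaleC cinner_scaleC_right)

lemma cinner_scaleR_left: "cinner (r *\<^sub>R x) y = of_real r * cinner x (y :: 'h::complex_inner)"
  by (simp add: scaleR_scaleC cinner_scaleC_left)

text \<open>Over the complex numbers symmetry follows from a real quadratic form: polarization with
  t = 1 and t = \<i> recovers the off-diagonal entries.\<close>

lemma positive_op_app_iff: "positive_op (app P) \<longleftrightarrow> pos P"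
proof
  assume P: "positive_op (app P)"
  then have lin: "app P (c *\<^sub>C \<psi>) = c *\<^sub>C app P \<psi>" for c \<psi>
    by (simp add: positive_op_def)
  have re: "Im (cinner \<psi> (app P \<psi>)) = 0" "0 \<le> Re (cinner \<psi> (app P \<psi>))" for \<psi>
    using P by (simp_all add: positive_op_def complex_nonneg_Reals_iff)
  have "cinner x (app P y) = cinner (app P x) y" for x y
  proof -
    have *: "Im (t * cinner x (app P y) + cnj t * cinner y (app P x)) = 0" for t
    proof -
      have "cinner (x + t *\<^sub>C y) (app P (x + t *\<^sub>C y)) = cinner x (app P x) + (t * cnj t) * cinner y (app P y)
        + (t * cinner x (app P y) + cnj t * cinner y (app P x))"
        by (simp add: linear_simps[OF app_bounded_linear] lin cinner_add_left cinner_add_right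
            cinner_scaleC_left cinner_scaleC_right algebra_simps)
      then show ?thesis
        using re(1)[of "x + t *\<^sub>C y"] re(1)[of x] re(1)[of y]
        by (simp add: complex_norm_square[symmetric] flip: of_real_power)
    qed
    have "cinner x (app P y) = cnj (cinner y (app P x))"
      using *[of 1] *[of \<i>] by (simp add: complex_eq_iff)
    then show ?thesis by (simp flip: cinner_commute)
  qed
  then show "pos P"
    unfolding pos_def complex_linear_def adjoint_pair_def using lin re(2) by blast
next
  assume P: "pos P"
  have "cnj (cinner \<psi> (app P \<psi>)) = cinner \<psi> (app P \<psi>)" for \<psi>
    using pos_adjoint[OF P, of \<psi> \<psi>] by (simp flip: cinner_commute)
  then have "Im (cinner \<psi> (app P \<psi>)) = 0" for \<psi>
    by (metis Reals_cnj_iff complex_is_Real_iff)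
  then show "positive_op (app P)"
    using P by (simp add: positive_op_def pos_def complex_linear_def app_bounded_linear
        complex_nonneg_Reals_iff)
qed

lemma norm_bop_le:
  assumes "\<And>\<psi>. norm (app T \<psi>) \<le> b * norm \<psi>" "b \<ge> 0"
  shows "norm T \<le> b"
  using assms unfolding app_def norm_bop.rep_eq by (intro norm_blinfun_bound) auto

text \<open>The operator inequality P^2 <= norm(P) P, obtained without a root of P by evaluating the
  form at \<psi> - e P\<psi> with e = 1 / norm(P).\<close>

lemma pos_norm_square_le:
  assumes P: "pos P"
  shows "(norm (app P \<psi>))\<^sup>2 \<le> norm P * Re (cinner \<psi> (app P \<psi>))"
proof (cases "norm P = 0")
  case False
  define e where "e = 1 / norm P"
  have e: "e > 0" "e * norm P = 1" using False by (simp_all add: e_def)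
  let ?y = "app P \<psi>"
  have "Re (cinner ?y (app P ?y)) \<le> norm ?y * norm (app P ?y)"
    using complex_Re_le_cmod cauchy_schwarz_ell2 by (rule order_trans)
  also have "\<dots> \<le> norm ?y * (norm P * norm ?y)"
    by (intro mult_left_mono norm_app) auto
  finally have 1: "Re (cinner ?y (app P ?y)) \<le> norm P * (norm ?y)\<^sup>2"
    by (simp add: power2_eq_square mult_ac)
  have "cinner (\<psi> - e *\<^sub>R ?y) (app P (\<psi> - e *\<^sub>R ?y)) =
      cinner \<psi> ?y - 2 * of_real e * cinner ?y ?y + of_real (e\<^sup>2) * cinner ?y (app P ?y)"
    by (simp add: linear_simps[OF app_bounded_linear] cinner_diff_left cinner_diff_right
        cinner_scaleR_left cinner_scaleR_right pos_adjoint[OF P, of \<psi>] power2_eq_square algebra_simps)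
  then have "Re (cinner (\<psi> - e *\<^sub>R ?y) (app P (\<psi> - e *\<^sub>R ?y))) =
      Re (cinner \<psi> ?y) - 2 * e * (norm ?y)\<^sup>2 + e\<^sup>2 * Re (cinner ?y (app P ?y))"
    unfolding cinner_self by (simp flip: of_real_power)
  then have "0 \<le> Re (cinner \<psi> ?y) - 2 * e * (norm ?y)\<^sup>2 + e\<^sup>2 * Re (cinner ?y (app P ?y))"
    using pos_nonneg[OF P, of "\<psi> - e *\<^sub>R ?y"] by simp
  also have "e\<^sup>2 * Re (cinner ?y (app P ?y)) \<le> e\<^sup>2 * (norm P * (norm ?y)\<^sup>2)"
    using 1 by (rule mult_left_mono) simp
  also have "e\<^sup>2 * (norm P * (norm ?y)\<^sup>2) = e * (norm ?y)\<^sup>2"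
    using e(2) by (simp add: power2_eq_square mult_ac)
  finally have "e * (norm ?y)\<^sup>2 \<le> Re (cinner \<psi> ?y)" by simp
  then show ?thesis
    using False by (simp add: e_def field_simps)
next
  case True
  then have "P = 0" by simp
  then show ?thesis by simp
qed

lemma pos_app_eq_0: "pos P \<Longrightarrow> Re (cinner \<psi> (app P \<psi>)) = 0 \<Longrightarrow> app P \<psi> = 0"
  using pos_norm_square_le[of P \<psi>] by simp

lemma pos_scaleR: "pos P \<Longrightarrow> r \<ge> 0 \<Longrightarrow> pos (r *\<^sub>R P)"
  by (simp add: pos_def complex_linear_scaleR adjoint_pair_scaleR cinner_scaleR_right)

lemma adjoint_pair_diff: "adjoint_pair S S' \<Longrightarrow> adjoint_pair T T' \<Longrightarrow> adjoint_pair (S - T) (S' - T')"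
  by (simp add: adjoint_pair_def cinner_diff_left cinner_diff_right)

lemma complex_linear_diff: "complex_linear S \<Longrightarrow> complex_linear T \<Longrightarrow> complex_linear (S - T)"
  by (simp add: complex_linear_def CV.scale_right_diff_distrib)

lemma adjoint_pair_1: "adjoint_pair 1 1" and complex_linear_1: "complex_linear 1"
  by (simp_all add: adjoint_pair_def complex_linear_def)

text \<open>The term n = 0 contributes the squared norm of \<psi>, each other term at least minus
  \<open>\<bar>sqrt_coeff n\<bar>\<close> times it. As the absolute coefficients, including the 1 at
  n = 0, add up to at most 2, the total is nonnegative.\<close>

lemma pos_sqrt_series:
  assumes C: "complex_linear C" "adjoint_pair C C" and norm: "norm C \<le> 1"
  shows "pos (sqrt_series C)"
  unfolding pos_def
proof (intro conjI allI)
  have sums: "(\<lambda>n. sqrt_coeff n *\<^sub>R C ^ n) sums sqrt_series C"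
    unfolding sqrt_series_def by (rule summable_sums[OF summable_sqrt_series[OF norm]])
  show "complex_linear (sqrt_series C)"
    by (rule complex_linear_sums[OF _ sums]) (intro complex_linear_scaleR complex_linear_power C)
  show "adjoint_pair (sqrt_series C) (sqrt_series C)"
    by (rule adjoint_pair_sums[OF _ sums sums]) (intro adjoint_pair_scaleR adjoint_pair_power C)
  fix \<psi>
  define r where "r n = Re (cinner \<psi> (app (C ^ n) \<psi>))" for n
  have r0: "r 0 = (norm \<psi>)\<^sup>2" by (simp add: r_def cinner_self)
  have r: "\<bar>r n\<bar> \<le> (norm \<psi>)\<^sup>2" for n
  proof -
    have "\<bar>r n\<bar> \<le> norm \<psi> * norm (app (C ^ n) \<psi>)"
      unfolding r_def using abs_Re_le_cmod cauchy_schwarz_ell2 by (rule order_trans)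
    also have "\<dots> \<le> norm \<psi> * (norm (C ^ n) * norm \<psi>)"
      by (intro mult_left_mono norm_app) auto
    also have "\<dots> \<le> norm \<psi> * (1 * norm \<psi>)"
      using norm_power_ineq[of C n] power_le_one[of "norm C" n] norm
      by (intro mult_left_mono mult_right_mono) auto
    finally show ?thesis by (simp add: power2_eq_square)
  qed
  have le: "(if n \<in> {0} then 2 * (norm \<psi>)\<^sup>2 else 0) - \<bar>sqrt_coeff n\<bar> * (norm \<psi>)\<^sup>2 \<le> sqrt_coeff n * r n" for n
  proof (cases n)
    case 0
    then show ?thesis by (simp add: r0)
  next
    case (Suc k)
    have "\<bar>sqrt_coeff n * r n\<bar> \<le> \<bar>sqrt_coeff n\<bar> * (norm \<psi>)\<^sup>2"
      unfolding abs_mult by (intro mult_left_mono r) auto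
    then show ?thesis using Suc by simp
  qed
  have s1: "(\<lambda>n. sqrt_coeff n * r n) sums Re (cinner \<psi> (app (sqrt_series C) \<psi>))"
    using sums_Re[OF bounded_linear.sums[OF bounded_linear_cinner_right
          bounded_linear.sums[OF bounded_linear_app_left sums]], of \<psi> \<psi>]
    by (simp add: r_def cinner_scaleR_right)
  have s2: "(\<lambda>n. (if n \<in> {0} then 2 * (norm \<psi>)\<^sup>2 else 0) - \<bar>sqrt_coeff n\<bar> * (norm \<psi>)\<^sup>2) sums
      ((\<Sum>n\<in>{0::nat}. 2 * (norm \<psi>)\<^sup>2) - (\<Sum>n. \<bar>sqrt_coeff n\<bar>) * (norm \<psi>)\<^sup>2)"
    by (intro sums_diff sums_If_finite_set sums_mult2 summable_sums summable_abs_sqrt_coeff) simp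
  have "0 \<le> (2 - (\<Sum>n. \<bar>sqrt_coeff n\<bar>)) * (norm \<psi>)\<^sup>2"
    using suminf_abs_sqrt_coeff by (intro mult_nonneg_nonneg) auto
  also have "\<dots> \<le> Re (cinner \<psi> (app (sqrt_series C) \<psi>))"
    using sums_le[OF le s2 s1] by (simp add: left_diff_distrib)
  finally show "0 \<le> Re (cinner \<psi> (app (sqrt_series C) \<psi>))" .
qed

text \<open>P divided by its norm equals 1 - C with C of norm at most 1, so its root is the series
  in C. Commutation with everything that commutes with P serves twice: for uniqueness of the root
  and for exchanging it with the evolution.\<close>

lemma pos_sqrt_exists:
  assumes P: "pos P"
  obtains S where "pos S" "S * S = P" "\<And>X. X * P = P * X \<Longrightarrow> X * S = S * X"
proof (cases "norm P = 0")
  case True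
  then have "P = 0" by simp
  then show thesis using P by (intro that[of 0]) simp_all
next
  case False
  define C where "C = 1 - (1 / norm P) *\<^sub>R P"
  have C: "complex_linear C" "adjoint_pair C C"
    using P unfolding C_def pos_def
    by (auto intro!: complex_linear_diff complex_linear_1 complex_linear_scaleR adjoint_pair_diff
        adjoint_pair_1 adjoint_pair_scaleR)
  have "norm (app C \<psi>) \<le> 1 * norm \<psi>" for \<psi>
  proof (rule power2_le_imp_le)
    let ?y = "app P \<psi>" and ?e = "1 / norm P"
    have "cinner (app C \<psi>) (app C \<psi>) = cinner \<psi> \<psi> - 2 * of_real ?e * cinner \<psi> ?y + of_real (?e\<^sup>2) * cinner ?y ?y"
      unfolding C_def
      by (simp add: cinner_diff_left cinner_diff_right cinner_scaleR_left cinner_scaleR_right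
          pos_adjoint[OF P, symmetric, of \<psi> \<psi>] power2_eq_square
          diff_divide_distrib)
    then have "(norm (app C \<psi>))\<^sup>2 = (norm \<psi>)\<^sup>2 - 2 * ?e * Re (cinner \<psi> ?y) + ?e\<^sup>2 * (norm ?y)\<^sup>2"
      unfolding cinner_self by (simp add: complex_eq_iff flip: of_real_power)
    also have "?e\<^sup>2 * (norm ?y)\<^sup>2 \<le> ?e\<^sup>2 * (norm P * Re (cinner \<psi> ?y))"
      by (intro mult_left_mono pos_norm_square_le P) simp
    also have "?e\<^sup>2 * (norm P * Re (cinner \<psi> ?y)) = ?e * Re (cinner \<psi> ?y)"
      using False by (simp add: power2_eq_square)
    finally have "(norm (app C \<psi>))\<^sup>2 \<le> (norm \<psi>)\<^sup>2 - ?e * Re (cinner \<psi> ?y)"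
      by simp
    moreover have "0 \<le> ?e * Re (cinner \<psi> ?y)"
      using pos_nonneg[OF P, of \<psi>] by (intro mult_nonneg_nonneg) auto
    ultimately show "(norm (app C \<psi>))\<^sup>2 \<le> (1 * norm \<psi>)\<^sup>2"
      unfolding mult_1_left by linarith
  qed simp
  then have norm: "norm C \<le> 1" by (rule norm_bop_le) simp
  define S where "S = sqrt (norm P) *\<^sub>R sqrt_series C"
  show thesis
  proof (rule that)
    show "pos S"
      unfolding S_def by (intro pos_scaleR pos_sqrt_series C norm) simp
    show "S * S = P"
      using False by (simp add: S_def sqrt_series_square[OF norm]) (simp add: C_def)
    show "X * S = S * X" if "X * P = P * X" for X
      using sqrt_series_commute[OF norm, of X] that by (simp add: S_def C_def algebra_simps)
  qed
qed

text \<open>(S + S') (S - S') = 0, so on the vector y = (S - S') x both nonnegative forms vanish;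
  then both operators kill y, and y is orthogonal to itself.\<close>

lemma pos_sqrt_unique:
  assumes "pos S" "pos S'" "S * S = S' * S'" "S' * S = S * S'"
  shows "S = S'"
proof (rule app_eqI)
  fix x
  define y where "y = app S x - app S' x"
  have "app (S + S') y = app ((S + S') * (S - S')) x"
    by (simp add: y_def linear_simps[OF app_bounded_linear])
  also have "(S + S') * (S - S') = 0"
    using assms(3,4) by (simp add: algebra_simps)
  finally have "cinner y (app S y) + cinner y (app S' y) = 0"
    by (simp flip: cinner_add_right)
  then have "Re (cinner y (app S y)) + Re (cinner y (app S' y)) = 0"
    by (simp flip: plus_complex.sel)
  then have "Re (cinner y (app S y)) = 0" "Re (cinner y (app S' y)) = 0"
    using pos_nonneg[OF assms(1), of y] pos_nonneg[OF assms(2), of y] by linarith+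
  then have "app S y = 0" "app S' y = 0"
    using assms(1,2) by (simp_all add: pos_app_eq_0)
  then have "cinner y y = 0"
    by (simp add: y_def cinner_diff_left flip: pos_adjoint[OF assms(1)] pos_adjoint[OF assms(2)])
  then have "y = 0"
    by (simp add: cinner_self)
  then show "app S x = app S' x" by (simp add: y_def)
qed

text \<open>Any positive root commutes with its square P, hence with the root built from the series,
  so \<open>pos_sqrt_unique\<close> makes the definite description meaningful.\<close>

lemma sqrt_op_app:
  assumes P: "pos P"
  obtains S where "pos S" "S * S = P" "sqrt_op (app P) = app S" "\<And>X. X * P = P * X \<Longrightarrow> X * S = S * X"
proof -
  obtain S where S: "pos S" "S * S = P" "\<And>X. X * P = P * X \<Longrightarrow> X * S = S * X"
    using pos_sqrt_exists[OF P] by blast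
  have "sqrt_op (app P) = app S"
    unfolding sqrt_op_def
  proof (rule the_equality)
    show "positive_op (app S) \<and> app S \<circ> app S = app P"
      using S(1) by (auto simp: positive_op_app_iff S(2)[symmetric])
    fix S' assume S': "positive_op S' \<and> S' \<circ> S' = app P"
    then obtain R where R: "app R = S'"
      using bop_exists by (auto simp: positive_op_def)
    have "R * R = P"
      using S' by (intro app_eqI) (auto simp: R fun_eq_iff)
    then have "R * S = S * R"
      by (intro S(3)) (simp add: mult.assoc flip: \<open>R * R = P\<close>)
    moreover have "pos R"
      using S' R positive_op_app_iff[of R] by simp
    moreover have "S * S = R * R"
      using S(2) \<open>R * R = P\<close> by simp
    ultimately have "S = R"
      using pos_sqrt_unique[OF S(1)] by blast
    then show "S' = app S" using R by simp
  qed
  then show thesis using that S by blast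
qed

section \<open>The unitary group and the Bose operator of a positive operator\<close>

lemma complex_unit_exists: "\<exists>J. app J = (\<lambda>\<psi>. \<i> *\<^sub>C \<psi>)"
  using bop_exists[OF bounded_linear_scaleC_ell2[of \<i>]] by metis

text \<open>The operators form a real algebra, so multiplication by \<i> has to enter as one of its
  elements.\<close>

definition imag_unit :: "'v bop" where
  "imag_unit = (SOME J. app J = (\<lambda>\<psi>. \<i> *\<^sub>C \<psi>))"

lemma app_imag_unit [simp]: "app imag_unit \<psi> = \<i> *\<^sub>C \<psi>"
  unfolding imag_unit_def using someI_ex[OF complex_unit_exists] by metis

text \<open>\<open>cexp H z\<close> is \<open>e\<^sup>i\<^sup>z\<^sup>H\<close>.\<close>

definition cexp_gen :: "'v bop \<Rightarrow> complex \<Rightarrow> 'v bop" where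
  "cexp_gen H z = Re z *\<^sub>R (imag_unit * H) - Im z *\<^sub>R H"

definition cexp :: "'v bop \<Rightarrow> complex \<Rightarrow> 'v bop" where
  "cexp H z = exp (cexp_gen H z)"

lemma app_cexp_gen: "app (cexp_gen H z) \<psi> = (\<i> * z) *\<^sub>C app H \<psi>"
proof -
  have "(\<i> * z) *\<^sub>C app H \<psi> = (complex_of_real (Re z) * \<i> - complex_of_real (Im z)) *\<^sub>C app H \<psi>"
    by (intro arg_cong2[where f = scaleC] refl) (simp add: complex_eq_iff)
  then show ?thesis
    by (simp add: cexp_gen_def scaleR_scaleC scaleC_scaleC CV.scale_left_diff_distrib)
qed

context
  fixes H :: "'v bop"
  assumes H: "pos H"
begin

lemma H_linear: "app H (c *\<^sub>C \<psi>) = c *\<^sub>C app H \<psi>"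
  using H by (simp add: pos_def complex_linear_def)

lemma cexp_gen_commute: "cexp_gen H z * cexp_gen H w = cexp_gen H w * cexp_gen H z"
  by (rule app_eqI) (simp add: app_cexp_gen H_linear scaleC_scaleC mult_ac)

lemma cexp_add: "cexp H (z + w) = cexp H z * cexp H w"
proof -
  have "cexp_gen H (z + w) = cexp_gen H z + cexp_gen H w"
    by (simp add: cexp_gen_def algebra_simps)
  then show ?thesis
    unfolding cexp_def by (simp add: exp_add_commuting cexp_gen_commute)
qed

lemma cexp_0: "cexp H 0 = 1"
  by (simp add: cexp_def cexp_gen_def)

lemma app_cexp_gen_power: "app (cexp_gen H z ^ n) \<psi> = (\<i> * z) ^ n *\<^sub>C app (H ^ n) \<psi>"
  by (induction n) (simp_all add: app_cexp_gen H_linear scaleC_scaleC)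

lemma cexp_adjoint: "cinner \<phi> (app (cexp H z) \<psi>) = cinner (app (cexp H (- cnj z)) \<phi>) \<psi>"
proof -
  have "adjoint_pair (cexp_gen H z) (cexp_gen H (- cnj z))"
    by (simp add: adjoint_pair_def app_cexp_gen cinner_scaleC_left cinner_scaleC_right pos_adjoint[OF H]
        cinner_minus_left)
  then show ?thesis
    using adjoint_pair_exp unfolding cexp_def adjoint_pair_def by blast
qed

lemma cexp_real_unitary: "cinner (app (cexp H (of_real t)) \<phi>) (app (cexp H (of_real t)) \<psi>) = cinner \<phi> \<psi>"
proof -
  have "cinner (app (cexp H (of_real t)) \<phi>) (app (cexp H (of_real t)) \<psi>) =
      cinner (app (cexp H (- of_real t) * cexp H (of_real t)) \<phi>) \<psi>"
    using cexp_adjoint[of "app (cexp H (of_real t)) \<phi>" "of_real t" \<psi>] by simp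
  also have "cexp H (- of_real t) * cexp H (of_real t) = 1"
    by (simp add: cexp_0 flip: cexp_add)
  finally show ?thesis by simp
qed

lemma norm_cexp_real: "norm (app (cexp H (of_real t)) \<psi>) = norm \<psi>"
proof -
  have "(norm (app (cexp H (of_real t)) \<psi>))\<^sup>2 = (norm \<psi>)\<^sup>2"
    using cexp_real_unitary[of t \<psi> \<psi>] by (simp only: cinner_self of_real_eq_iff)
  then show ?thesis by (simp add: power2_eq_iff_nonneg)
qed

text \<open>The real part of z contributes a unitary factor, so the bound depends on Im z only and
  is uniform on a horizontal strip.\<close>

lemma cexp_bound: "cmod (cinner x (app (cexp H z) y)) \<le> norm x * (exp (\<bar>Im z\<bar> * norm H) * norm y)"
proof -
  have "norm (app (cexp H z) y) = norm (app (cexp H (of_real (Re z))) (app (cexp H (\<i> * of_real (Im z))) y))"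
    unfolding app_simps(7)[symmetric] cexp_add[symmetric] by (simp add: complex_eq[symmetric])
  also have "\<dots> = norm (app (cexp H (\<i> * of_real (Im z))) y)"
    by (rule norm_cexp_real)
  also have "\<dots> \<le> norm (cexp H (\<i> * of_real (Im z))) * norm y"
    by (rule norm_app)
  also have "\<dots> \<le> exp (\<bar>Im z\<bar> * norm H) * norm y"
    using norm_exp[of "cexp_gen H (\<i> * of_real (Im z))"]
    by (intro mult_right_mono) (simp_all add: cexp_def cexp_gen_def)
  finally show ?thesis
    by (intro order_trans[OF cauchy_schwarz_ell2 mult_left_mono]) auto
qed

lemma cexp_holomorphic: "(\<lambda>z. cinner x (app (cexp H z) y)) holomorphic_on UNIV"
proof -
  define c where "c n = \<i> ^ n * cinner x (app (H ^ n) y) / fact n" for n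
  have "(\<lambda>n. c n * z ^ n) sums cinner x (app (cexp H z) y)" for z
  proof -
    have "(\<lambda>n. cinner x (app (cexp_gen H z ^ n) y /\<^sub>R fact n)) sums cinner x (app (cexp H z) y)"
      unfolding cexp_def by (rule bounded_linear.sums[OF bounded_linear_cinner_right exp_sums_app])
    then show ?thesis
      by (simp add: c_def app_cexp_gen_power cinner_scaleR_right cinner_scaleC_right power_mult_distrib
          divide_inverse mult_ac)
  qed
  then have eq: "cinner x (app (cexp H z) y) = (\<Sum>n. c n * z ^ n)" and summ: "summable (\<lambda>n. c n * z ^ n)" for z
    by (simp_all add: sums_iff)
  show ?thesis
    unfolding eq holomorphic_on_def field_differentiable_def
    using termdiffs_strong_converges_everywhere[OF summ] by blast
qed

lemma exp_op_cexp: "exp_op (\<lambda>\<psi>. (\<i> * of_real t) *\<^sub>C app H \<psi>) = app (cexp H (of_real t))"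
proof -
  have "(\<lambda>\<psi>. (\<i> * of_real t) *\<^sub>C app H \<psi>) = app (cexp_gen H (of_real t))"
    by (simp add: fun_eq_iff app_cexp_gen)
  then show ?thesis by (simp add: exp_op_app cexp_def)
qed

text \<open>An even power is a square H^k H^k, an odd one is H^k H H^k; no root of H is
  involved.\<close>

lemma pos_power_nonneg: "0 \<le> Re (cinner \<psi> (app (H ^ n) \<psi>))"
proof -
  have adj: "cinner \<phi> (app (H ^ k) u) = cinner (app (H ^ k) \<phi>) u" for k \<phi> u
    using H adjoint_pair_power[of H H k] by (simp add: pos_def adjoint_pair_def)
  define k where "k = n div 2"
  have "n = 2 * k \<or> n = 2 * k + 1"
    unfolding k_def by presburger
  then consider "n = k + k" | "n = k + (1 + k)"
    by linarith
  then show ?thesis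
  proof cases
    case 1
    then show ?thesis
      by (simp add: power_add adj cinner_self)
  next
    case 2
    have "H ^ n = H ^ k * (H * H ^ k)"
      by (simp only: 2 power_add power_one_right)
    then show ?thesis
      using pos_nonneg[OF H, of "app (H ^ k) \<psi>"] by (simp add: adj)
  qed
qed

definition bose :: "real \<Rightarrow> 'v bop" where
  "bose \<beta> = exp (\<beta> *\<^sub>R H) - 1"

lemma bose_cexp: "bose \<beta> = cexp H (- \<i> * of_real \<beta>) - 1"
  by (simp add: bose_def cexp_def cexp_gen_def)

text \<open>All terms of the exponential series have nonnegative expectation, so it may be cut off
  after the linear term.\<close>

lemma bose_ge: 
  assumes "\<beta> > 0"
  shows "\<beta> * Re (cinner \<psi> (app H \<psi>)) \<le> Re (cinner \<psi> (app (bose \<beta>) \<psi>))"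
proof -
  define a where "a n = \<beta> ^ n / fact n * Re (cinner \<psi> (app (H ^ n) \<psi>))" for n
  have "(\<lambda>n. Re (cinner \<psi> (app ((\<beta> *\<^sub>R H) ^ n) \<psi> /\<^sub>R fact n))) sums Re (cinner \<psi> (app (exp (\<beta> *\<^sub>R H)) \<psi>))"
    by (intro sums_Re bounded_linear.sums[OF bounded_linear_cinner_right exp_sums_app])
  moreover have "Re (cinner \<psi> (app ((\<beta> *\<^sub>R H) ^ n) \<psi> /\<^sub>R fact n)) = a n" for n
  proof -
    have "cinner \<psi> (app ((\<beta> *\<^sub>R H) ^ n) \<psi> /\<^sub>R fact n) =
        of_real (inverse (fact n) * \<beta> ^ n) * cinner \<psi> (app (H ^ n) \<psi>)"
      unfolding scaleR_power app_simps cinner_scaleR_right of_real_mult by (simp only: mult.assoc)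
    then show ?thesis
      by (simp only: a_def times_complex.sel Re_complex_of_real Im_complex_of_real divide_inverse
          mult_zero_left diff_0_right mult.commute[of "inverse (fact n)"])
  qed
  ultimately have s1: "a sums Re (cinner \<psi> (app (exp (\<beta> *\<^sub>R H)) \<psi>))"
    by simp
  have s2: "(\<lambda>n. if n \<in> {0, 1} then a n else 0) sums (\<Sum>n\<in>{0, 1}. a n)"
    by (rule sums_If_finite_set) simp
  have "(if n \<in> {0, 1} then a n else 0) \<le> a n" for n
    using assms pos_power_nonneg[of \<psi> n] by (simp add: a_def)
  from sums_le[OF this s2 s1]
  have "(\<Sum>n\<in>{0, 1}. a n) \<le> Re (cinner \<psi> (app (exp (\<beta> *\<^sub>R H)) \<psi>))" .
  then show ?thesis
    by (simp add: a_def bose_def cinner_diff_right)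
qed

lemma pos_bose: "\<beta> > 0 \<Longrightarrow> pos (bose \<beta>)"
  unfolding pos_def
proof (intro conjI allI)
  assume "\<beta> > 0"
  show "complex_linear (bose \<beta>)" "adjoint_pair (bose \<beta>) (bose \<beta>)"
    using H unfolding bose_def pos_def
    by (auto intro!: complex_linear_diff complex_linear_exp complex_linear_scaleR complex_linear_1
        adjoint_pair_diff adjoint_pair_exp adjoint_pair_scaleR adjoint_pair_1)
  show "0 \<le> Re (cinner \<psi> (app (bose \<beta>) \<psi>))" for \<psi>
    using bose_ge[OF \<open>\<beta> > 0\<close>, of \<psi>] pos_nonneg[OF H, of \<psi>] \<open>\<beta> > 0\<close>
    by (meson mult_nonneg_nonneg less_imp_le order_trans)
qed

end

section \<open>Quasi-free KMS states of a Bose gas\<close>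

text \<open>Here \<open>\<kappa>\<close> and p stand for c / beta and the pairing with v. The
  assumption \<open>form_bounded\<close> places S in the range of the root of e^(beta H) - 1;
  invariance of p makes the condensate term constant along the evolution.\<close>

locale bose_system = weyl_system S W
  for S :: "'v ell2 set" and W :: "'v ell2 \<Rightarrow> 'a::cstar_algebra" +
  fixes H :: "'v bop" and \<beta> \<kappa> :: real and p :: "'v ell2 \<Rightarrow> complex"
  assumes H: "pos H"
    and H_definite: "Re (cinner \<psi> (app H \<psi>)) = 0 \<Longrightarrow> \<psi> = 0"
    and \<beta>: "\<beta> > 0" and \<kappa>: "\<kappa> \<ge> 0"
    and form_bounded: "\<xi> \<in> S \<Longrightarrow> \<exists>C. \<forall>\<psi>. cmod (cinner \<xi> \<psi>) \<le> C * sqrt (Re (cinner \<psi> (app H \<psi>)))"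
    and cexp_mem: "\<xi> \<in> S \<Longrightarrow> app (cexp H (of_real t)) \<xi> \<in> S"
    and p_add: "\<xi> \<in> S \<Longrightarrow> \<eta> \<in> S \<Longrightarrow> p (\<xi> + \<eta>) = p \<xi> + p \<eta>"
    and p_scale: "\<xi> \<in> S \<Longrightarrow> p (a *\<^sub>C \<xi>) = a * p \<xi>"
    and p_invariant: "\<xi> \<in> S \<Longrightarrow> p (app (cexp H (of_real t)) \<xi>) = p \<xi>"
begin

abbreviation B where "B \<equiv> bose H \<beta>"

definition R :: "'v bop" where
  "R = (SOME R. pos R \<and> R * R = B \<and> sqrt_op (app B) = app R \<and> (\<forall>X. X * B = B * X \<longrightarrow> X * R = R * X))"

lemma R: "pos R" "R * R = B" "sqrt_op (app B) = app R" "X * B = B * X \<Longrightarrow> X * R = R * X"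
proof -
  have "\<exists>R. pos R \<and> R * R = B \<and> sqrt_op (app B) = app R \<and> (\<forall>X. X * B = B * X \<longrightarrow> X * R = R * X)"
    using sqrt_op_app[OF pos_bose[OF H \<beta>]] by metis
  from someI_ex[OF this, folded R_def]
  show "pos R" "R * R = B" "sqrt_op (app B) = app R" "X * B = B * X \<Longrightarrow> X * R = R * X"
    by blast+
qed

definition r :: "'v ell2 \<Rightarrow> 'v ell2" where
  "r = inv_sqrt_op (app B)"

definition q :: "'v ell2 \<Rightarrow> 'v ell2 \<Rightarrow> complex" where
  "q \<xi> \<eta> = cinner (r \<eta>) (r \<xi>) + complex_of_real \<kappa> * cnj (p \<eta>) * p \<xi>"

definition T :: "real \<Rightarrow> 'v ell2 \<Rightarrow> 'v ell2" where
  "T t = app (cexp H (of_real t))"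

lemma norm_R_ge: "\<beta> * Re (cinner \<psi> (app H \<psi>)) \<le> (norm (app R \<psi>))\<^sup>2"
proof -
  have "cinner (app R \<psi>) (app R \<psi>) = cinner \<psi> (app B \<psi>)"
    by (simp add: pos_adjoint[OF R(1)] R(2)[symmetric])
  then have "(norm (app R \<psi>))\<^sup>2 = Re (cinner \<psi> (app B \<psi>))"
    unfolding cinner_self by (simp add: complex_eq_iff)
  then show ?thesis
    using bose_ge[OF H \<beta>, of \<psi>] by simp
qed

lemma inj_R: "inj (app R)"
proof (rule injI)
  fix x y assume "app R x = app R y"
  then have "app R (x - y) = 0"
    by (simp add: linear_simps[OF app_bounded_linear])
  then have "\<beta> * Re (cinner (x - y) (app H (x - y))) \<le> 0"
    using norm_R_ge[of "x - y"] by simp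
  then have "Re (cinner (x - y) (app H (x - y))) = 0"
    using \<beta> pos_nonneg[OF H, of "x - y"] by (simp add: mult_le_0_iff)
  then show "x = y"
    using H_definite by fastforce
qed

lemma r_R [simp]: "r (app R x) = x"
  unfolding r_def inv_sqrt_op_def R(3) by (rule inv_f_f[OF inj_R])

text \<open>The pairing with \<xi> is bounded by the form of H, hence by the norm of R\<psi>,
  because R^2 dominates beta H. The variational lemma turns this into a preimage under R.\<close>

lemma S_range:
  assumes "\<xi> \<in> S"
  obtains x where "\<xi> = app R x"
proof -
  obtain C where C: "\<And>\<psi>. cmod (cinner \<xi> \<psi>) \<le> C * sqrt (Re (cinner \<psi> (app H \<psi>)))"
    using form_bounded[OF assms] by blast
  have "\<xi> \<in> range (app R)"
  proof (rule mem_range_if_bounded_by_image[OF app_bounded_linear])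
    show "inner (app R x) y = inner x (app R y)" for x y
      by (simp add: inner_eq_Re_cinner pos_adjoint[OF R(1)])
    fix \<psi>
    have "sqrt (\<beta> * Re (cinner \<psi> (app H \<psi>))) \<le> norm (app R \<psi>)"
      using norm_R_ge by (rule real_le_lsqrt[rotated]) auto
    then have "sqrt (Re (cinner \<psi> (app H \<psi>))) \<le> norm (app R \<psi>) / sqrt \<beta>"
      using \<beta> by (simp add: real_sqrt_mult field_simps)
    then have "\<bar>C\<bar> * sqrt (Re (cinner \<psi> (app H \<psi>))) \<le> \<bar>C\<bar> * (norm (app R \<psi>) / sqrt \<beta>)"
      by (rule mult_left_mono) simp
    moreover have "\<bar>inner \<xi> \<psi>\<bar> \<le> cmod (cinner \<xi> \<psi>)"
      unfolding inner_eq_Re_cinner by (rule abs_Re_le_cmod)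
    moreover have "C * sqrt (Re (cinner \<psi> (app H \<psi>))) \<le> \<bar>C\<bar> * sqrt (Re (cinner \<psi> (app H \<psi>)))"
      using pos_nonneg[OF H, of \<psi>] by (intro mult_right_mono) auto
    ultimately show "\<bar>inner \<xi> \<psi>\<bar> \<le> (\<bar>C\<bar> / sqrt \<beta>) * norm (app R \<psi>)"
      using C[of \<psi>] by simp
  qed
  then show thesis using that by blast
qed

lemma R_linear: "app R (c *\<^sub>C \<psi>) = c *\<^sub>C app R \<psi>"
  using R(1) by (simp add: pos_def complex_linear_def)

lemma r_add: "\<xi> \<in> S \<Longrightarrow> \<eta> \<in> S \<Longrightarrow> r (\<xi> + \<eta>) = r \<xi> + r \<eta>"
  using S_range[of \<xi>] S_range[of \<eta>]
  by (metis linear_simps(1)[OF app_bounded_linear] r_R)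

lemma r_scale: "\<xi> \<in> S \<Longrightarrow> r (c *\<^sub>C \<xi>) = c *\<^sub>C r \<xi>"
  using S_range[of \<xi>] by (metis R_linear r_R)

lemma T_R: "T t (app R x) = app R (T t x)"
proof -
  have "cexp H (of_real t) * B = B * cexp H (of_real t)"
    by (simp add: bose_cexp[OF H] algebra_simps flip: cexp_add[OF H])
  then have "cexp H (of_real t) * R = R * cexp H (of_real t)"
    by (rule R(4))
  then show ?thesis
    unfolding T_def by (metis app_simps(7))
qed

lemma T_mem: "\<xi> \<in> S \<Longrightarrow> T t \<xi> \<in> S"
  unfolding T_def by (rule cexp_mem)

lemma T_unitary: "cinner (T t \<phi>) (T t \<psi>) = cinner \<phi> \<psi>"
  unfolding T_def by (rule cexp_real_unitary[OF H])

lemma T_norm: "norm (T t \<psi>) = norm \<psi>"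
  unfolding T_def by (rule norm_cexp_real[OF H])

lemma T_eq_0_iff: "T t \<psi> = 0 \<longleftrightarrow> \<psi> = 0"
  using T_norm[of t \<psi>] by (metis norm_eq_zero)

lemma r_T: "\<xi> \<in> S \<Longrightarrow> r (T t \<xi>) = T t (r \<xi>)"
  using S_range[of \<xi>] by (metis T_R r_R)

lemma p_T: "\<xi> \<in> S \<Longrightarrow> p (T t \<xi>) = p \<xi>"
  unfolding T_def by (rule p_invariant)

lemma q_T: "\<xi> \<in> S \<Longrightarrow> q (T t \<xi>) (T t \<xi>) = q \<xi> \<xi>"
  by (simp add: q_def r_T T_unitary p_T)

lemma psd_q: "psd_kernel S (\<lambda>f g. q g f)"
  unfolding q_def using psd_kernel_scale[OF psd_kernel_rank_one \<kappa>, of S p]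
  by (intro psd_kernel_add psd_kernel_gram) (simp add: mult.assoc)

lemma q_add: "f \<in> S \<Longrightarrow> g \<in> S \<Longrightarrow> q (f + g) (f + g) = q f f + q f g + q g f + q g g"
  by (simp add: q_def r_add p_add cinner_add_left cinner_add_right algebra_simps)

lemma q_minus: "f \<in> S \<Longrightarrow> g \<in> S \<Longrightarrow> q (- f) g = - q f g" "f \<in> S \<Longrightarrow> g \<in> S \<Longrightarrow> q f (- g) = - q f g"
  using r_scale[of f "-1"] r_scale[of g "-1"] p_scale[of f "-1"] p_scale[of g "-1"]
  by (simp_all add: q_def CV_minus_one cinner_minus_left cinner_minus_right)

lemma evolution_unique_exists: "\<exists>!\<alpha>. induced_evolution S W T \<alpha>"
proof -
  have "\<exists>\<alpha>. induced_evolution S W T \<alpha>"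
  proof (rule evolution_exists)
    show "T t (f + g) = T t f + T t g" for t f g
      unfolding T_def by (rule linear_simps(1)[OF app_bounded_linear])
    show "T 0 f = f" for f
      by (simp add: T_def cexp_0[OF H])
    show "T (s + t) f = T s (T t f)" for s t f
      by (simp add: T_def cexp_add[OF H])
  qed (simp_all add: T_mem T_unitary)
  then show ?thesis
    using evolution_unique[where T = T] T_mem T_eq_0_iff by (intro ex_ex1I) blast+
qed

lemma quasi_free_unique_exists: "\<exists>!\<omega>. quasi_free_state S W q \<omega>"
  using quasi_free_state_exists[OF psd_q q_add q_minus] quasi_free_state_unique by blast

text \<open>With \<open>\<xi> = Rx\<close> and \<open>\<eta> = Ry\<close> the exponents of both correlation functions are boundary values
  of the entire function \<open>F z = \<langle>x, e\<^bsup>i(z - i\<beta>)H\<^esup> y\<rangle> + \<langle>y, e\<^bsup>-izH\<^esup> x\<rangle>\<close> plus a constant.\<close>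

theorem quasi_free_kms:
  assumes \<omega>: "quasi_free_state S W q \<omega>" and \<alpha>: "induced_evolution S W T \<alpha>"
  shows "kms_state \<beta> \<alpha> \<omega>"
proof (rule kms_state_if_kms_on_weyl[OF _ \<alpha> T_mem T_eq_0_iff \<beta>])
  show "is_state \<omega>" using \<omega> by (simp add: quasi_free_state_def)
  fix \<xi> \<eta> assume \<xi>: "\<xi> \<in> S" and \<eta>: "\<eta> \<in> S"
  obtain x where x: "\<xi> = app R x" using S_range[OF \<xi>] by blast
  obtain y where y: "\<eta> = app R y" using S_range[OF \<eta>] by blast
  define F where "F z = cinner x (app (cexp H (z - \<i> * of_real \<beta>)) y) + cinner y (app (cexp H (- z)) x)" for z
  define k where "k = complex_of_real \<kappa> * (cnj (p \<eta>) * p \<xi> + cnj (p \<xi>) * p \<eta>)"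
  define \<Phi> where "\<Phi> z = \<omega> (W \<xi>) * \<omega> (W \<eta>) * exp (- (F z + k) / 2)" for z
  have holo: "F holomorphic_on UNIV"
  proof -
    have "(\<lambda>z. cinner x (app (cexp H (z - \<i> * of_real \<beta>)) y)) holomorphic_on UNIV"
      using holomorphic_on_compose[of "\<lambda>z. z - \<i> * of_real \<beta>" UNIV "\<lambda>z. cinner x (app (cexp H z) y)"]
        holomorphic_on_subset[OF cexp_holomorphic[OF H]]
      by (simp add: o_def holomorphic_intros)
    moreover have "(\<lambda>z. cinner y (app (cexp H (- z)) x)) holomorphic_on UNIV"
      using holomorphic_on_compose[of "\<lambda>z. - z" UNIV "\<lambda>z. cinner y (app (cexp H z) x)"]
        holomorphic_on_subset[OF cexp_holomorphic[OF H]]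
      by (simp add: o_def holomorphic_intros)
    ultimately show ?thesis
      unfolding F_def by (rule holomorphic_on_add)
  qed
  have \<Phi>_holo: "\<Phi> holomorphic_on UNIV"
    unfolding \<Phi>_def by (intro holomorphic_intros holo) auto
  define E where "E = exp (\<beta> * norm H)"
  have F_bound: "cmod (F z) \<le> 2 * (norm x * (E * norm y))" if "0 \<le> Im z" "Im z \<le> \<beta>" for z
  proof -
    have "exp (\<bar>Im z - \<beta>\<bar> * norm H) \<le> E" "exp (\<bar>Im z\<bar> * norm H) \<le> E"
      unfolding E_def using that by (auto intro!: mult_right_mono)
    then have "norm x * (exp (\<bar>Im z - \<beta>\<bar> * norm H) * norm y) \<le> norm x * (E * norm y)"
      "norm y * (exp (\<bar>Im z\<bar> * norm H) * norm x) \<le> norm y * (E * norm x)"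
      by (auto intro!: mult_left_mono mult_right_mono)
    moreover have "cmod (F z) \<le> norm x * (exp (\<bar>Im z - \<beta>\<bar> * norm H) * norm y)
        + norm y * (exp (\<bar>Im z\<bar> * norm H) * norm x)"
      unfolding F_def
      using cexp_bound[OF H, of x "z - \<i> * of_real \<beta>" y] cexp_bound[OF H, of y "- z" x]
      by (intro norm_triangle_le add_mono) simp_all
    ultimately show ?thesis by (simp add: mult_ac)
  qed
  have \<Phi>_bound: "cmod (\<Phi> z) \<le> cmod (\<omega> (W \<xi>) * \<omega> (W \<eta>)) * exp (norm x * (E * norm y) + cmod k)"
    if "0 \<le> Im z" "Im z \<le> \<beta>" for z
  proof -
    have "- Re (F z) \<le> 2 * (norm x * (E * norm y))"
      using F_bound[OF that] abs_Re_le_cmod[of "F z"] by (simp add: abs_le_iff)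
    moreover have "- Re k \<le> 2 * cmod k"
      using abs_Re_le_cmod[of k] norm_ge_zero[of k] by linarith
    ultimately have "- (Re (F z) + Re k) / 2 \<le> norm x * (E * norm y) + cmod k"
      by (simp add: field_simps)
    then show ?thesis
      unfolding \<Phi>_def norm_mult[of _ "exp _"] norm_exp_eq_Re by (intro mult_left_mono) simp_all
  qed
  have T_adj: "cinner (T t u) v = cinner u (T (- t) v)" for t u v
    using cexp_adjoint[OF H, of u "- of_real t" v] by (simp add: T_def)
  \<comment> \<open>Since 1 + B is e^(beta H), adding the B-term shifts the time by -\<i>
    beta.\<close>
  have TB: "T t u + app B (T t u) = app (cexp H (of_real t - \<i> * of_real \<beta>)) u" for t u
    using cexp_add[OF H, of "- \<i> * of_real \<beta>" "of_real t"] by (simp add: T_def bose_cexp[OF H] algebra_simps)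
  have state_T: "\<omega> (W (T t \<eta>)) = \<omega> (W \<eta>)" for t
    using \<omega> \<eta> T_mem[OF \<eta>] by (simp add: quasi_free_state_def q_T T_norm)
  have Rr: "cinner (app R u) (app R v) = cinner u (app B v)" for u v
    by (simp add: pos_adjoint[OF R(1), symmetric] R(2)[symmetric])
  have r: "r \<xi> = x" "r (T t \<eta>) = T t y" for t
    by (simp_all add: x r_T[OF \<eta>]) (simp add: y)
  have "\<omega> (W \<xi> * W (T t \<eta>)) = \<Phi> (of_real t)" for t
  proof -
    \<comment> \<open>The commutator part \<open>cinner \<xi> (T t \<eta>)\<close> is the B-term of
      \<open>cinner x (T t y)\<close>; the two combine into the shifted exponential.\<close>
    have "cinner \<xi> (T t \<eta>) + q \<xi> (T t \<eta>) + q (T t \<eta>) \<xi> =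
        (cinner x (T t y) + cinner x (app B (T t y))) + cinner (T t y) x + k"
      by (simp add: q_def r p_T \<eta> k_def algebra_simps) (simp add: x y T_R Rr)
    also have "\<dots> = F (of_real t) + k"
      unfolding cinner_add_right[symmetric] TB T_adj by (simp add: F_def T_def)
    finally show ?thesis
      by (simp add: quasi_free_state_weyl_mult[OF \<omega> psd_q q_add q_minus \<xi> T_mem[OF \<eta>]] \<Phi>_def state_T)
  qed
  moreover have "\<omega> (W (T t \<eta>) * W \<xi>) = \<Phi> (of_real t + \<i> * of_real \<beta>)" for t
  proof -
    have "app B (T (- t) x) = T (- t) (app B x)"
      by (simp add: T_R flip: R(2))
    \<comment> \<open>In the opposite order the B-term joins the pairing of y with x, so the shift
      moves to the other summand of F; this is the value of F at t + \<i> beta.\<close>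
    then have "cinner (T t \<eta>) \<xi> + q (T t \<eta>) \<xi> + q \<xi> (T t \<eta>) =
        (cinner y (T (- t) x) + cinner y (app B (T (- t) x))) + cinner x (T t y) + k"
      by (simp add: q_def r p_T \<eta> k_def algebra_simps) (simp add: x y T_R Rr T_adj)
    also have "\<dots> = F (of_real t + \<i> * of_real \<beta>) + k"
      unfolding cinner_add_right[symmetric] TB by (simp add: F_def T_def algebra_simps)
    finally show ?thesis
      by (simp add: quasi_free_state_weyl_mult[OF \<omega> psd_q q_add q_minus T_mem[OF \<eta>] \<xi>] \<Phi>_def state_T
          mult.commute[of "\<omega> (W \<eta>)"])
  qed
  ultimately show "\<exists>\<Phi> B. \<Phi> holomorphic_on UNIV \<and> (\<forall>z. 0 \<le> Im z \<longrightarrow> Im z \<le> \<beta> \<longrightarrow> cmod (\<Phi> z) \<le> B) \<and>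
      (\<forall>t. \<omega> (W \<xi> * W (T t \<eta>)) = \<Phi> (of_real t)) \<and>
      (\<forall>t. \<omega> (W (T t \<eta>) * W \<xi>) = \<Phi> (of_real t + \<i> * of_real \<beta>))"
    using \<Phi>_holo \<Phi>_bound by blast
qed

end

section \<open>Adjacency operators\<close>

locale bounded_graph =
  fixes E :: "'v \<Rightarrow> 'v \<Rightarrow> bool" and N :: nat
  assumes sym: "E x y \<Longrightarrow> E y x"
    and fin: "finite {y. E x y}"
    and degree: "card {y. E x y} \<le> N"
begin

abbreviation nb where "nb x \<equiv> {y. E x y}"

text \<open>Fubini over the set of directed edges, which the exchange of endpoints maps to itself by
  symmetry of E.\<close>

lemma
  fixes p :: "'v \<Rightarrow> 'v \<Rightarrow> 'b::banach"
  assumes "(\<lambda>y. \<Sum>x\<in>nb y. norm (p x y)) summable_on UNIV"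
  shows edge_swap_summable: "(\<lambda>x. \<Sum>y\<in>nb x. p x y) summable_on UNIV"
    and edge_swap: "(\<Sum>\<^sub>\<infinity>x. \<Sum>y\<in>nb x. p x y) = (\<Sum>\<^sub>\<infinity>y. \<Sum>x\<in>nb y. p x y)"
proof -
  have sw: "bij_betw prod.swap (Sigma UNIV nb) (Sigma UNIV nb)"
    by (rule bij_betw_byWitness[where f' = prod.swap]) (auto intro: sym)
  have "(\<lambda>z. norm (case z of (y, x) \<Rightarrow> p x y)) summable_on (Sigma UNIV nb)"
  proof (rule Infinite_Sum.abs_summable_on_Sigma_iff[THEN iffD2], intro conjI ballI)
    fix y
    show "(\<lambda>x. norm (case (y, x) of (y, x) \<Rightarrow> p x y)) summable_on nb y"
      by (rule summable_on_finite[OF fin])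
  next
    have "(\<lambda>y. norm (\<Sum>x\<in>nb y. norm (p x y))) summable_on UNIV"
      using assms by (simp add: sum_nonneg)
    then show "(\<lambda>y. norm (\<Sum>\<^sub>\<infinity>x\<in>nb y. norm (case (y, x) of (y, x) \<Rightarrow> p x y))) summable_on UNIV"
      by (simp add: fin)
  qed
  then have s: "(\<lambda>(y, x). p x y) summable_on (Sigma UNIV nb)"
    by (rule Infinite_Sum.abs_summable_summable)
  then have s': "(\<lambda>(x, y). p x y) summable_on (Sigma UNIV nb)"
    using summable_on_reindex_bij_betw[OF sw, of "\<lambda>(y, x). p x y"] by (simp add: case_prod_unfold)
  show "(\<lambda>x. \<Sum>y\<in>nb x. p x y) summable_on UNIV"
    using summable_on_Sigma_banach[OF s'] by (simp add: fin)
  have "(\<Sum>\<^sub>\<infinity>x. \<Sum>y\<in>nb x. p x y) = (\<Sum>\<^sub>\<infinity>(x, y)\<in>Sigma UNIV nb. p x y)"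
    using infsum_Sigma'_banach[OF s'] by (simp add: fin)
  also have "\<dots> = (\<Sum>\<^sub>\<infinity>(y, x)\<in>Sigma UNIV nb. p x y)"
    using infsum_reindex_bij_betw[OF sw, of "\<lambda>(y, x). p x y"] by (simp add: case_prod_unfold)
  also have "\<dots> = (\<Sum>\<^sub>\<infinity>y. \<Sum>x\<in>nb y. p x y)"
    using infsum_Sigma'_banach[OF s] by (simp add: fin)
  finally show "(\<Sum>\<^sub>\<infinity>x. \<Sum>y\<in>nb x. p x y) = (\<Sum>\<^sub>\<infinity>y. \<Sum>x\<in>nb y. p x y)" .
qed

text \<open>The Schur test: Cauchy-Schwarz on each neighbourhood with weights sqrt (u y), then an
  exchange of the endpoints, each of the two steps costing one factor K.\<close>

lemma
  assumes u: "\<And>x. u x > 0" and K: "\<And>x. (\<Sum>y\<in>nb x. u y) \<le> K * u x"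
  shows adj_square_summable: "(\<lambda>x. (cmod (\<Sum>y\<in>nb x. apply_ell2 \<psi> y))\<^sup>2) summable_on UNIV"
    and adj_square_bound: "(\<Sum>\<^sub>\<infinity>x. (cmod (\<Sum>y\<in>nb x. apply_ell2 \<psi> y))\<^sup>2) \<le> K\<^sup>2 * (norm \<psi>)\<^sup>2"
proof -
  have K0: "K \<ge> 0"
  proof -
    fix x
    have "0 \<le> K * u x"
      using K[of x] u by (intro order_trans[OF _ K[of x]] sum_nonneg) (simp add: less_imp_le)
    then show ?thesis using u[of x] by (simp add: zero_le_mult_iff)
  qed
  define p where "p x y = K * u x * (cmod (apply_ell2 \<psi> y))\<^sup>2 / u y" for x y
  have p0: "p x y \<ge> 0" for x y
    using K0 u[of x] u[of y] by (simp add: p_def)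
  have le: "(\<Sum>x\<in>nb y. p x y) \<le> K\<^sup>2 * (cmod (apply_ell2 \<psi> y))\<^sup>2" for y
  proof -
    have "(\<Sum>x\<in>nb y. p x y) = K * ((\<Sum>x\<in>nb y. u x) / u y) * (cmod (apply_ell2 \<psi> y))\<^sup>2"
      by (simp add: p_def sum_distrib_left sum_distrib_right sum_divide_distrib)
    also have "\<dots> \<le> K * K * (cmod (apply_ell2 \<psi> y))\<^sup>2"
      using K[of y] u[of y] K0 by (intro mult_right_mono mult_left_mono) (simp_all add: divide_le_eq)
    finally show ?thesis by (simp add: power2_eq_square)
  qed
  have s1: "(\<lambda>y. K\<^sup>2 * (cmod (apply_ell2 \<psi> y))\<^sup>2) summable_on UNIV"
    by (intro summable_on_cmult_right ell2_summable)
  have s2: "(\<lambda>y. \<Sum>x\<in>nb y. p x y) summable_on UNIV"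
    by (rule summable_on_comparison_test[OF s1]) (auto intro: le sum_nonneg p0)
  then have s2': "(\<lambda>y. \<Sum>x\<in>nb y. norm (p x y)) summable_on UNIV"
    by (simp add: p0)
  have ptw: "(cmod (\<Sum>y\<in>nb x. apply_ell2 \<psi> y))\<^sup>2 \<le> (\<Sum>y\<in>nb x. p x y)" for x
  proof -
    have "(cmod (\<Sum>y\<in>nb x. apply_ell2 \<psi> y))\<^sup>2 \<le> (\<Sum>y\<in>nb x. sqrt (u y) * (cmod (apply_ell2 \<psi> y) / sqrt (u y)))\<^sup>2"
      using u by (intro power_mono) (auto intro!: sum_norm_le simp: less_imp_neq[symmetric])
    also have "\<dots> \<le> (\<Sum>y\<in>nb x. (sqrt (u y))\<^sup>2) * (\<Sum>y\<in>nb x. (cmod (apply_ell2 \<psi> y) / sqrt (u y))\<^sup>2)"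
      by (rule Cauchy_Schwarz_ineq_sum)
    also have "\<dots> = (\<Sum>y\<in>nb x. u y) * (\<Sum>y\<in>nb x. (cmod (apply_ell2 \<psi> y))\<^sup>2 / u y)"
      using u by (simp add: power_divide less_imp_le)
    also have "\<dots> \<le> (K * u x) * (\<Sum>y\<in>nb x. (cmod (apply_ell2 \<psi> y))\<^sup>2 / u y)"
      using u by (intro mult_right_mono K sum_nonneg) (simp add: less_imp_le)
    also have "\<dots> = (\<Sum>y\<in>nb x. p x y)"
      by (simp add: p_def sum_distrib_left)
    finally show ?thesis .
  qed
  show 1: "(\<lambda>x. (cmod (\<Sum>y\<in>nb x. apply_ell2 \<psi> y))\<^sup>2) summable_on UNIV"
    by (rule summable_on_comparison_test[OF edge_swap_summable[OF s2']]) (auto intro: ptw)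
  have "(\<Sum>\<^sub>\<infinity>x. (cmod (\<Sum>y\<in>nb x. apply_ell2 \<psi> y))\<^sup>2) \<le> (\<Sum>\<^sub>\<infinity>x. \<Sum>y\<in>nb x. p x y)"
    by (rule infsum_mono[OF 1 edge_swap_summable[OF s2']]) (rule ptw)
  also have "\<dots> = (\<Sum>\<^sub>\<infinity>y. \<Sum>x\<in>nb y. p x y)"
    by (rule edge_swap[OF s2'])
  also have "\<dots> \<le> (\<Sum>\<^sub>\<infinity>y. K\<^sup>2 * (cmod (apply_ell2 \<psi> y))\<^sup>2)"
    by (rule infsum_mono[OF s2 s1]) (rule le)
  also have "\<dots> = K\<^sup>2 * (norm \<psi>)\<^sup>2"
    unfolding norm_ell2_square by (rule infsum_cmult_right')
  finally show "(\<Sum>\<^sub>\<infinity>x. (cmod (\<Sum>y\<in>nb x. apply_ell2 \<psi> y))\<^sup>2) \<le> K\<^sup>2 * (norm \<psi>)\<^sup>2" .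
qed

lemma apply_adj_op: "apply_ell2 (adj_op E \<psi>) x = (\<Sum>y\<in>nb x. apply_ell2 \<psi> y)"
proof -
  have "(\<lambda>x. (cmod (\<Sum>y\<in>nb x. apply_ell2 \<psi> y))\<^sup>2) summable_on UNIV"
    by (rule adj_square_summable[where u = "\<lambda>_. 1" and K = "real N"]) (use degree in auto)
  then show ?thesis
    by (simp add: adj_op_def Abs_ell2_inverse)
qed

lemma norm_adj_op_le:
  assumes "\<And>x. u x > 0" "\<And>x. (\<Sum>y\<in>nb x. u y) \<le> K * u x" "K \<ge> 0"
  shows "norm (adj_op E \<psi>) \<le> K * norm \<psi>"
proof (rule power2_le_imp_le)
  show "(norm (adj_op E \<psi>))\<^sup>2 \<le> (K * norm \<psi>)\<^sup>2"
    using adj_square_bound[OF assms(1,2)] by (simp add: norm_ell2_square[of "adj_op E \<psi>"] apply_adj_op power_mult_distrib)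
qed (use assms(3) in simp)

lemma adj_op_scaleC: "adj_op E (c *\<^sub>C \<psi>) = c *\<^sub>C adj_op E \<psi>"
  by (rule ell2_eqI) (simp add: apply_adj_op scaleC_ell2.rep_eq sum_distrib_left)

lemma bounded_linear_adj_op: "bounded_linear (adj_op E)"
proof (rule bounded_linear_intro)
  show "adj_op E (\<phi> + \<psi>) = adj_op E \<phi> + adj_op E \<psi>" for \<phi> \<psi>
    by (rule ell2_eqI) (simp add: apply_adj_op plus_ell2.rep_eq sum.distrib)
  show "adj_op E (r *\<^sub>R \<psi>) = r *\<^sub>R adj_op E \<psi>" for r \<psi>
    by (simp add: scaleR_scaleC adj_op_scaleC)
  show "norm (adj_op E \<psi>) \<le> norm \<psi> * real N" for \<psi>
    using norm_adj_op_le[of "\<lambda>_. 1" "real N" \<psi>] degree by (simp add: mult.commute)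
qed

lemma adj_op_symmetric: "cinner \<phi> (adj_op E \<psi>) = cinner (adj_op E \<phi>) \<psi>"
proof -
  let ?f = "apply_ell2 \<phi>" and ?g = "apply_ell2 \<psi>"
  have "(\<lambda>x. \<Sum>y\<in>nb x. norm ((cmod (?f x))\<^sup>2)) summable_on UNIV"
  proof (rule summable_on_comparison_test)
    show "(\<lambda>x. real N * (cmod (?f x))\<^sup>2) summable_on UNIV"
      by (intro summable_on_cmult_right ell2_summable)
    show "(\<Sum>y\<in>nb x. norm ((cmod (?f x))\<^sup>2)) \<le> real N * (cmod (?f x))\<^sup>2" for x
      using degree[of x] by (auto intro!: mult_right_mono)
  qed (auto intro: sum_nonneg)
  then have s1: "(\<lambda>x. \<Sum>y\<in>nb x. (cmod (?f y))\<^sup>2) summable_on UNIV"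
    using edge_swap_summable[of "\<lambda>y x. (cmod (?f x))\<^sup>2"] by simp
  have "(\<lambda>y. \<Sum>x\<in>nb y. norm (cnj (?f x) * ?g y)) summable_on UNIV"
  proof (rule summable_on_comparison_test)
    show "(\<lambda>y. (\<Sum>x\<in>nb y. (cmod (?f x))\<^sup>2) + real N * (cmod (?g y))\<^sup>2) summable_on UNIV"
      by (intro summable_on_add s1 summable_on_cmult_right ell2_summable)
    show "(\<Sum>x\<in>nb y. norm (cnj (?f x) * ?g y)) \<le> (\<Sum>x\<in>nb y. (cmod (?f x))\<^sup>2) + real N * (cmod (?g y))\<^sup>2" for y
    proof -
      have "norm (cnj (?f x) * ?g y) \<le> (cmod (?f x))\<^sup>2 + (cmod (?g y))\<^sup>2" for x
        using sum_squares_bound[of "cmod (?f x)" "cmod (?g y)"] mult_nonneg_nonneg[OF norm_ge_zero[of "?f x"] norm_ge_zero[of "?g y"]]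
        unfolding norm_mult complex_mod_cnj by linarith
      then have "(\<Sum>x\<in>nb y. norm (cnj (?f x) * ?g y)) \<le> (\<Sum>x\<in>nb y. (cmod (?f x))\<^sup>2 + (cmod (?g y))\<^sup>2)"
        by (rule sum_mono)
      also have "\<dots> \<le> (\<Sum>x\<in>nb y. (cmod (?f x))\<^sup>2) + real N * (cmod (?g y))\<^sup>2"
        using degree[of y] by (simp add: sum.distrib mult_right_mono)
      finally show ?thesis .
    qed
  qed (auto intro: sum_nonneg)
  from edge_swap[OF this] show ?thesis
    by (simp add: cinner_ell2_def apply_adj_op sum_distrib_left sum_distrib_right cnj_sum)
qed

text \<open>The Schur test for the quadratic form, by the arithmetic-geometric mean inequality with
  ratio u y / u x on every edge. The bound \<mu> may vary with the vertex; a gain on a single tooth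
  can thus be recorded.\<close>

lemma adj_op_form_le:
  assumes u: "\<And>x. u x > 0" and \<mu>: "\<And>x. (\<Sum>y\<in>nb x. u y) \<le> \<mu> x * u x" "\<And>x. \<mu> x \<le> K"
  shows "Re (cinner \<psi> (adj_op E \<psi>)) \<le> (\<Sum>\<^sub>\<infinity>x. \<mu> x * (cmod (apply_ell2 \<psi> x))\<^sup>2)"
    and "(\<lambda>x. \<mu> x * (cmod (apply_ell2 \<psi> x))\<^sup>2) summable_on UNIV"
proof -
  let ?g = "apply_ell2 \<psi>"
  have \<mu>0: "0 \<le> \<mu> x" for x
  proof -
    have "0 \<le> \<mu> x * u x"
      using u by (intro order_trans[OF _ \<mu>(1)[of x]] sum_nonneg) (simp add: less_imp_le)
    then show ?thesis using u[of x] by (simp add: zero_le_mult_iff)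
  qed
  show s\<mu>: "(\<lambda>x. \<mu> x * (cmod (?g x))\<^sup>2) summable_on UNIV"
  proof (rule summable_on_comparison_test)
    show "(\<lambda>x. K * (cmod (?g x))\<^sup>2) summable_on UNIV"
      by (intro summable_on_cmult_right ell2_summable)
  qed (auto intro!: mult_right_mono \<mu>(2) simp: \<mu>0)
  define p where "p x y = u x / u y * (cmod (?g y))\<^sup>2" for x y
  have p0: "p x y \<ge> 0" for x y
    using u[of x] u[of y] by (simp add: p_def)
  have le: "(\<Sum>x\<in>nb y. p x y) \<le> \<mu> y * (cmod (?g y))\<^sup>2" for y
  proof -
    have "(\<Sum>x\<in>nb y. p x y) = (\<Sum>x\<in>nb y. u x) / u y * (cmod (?g y))\<^sup>2"
      by (simp add: p_def sum_distrib_right sum_divide_distrib)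
    also have "\<dots> \<le> \<mu> y * (cmod (?g y))\<^sup>2"
      using \<mu>(1)[of y] u[of y] by (intro mult_right_mono) (simp_all add: divide_le_eq)
    finally show ?thesis .
  qed
  have s2: "(\<lambda>y. \<Sum>x\<in>nb y. p x y) summable_on UNIV"
    by (rule summable_on_comparison_test[OF s\<mu>]) (auto intro: le sum_nonneg p0)
  then have s2': "(\<lambda>y. \<Sum>x\<in>nb y. norm (p x y)) summable_on UNIV"
    by (simp add: p0)
  note s3 = edge_swap_summable[OF s2']
  have ptw: "Re (cnj (?g x) * (\<Sum>y\<in>nb x. ?g y)) \<le> (1/2) * ((\<Sum>y\<in>nb x. p y x) + (\<Sum>y\<in>nb x. p x y))" for x
  proof -
    have "Re (cnj (?g x) * (\<Sum>y\<in>nb x. ?g y)) \<le> (\<Sum>y\<in>nb x. (1/2) * (p y x + p x y))"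
      unfolding sum_distrib_left Re_sum
    proof (rule sum_mono)
      fix y
      have pos: "u x > 0" "u y > 0" using u by auto
      have "0 \<le> (u y * cmod (?g x) - u x * cmod (?g y))\<^sup>2 / (u x * u y)"
        using pos by simp
      also have "\<dots> = p y x + p x y - 2 * (cmod (?g x) * cmod (?g y))"
        using pos by (simp add: p_def power2_eq_square field_simps)
      finally have "cmod (cnj (?g x) * ?g y) \<le> (1/2) * (p y x + p x y)"
        by (simp add: norm_mult)
      then show "Re (cnj (?g x) * ?g y) \<le> (1/2) * (p y x + p x y)"
        using complex_Re_le_cmod order_trans by blast
    qed
    then show ?thesis
      by (simp add: sum.distrib sum_divide_distrib[symmetric])
  qed
  have "Re (cinner \<psi> (adj_op E \<psi>)) = (\<Sum>\<^sub>\<infinity>x. Re (cnj (?g x) * (\<Sum>y\<in>nb x. ?g y)))"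
    using infsum_Re[OF cinner_ell2_summable[of \<psi> "adj_op E \<psi>"]] by (simp add: cinner_ell2_def apply_adj_op)
  also have "\<dots> \<le> (\<Sum>\<^sub>\<infinity>x. (1/2) * ((\<Sum>y\<in>nb x. p y x) + (\<Sum>y\<in>nb x. p x y)))"
  proof (rule infsum_mono)
    show "(\<lambda>x. Re (cnj (?g x) * (\<Sum>y\<in>nb x. ?g y))) summable_on UNIV"
      using summable_on_Re[OF cinner_ell2_summable[of \<psi> "adj_op E \<psi>"]] by (simp add: apply_adj_op)
  qed (intro summable_on_cmult_right summable_on_add s2 s3, rule ptw)
  also have "\<dots> = (1/2) * ((\<Sum>\<^sub>\<infinity>x. \<Sum>y\<in>nb x. p y x) + (\<Sum>\<^sub>\<infinity>x. \<Sum>y\<in>nb x. p x y))"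
    by (simp only: infsum_cmult_right' infsum_add[OF s2 s3])
  also have "\<dots> = (\<Sum>\<^sub>\<infinity>y. \<Sum>x\<in>nb y. p x y)"
    using edge_swap[OF s2'] by simp
  also have "\<dots> \<le> (\<Sum>\<^sub>\<infinity>x. \<mu> x * (cmod (?g x))\<^sup>2)"
    by (rule infsum_mono[OF s2 s\<mu>]) (rule le)
  finally show "Re (cinner \<psi> (adj_op E \<psi>)) \<le> (\<Sum>\<^sub>\<infinity>x. \<mu> x * (cmod (?g x))\<^sup>2)" .
qed

lemma norm_adj_op_ge:
  assumes f: "\<And>x. apply_ell2 \<phi> x = complex_of_real (f x)" "\<And>x. f x \<ge> 0"
    and q: "\<And>x. (\<Sum>y\<in>nb x. f y) \<ge> q * f x" "q \<ge> 0"
  shows "q * norm \<phi> \<le> norm (adj_op E \<phi>)"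
proof (rule power2_le_imp_le)
  have "(q * norm \<phi>)\<^sup>2 = (\<Sum>\<^sub>\<infinity>x. q\<^sup>2 * (cmod (apply_ell2 \<phi> x))\<^sup>2)"
    unfolding power_mult_distrib norm_ell2_square by (rule infsum_cmult_right'[symmetric])
  also have "\<dots> \<le> (\<Sum>\<^sub>\<infinity>x. (cmod (apply_ell2 (adj_op E \<phi>) x))\<^sup>2)"
  proof (rule infsum_mono)
    show "(\<lambda>x. q\<^sup>2 * (cmod (apply_ell2 \<phi> x))\<^sup>2) summable_on UNIV"
      by (intro summable_on_cmult_right ell2_summable)
    show "q\<^sup>2 * (cmod (apply_ell2 \<phi> x))\<^sup>2 \<le> (cmod (apply_ell2 (adj_op E \<phi>) x))\<^sup>2" for x
    proof -
      have "apply_ell2 (adj_op E \<phi>) x = complex_of_real (\<Sum>y\<in>nb x. f y)"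
        by (simp add: apply_adj_op f(1))
      then have "q * cmod (apply_ell2 \<phi> x) \<le> cmod (apply_ell2 (adj_op E \<phi>) x)"
        using q(1)[of x] f(2) sum_nonneg[of "nb x" f] by (simp only: norm_of_real f(1)) simp
      then show ?thesis
        unfolding power_mult_distrib[symmetric] using q(2) by (intro power_mono) auto
    qed
  qed (rule ell2_summable)
  finally show "(q * norm \<phi>)\<^sup>2 \<le> (norm (adj_op E \<phi>))\<^sup>2"
    by (simp only: norm_ell2_square)
qed simp

end

section \<open>The comb graph\<close>

lemma nb_Z: "{y. adj_Z x y} = {x + 1, x - 1}"
  by (auto simp: adj_Z_def abs_if split: if_splits)

interpretation Z: bounded_graph adj_Z 2
  by unfold_locales (auto simp: nb_Z card_insert_if, auto simp: adj_Z_def)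

lemma adj_Zd_iff: "adj_Zd x y \<longleftrightarrow> (\<exists>i. y = x + axis i 1 \<or> y = x - axis i 1)" for x y :: "int ^ 'd::finite"
proof
  assume "adj_Zd x y"
  then have s: "(\<Sum>i\<in>UNIV. \<bar>x $ i - y $ i\<bar>) = 1" by (simp add: adj_Zd_def)
  then obtain i where i: "x $ i \<noteq> y $ i"
    by (metis (no_types, lifting) abs_0 diff_self sum.neutral zero_neq_one)
  have "\<bar>x $ i - y $ i\<bar> + (\<Sum>j\<in>UNIV - {i}. \<bar>x $ j - y $ j\<bar>) = 1"
    using s by (simp add: sum.remove[of UNIV i])
  moreover have "\<bar>x $ i - y $ i\<bar> \<ge> 1" using i by simp
  moreover have "(\<Sum>j\<in>UNIV - {i}. \<bar>x $ j - y $ j\<bar>) \<ge> 0" by (simp add: sum_nonneg)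
  ultimately have "\<bar>x $ i - y $ i\<bar> = 1" "(\<Sum>j\<in>UNIV - {i}. \<bar>x $ j - y $ j\<bar>) = 0" by linarith+
  then have 1: "y $ i = x $ i + 1 \<or> y $ i = x $ i - 1" and 2: "\<And>j. j \<noteq> i \<Longrightarrow> y $ j = x $ j"
    by (simp_all add: sum_nonneg_eq_0_iff) linarith
  show "\<exists>i. y = x + axis i 1 \<or> y = x - axis i 1"
    using 1 2 by (intro exI[of _ i]) (auto simp: vec_eq_iff axis_def)
next
  have "(\<Sum>j\<in>UNIV. \<bar>axis i (1::int) $ j\<bar>) = 1" for i :: 'd
    by (subst sum.remove[of UNIV i]) (auto simp: axis_def)
  moreover assume "\<exists>i. y = x + axis i 1 \<or> y = x - axis i 1"
  ultimately show "adj_Zd x y"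
    by (auto simp: adj_Zd_def)
qed

lemma axis_eq_axis_int: "axis i (1::int) = axis j 1 \<longleftrightarrow> i = j"
  by (auto simp: axis_eq_axis)

lemma
  fixes x :: "int ^ 'd::finite" and f :: "int ^ 'd \<Rightarrow> 'b::comm_monoid_add"
  shows finite_nb_Zd: "finite {y. adj_Zd x y}"
    and sum_nb_Zd: "(\<Sum>y\<in>{y. adj_Zd x y}. f y) = (\<Sum>i\<in>UNIV. f (x + axis i 1) + f (x - axis i 1))"
proof -
  let ?P = "range (\<lambda>i. x + axis i 1)" and ?Q = "range (\<lambda>i. x - axis i 1)"
  have eq: "{y. adj_Zd x y} = ?P \<union> ?Q"
    by (auto simp: adj_Zd_iff)
  have disj: "?P \<inter> ?Q = {}"
  proof -
    have "x + axis i 1 \<noteq> x - axis j (1::int)" for i j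
    proof
      assume "x + axis i 1 = x - axis j (1::int)"
      then have "(x + axis i 1) $ i = (x - axis j (1::int)) $ i" by simp
      then show False by (simp add: axis_def split: if_splits)
    qed
    then show ?thesis by auto
  qed
  show "finite {y. adj_Zd x y}" unfolding eq by simp
  have inj: "inj (\<lambda>i. x + axis i (1::int))" "inj (\<lambda>i. x - axis i (1::int))"
    by (auto simp: inj_def axis_eq_axis_int)
  show "(\<Sum>y\<in>{y. adj_Zd x y}. f y) = (\<Sum>i\<in>UNIV. f (x + axis i 1) + f (x - axis i 1))"
    unfolding eq using disj inj by (simp add: sum.union_disjoint sum.reindex sum.distrib)
qed

lemma card_nb_Zd: "card {y. adj_Zd (x :: int ^ 'd::finite) y} = 2 * CARD('d)"
  using sum_nb_Zd[of "\<lambda>_. 1::nat" x] by simp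

lemma adj_Zd_sym: "adj_Zd x y \<Longrightarrow> adj_Zd y x"
  by (simp add: adj_Zd_def abs_minus_commute)

lemma
  fixes j :: "int ^ 'd::finite" and f :: "'d comb_vertex \<Rightarrow> 'b::comm_monoid_add"
  shows finite_nb_comb: "finite {y. comb adj_Zd adj_Z 0 (j, k) y}"
    and sum_nb_comb: "(\<Sum>y\<in>{y. comb adj_Zd adj_Z 0 (j, k) y}. f y) =
      f (j, k + 1) + f (j, k - 1) + (if k = 0 then \<Sum>j'\<in>{j'. adj_Zd j j'}. f (j', 0) else 0)"
proof -
  let ?Q = "if k = 0 then (\<lambda>j'. (j', 0)) ` {j'. adj_Zd j j'} else {}"
  have eq: "{y. comb adj_Zd adj_Z 0 (j, k) y} = {(j, k + 1), (j, k - 1)} \<union> ?Q"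
    by (auto simp: comb_def adj_Z_def abs_if split: if_splits)
  have disj: "{(j, k + 1), (j, k - 1)} \<inter> ?Q = {}"
    by auto
  have fin: "finite ?Q" by (simp add: finite_nb_Zd)
  then show "finite {y. comb adj_Zd adj_Z 0 (j, k) y}" unfolding eq by simp
  have "(\<Sum>y\<in>?Q. f y) = (if k = 0 then \<Sum>j'\<in>{j'. adj_Zd j j'}. f (j', 0) else 0)"
    by (simp add: sum.reindex inj_on_def)
  then show "(\<Sum>y\<in>{y. comb adj_Zd adj_Z 0 (j, k) y}. f y) =
      f (j, k + 1) + f (j, k - 1) + (if k = 0 then \<Sum>j'\<in>{j'. adj_Zd j j'}. f (j', 0) else 0)"
    unfolding eq using sum.union_disjoint[OF _ fin disj, of f] by (simp add: add.assoc)
qed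

interpretation G: bounded_graph "comb adj_Zd adj_Z 0 :: 'd::finite comb_vertex \<Rightarrow> 'd comb_vertex \<Rightarrow> bool" "2 + 2 * CARD('d)"
proof
  fix x y :: "'d comb_vertex"
  show "comb adj_Zd adj_Z 0 x y \<Longrightarrow> comb adj_Zd adj_Z 0 y x"
    by (auto simp: comb_def adj_Z_def abs_minus_commute adj_Zd_sym split: prod.splits)
  obtain j k where x: "x = (j, k)" by (cases x)
  show "finite {y. comb adj_Zd adj_Z 0 x y}"
    unfolding x by (rule finite_nb_comb)
  show "card {y. comb adj_Zd adj_Z 0 x y} \<le> 2 + 2 * CARD('d)"
    using sum_nb_comb[of "\<lambda>_. 1::nat" j k] card_nb_Zd[of j] by (auto simp: x)
qed

lemma apply_slice: "apply_ell2 (slice \<xi> j) k = apply_ell2 \<xi> (j, k)"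
  by (simp add: slice.rep_eq)

section \<open>The norm of the adjacency operator\<close>

text \<open>Away from the root of a tooth, the powers of x are an eigenfunction of the adjacency
  operator of the integers.\<close>

lemma tooth_sum:
  fixes x :: real
  assumes "x > 0" "k \<noteq> 0"
  shows "x ^ nat \<bar>k + 1\<bar> + x ^ nat \<bar>k - 1\<bar> = (x + 1 / x) * x ^ nat \<bar>k\<bar>"
proof -
  obtain n where n: "nat \<bar>k\<bar> = Suc n"
    using assms(2) by (cases "nat \<bar>k\<bar>") auto
  consider "k = int n + 1" | "k = - int n - 1"
    using n by linarith
  then show ?thesis
  proof cases
    case 1
    then have "nat \<bar>k + 1\<bar> = Suc (Suc n)" "nat \<bar>k - 1\<bar> = n" by auto
    then show ?thesis using assms n by (simp add: distrib_right)
  next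
    case 2
    then have "nat \<bar>k + 1\<bar> = n" "nat \<bar>k - 1\<bar> = Suc (Suc n)" by auto
    then show ?thesis using assms n by (simp add: distrib_right)
  qed
qed

text \<open>The base X may differ from tooth to tooth, since teeth meet only at height 0, where the
  power of X is 1.\<close>

lemma comb_weight_sum:
  fixes U X :: "int ^ 'd::finite \<Rightarrow> real"
  assumes "X j > 0"
  shows "(\<Sum>y\<in>{y. comb adj_Zd adj_Z 0 (j, k) y}. U (fst y) * X (fst y) ^ nat \<bar>snd y\<bar>) =
    (if k = 0 then 2 * X j * U j + (\<Sum>j'\<in>{j'. adj_Zd j j'}. U j')
     else (X j + 1 / X j) * (U j * X j ^ nat \<bar>k\<bar>))"
proof (cases "k = 0")
  case True
  then show ?thesis by (simp add: sum_nb_comb)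
next
  case False
  then show ?thesis
    using arg_cong[OF tooth_sum[OF assms False], of "\<lambda>x. U j * x"]
    by (simp add: sum_nb_comb distrib_left mult_ac)
qed

text \<open>The positive solution of l + 1/l = 2 l + 2 D. It equalizes the eigenvalue along a tooth
  and the one at its root.\<close>

definition comb_lambda :: "real \<Rightarrow> real" where
  "comb_lambda D = sqrt (D\<^sup>2 + 1) - D"

lemma comb_lambda:
  assumes "D > 0"
  shows "0 < comb_lambda D" "comb_lambda D < 1" "comb_lambda D + 1 / comb_lambda D = 2 * sqrt (D\<^sup>2 + 1)"
    "2 * comb_lambda D + 2 * D = 2 * sqrt (D\<^sup>2 + 1)"
proof -
  have "D < sqrt (D\<^sup>2 + 1)" by (rule real_less_rsqrt) simp
  then show pos: "0 < comb_lambda D" by (simp add: comb_lambda_def)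
  have "sqrt (D\<^sup>2 + 1) < D + 1"
    using assms by (intro real_less_lsqrt) (auto simp: power2_sum)
  then show "comb_lambda D < 1" by (simp add: comb_lambda_def)
  have "comb_lambda D * (sqrt (D\<^sup>2 + 1) + D) = 1"
    by (simp add: comb_lambda_def square_diff_square_factored[symmetric] power2_eq_square[symmetric]
        mult.commute add_nonneg_pos) (simp add: algebra_simps power2_eq_square)
  then have "1 / comb_lambda D = sqrt (D\<^sup>2 + 1) + D"
    using pos by (simp add: field_simps)
  then show "comb_lambda D + 1 / comb_lambda D = 2 * sqrt (D\<^sup>2 + 1)"
    by (simp add: comb_lambda_def)
  show "2 * comb_lambda D + 2 * D = 2 * sqrt (D\<^sup>2 + 1)"
    by (simp add: comb_lambda_def)
qed

section \<open>Summability over the lattice\<close>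

lemma summable_on_int:
  fixes f :: "int \<Rightarrow> real"
  assumes "\<And>k. f k \<ge> 0" "summable (\<lambda>n. f (int n))" "summable (\<lambda>n. f (- int n))"
  shows "f summable_on UNIV"
proof -
  have 1: "f summable_on range int"
    by (subst summable_on_reindex) (auto simp: o_def inj_on_def summable_on_UNIV_nonneg_real_iff assms)
  have "f summable_on range (\<lambda>n. - int n)"
    by (subst summable_on_reindex) (auto simp: o_def inj_on_def summable_on_UNIV_nonneg_real_iff assms)
  then have 2: "f summable_on (range (\<lambda>n. - int n) - range int)"
    by (rule summable_on_subset_banach) auto
  have "range int \<union> (range (\<lambda>n. - int n) - range int) = UNIV"
    by (auto, metis int_cases2 rangeI)
  then show ?thesis
    using summable_on_Un_disjoint[OF 1 2] by auto
qed

lemma summable_on_vec_prod: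
  fixes f :: "int \<Rightarrow> real"
  assumes f: "\<And>k. f k \<ge> 0" "f summable_on UNIV"
  shows "(\<lambda>j :: int ^ 'd::finite. \<Prod>i\<in>UNIV. f (j $ i)) summable_on UNIV"
proof (rule nonneg_bounded_partial_sums_imp_summable_on)
  show "\<forall>\<^sub>F X in finite_subsets_at_top (UNIV :: (int ^ 'd) set).
      (\<Sum>j\<in>X. \<Prod>i\<in>UNIV. f (j $ i)) \<le> (\<Sum>\<^sub>\<infinity>k. f k) ^ CARD('d)"
  proof (rule eventually_finite_subsets_at_top_weakI)
    fix X :: "(int ^ 'd) set" assume X: "finite X"
    define G where "G = (\<Union>i. (\<lambda>j. j $ i) ` X)"
    have G: "finite G" unfolding G_def using X by auto
    have inj: "inj_on (\<lambda>j :: int ^ 'd. ($) j) X"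
      by (auto simp: inj_on_def vec_eq_iff)
    have "(\<Sum>j\<in>X. \<Prod>i\<in>UNIV. f (j $ i)) = (\<Sum>g\<in>(\<lambda>j. ($) j) ` X. \<Prod>i\<in>UNIV. f (g i))"
      by (simp add: sum.reindex[OF inj])
    also have "\<dots> \<le> (\<Sum>g\<in>(UNIV :: 'd set) \<rightarrow>\<^sub>E G. \<Prod>i\<in>UNIV. f (g i))"
      by (intro sum_mono2 finite_PiE) (auto simp: G G_def f prod_nonneg X)
    also have "\<dots> = (\<Prod>i\<in>(UNIV :: 'd set). \<Sum>k\<in>G. f k)"
      by (rule prod_sum_PiE[symmetric]) (auto simp: G X)
    also have "\<dots> = (\<Sum>k\<in>G. f k) ^ CARD('d)" by simp
    also have "\<dots> \<le> (\<Sum>\<^sub>\<infinity>k. f k) ^ CARD('d)"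
      by (intro power_mono finite_sum_le_infsum f G sum_nonneg) (auto simp: f)
    finally show "(\<Sum>j\<in>X. \<Prod>i\<in>UNIV. f (j $ i)) \<le> (\<Sum>\<^sub>\<infinity>k. f k) ^ CARD('d)" .
  qed
qed (auto intro: prod_nonneg f)

lemma summable_on_prod_mult:
  fixes f :: "'a \<Rightarrow> real" and g :: "'b \<Rightarrow> real"
  assumes "f summable_on UNIV" "g summable_on UNIV" "\<And>x. f x \<ge> 0" "\<And>y. g y \<ge> 0"
  shows "(\<lambda>(x, y). f x * g y) summable_on UNIV"
proof -
  have "(\<lambda>z. norm (case z of (x, y) \<Rightarrow> f x * g y)) summable_on (UNIV \<times> UNIV)"
  proof (rule Infinite_Sum.abs_summable_on_Sigma_iff[THEN iffD2], intro conjI ballI)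
    show "(\<lambda>y. norm (case (x, y) of (x, y) \<Rightarrow> f x * g y)) summable_on UNIV" for x
      using assms by (simp add: abs_mult summable_on_cmult_right)
    have "(\<lambda>x. f x * infsum g UNIV) summable_on UNIV"
      by (intro summable_on_cmult_left assms)
    then show "(\<lambda>x. norm (\<Sum>\<^sub>\<infinity>y. norm (case (x, y) of (x, y) \<Rightarrow> f x * g y))) summable_on UNIV"
      using assms by (simp add: abs_mult infsum_cmult_right' infsum_nonneg)
  qed
  then show ?thesis
    using Infinite_Sum.abs_summable_summable by fastforce
qed

definition l1 :: "int ^ 'd::finite \<Rightarrow> nat" where
  "l1 j = (\<Sum>i\<in>UNIV. nat \<bar>j $ i\<bar>)"

lemma l1_adj: "adj_Zd j j' \<Longrightarrow> l1 j' \<le> l1 j + 1"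
proof -
  assume "adj_Zd j j'"
  then have s: "(\<Sum>i\<in>UNIV. \<bar>j $ i - j' $ i\<bar>) = 1" by (simp add: adj_Zd_def)
  have "int (l1 j') = (\<Sum>i\<in>UNIV. \<bar>j' $ i\<bar>)" by (simp add: l1_def)
  also have "\<dots> \<le> (\<Sum>i\<in>UNIV. \<bar>j $ i\<bar> + \<bar>j $ i - j' $ i\<bar>)" by (intro sum_mono) linarith
  also have "\<dots> = int (l1 j) + 1" by (simp add: sum.distrib s l1_def)
  finally show ?thesis by simp
qed

lemma summable_on_geometric_int:
  assumes "0 < q" "q < (1::real)"
  shows "(\<lambda>k :: int. q ^ nat \<bar>k\<bar>) summable_on UNIV"
  using assms by (intro summable_on_int) (auto simp: summable_geometric)

lemma summable_on_geometric_l1: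
  assumes "0 < q" "q < (1::real)"
  shows "(\<lambda>j :: int ^ 'd::finite. q ^ l1 j) summable_on UNIV"
  unfolding l1_def power_sum
  using assms by (intro summable_on_vec_prod summable_on_geometric_int) auto

lemma bounded_linear_A_comb: "bounded_linear (A_comb :: 'd::finite comb_vertex ell2 \<Rightarrow> _)"
  unfolding A_comb_def by (rule G.bounded_linear_adj_op)

text \<open>The weight in the Schur test is a positive eigenfunction that is constant along the
  lattice directions, hence not square-summable; the lower bound needs damped versions of
  it.\<close>

theorem onorm_A_comb:
  "onorm (A_comb :: 'd::finite comb_vertex ell2 \<Rightarrow> _) = 2 * sqrt ((real CARD('d))\<^sup>2 + 1)"
proof (rule antisym)
  define D where "D = real CARD('d)"
  have D: "D > 0" by (simp add: D_def)
  let ?l = "comb_lambda D"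
  note l = comb_lambda[OF D]
  have sum: "(\<Sum>y\<in>{y. comb adj_Zd adj_Z 0 x y}. ?l ^ nat \<bar>snd y\<bar>) = 2 * sqrt (D\<^sup>2 + 1) * ?l ^ nat \<bar>snd x\<bar>"
    for x :: "'d comb_vertex"
    using comb_weight_sum[where X = "\<lambda>_. ?l" and U = "\<lambda>_. 1" and j = "fst x" and k = "snd x"] l
    by (auto simp: card_nb_Zd D_def[symmetric] mult_ac split: if_splits)
  have "norm (A_comb \<psi>) \<le> 2 * sqrt (D\<^sup>2 + 1) * norm \<psi>" for \<psi> :: "'d comb_vertex ell2"
    unfolding A_comb_def
    by (rule G.norm_adj_op_le[where u = "\<lambda>x. ?l ^ nat \<bar>snd x\<bar>"]) (use l sum in auto)
  then show "onorm (A_comb :: 'd comb_vertex ell2 \<Rightarrow> _) \<le> 2 * sqrt ((real CARD('d))\<^sup>2 + 1)"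
    unfolding D_def by (intro onorm_bound) auto
  \<comment> \<open>The damping q^(l1 j) costs at most a factor q on horizontal edges and nothing
    along teeth. The limit q -> 1 gives the exact value.\<close>
  have lower: "2 * ?l + 2 * D * q \<le> onorm (A_comb :: 'd comb_vertex ell2 \<Rightarrow> _)" if q: "0 < q" "q < 1" for q
  proof -
    define f where "f x = q ^ l1 (fst x) * ?l ^ nat \<bar>snd x\<bar>" for x :: "'d comb_vertex"
    have f0: "f x \<ge> 0" for x using q l by (simp add: f_def)
    have "(\<lambda>(j :: int ^ 'd, k). (q\<^sup>2) ^ l1 j * (?l\<^sup>2) ^ nat \<bar>k\<bar>) summable_on UNIV"
      using q l by (intro summable_on_prod_mult summable_on_geometric_l1 summable_on_geometric_int)
        (auto simp: power_less_one_iff)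
    moreover have "(cmod (complex_of_real (f x)))\<^sup>2 = (case x of (j, k) \<Rightarrow> (q\<^sup>2) ^ l1 j * (?l\<^sup>2) ^ nat \<bar>k\<bar>)" for x
      unfolding norm_of_real power2_abs f_def case_prod_unfold
      by (simp only: power_mult_distrib power_mult[symmetric] mult.commute)
    ultimately have "(\<lambda>x. (cmod (complex_of_real (f x)))\<^sup>2) summable_on UNIV"
      by simp
    then have rep: "apply_ell2 (Abs_ell2 (\<lambda>x. complex_of_real (f x))) x = complex_of_real (f x)" for x
      by (simp add: Abs_ell2_inverse)
    define \<phi> where "\<phi> = Abs_ell2 (\<lambda>x. complex_of_real (f x))"
    have "\<phi> \<noteq> 0"
    proof
      assume "\<phi> = 0"
      then have "f (0, 0) = 0" using rep[of "(0, 0)"] by (simp add: \<phi>_def zero_ell2.rep_eq)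
      then show False using q by (simp add: f_def)
    qed
    have "(2 * ?l + 2 * D * q) * norm \<phi> \<le> norm (A_comb \<phi>)"
      unfolding A_comb_def
    proof (rule G.norm_adj_op_ge)
      show "apply_ell2 \<phi> x = complex_of_real (f x)" for x by (simp add: \<phi>_def rep)
      show "(2 * ?l + 2 * D * q) * f x \<le> (\<Sum>y\<in>{y. comb adj_Zd adj_Z 0 x y}. f y)" for x :: "'d comb_vertex"
      proof -
        obtain j k where x: "x = (j, k)" by (cases x)
        have "2 * D * q * q ^ l1 j = (\<Sum>j'\<in>{j'. adj_Zd j j'}. q ^ (l1 j + 1))"
          by (simp add: card_nb_Zd D_def)
        also have "\<dots> \<le> (\<Sum>j'\<in>{j'. adj_Zd j j'}. q ^ l1 j')"
          using q by (intro sum_mono power_decreasing l1_adj) auto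
        finally have k0: "2 * D * q * q ^ l1 j \<le> (\<Sum>j'\<in>{j'. adj_Zd j j'}. q ^ l1 j')" .
        have "2 * ?l + 2 * D * q \<le> ?l + 1 / ?l"
        proof -
          have "D * q \<le> D" using D q by (intro mult_left_le) auto
          then show ?thesis using l(3,4) by simp
        qed
        then have "(2 * ?l + 2 * D * q) * f x \<le> (?l + 1 / ?l) * f x"
          using f0 by (intro mult_right_mono) auto
        moreover have "(2 * ?l + 2 * D * q) * q ^ l1 j = 2 * ?l * q ^ l1 j + 2 * D * q * q ^ l1 j"
          by (rule distrib_right)
        ultimately show ?thesis
          using comb_weight_sum[where X = "\<lambda>_. ?l" and U = "\<lambda>j. q ^ l1 j" and j = j and k = k, OF l(1)] k0
          unfolding f_def x by (cases "k = 0") simp_all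
      qed
      show "0 \<le> 2 * ?l + 2 * D * q" using l D q by simp
    qed (rule f0)
    also have "\<dots> \<le> onorm (A_comb :: 'd comb_vertex ell2 \<Rightarrow> _) * norm \<phi>"
      by (rule onorm[OF bounded_linear_A_comb])
    finally show ?thesis using \<open>\<phi> \<noteq> 0\<close> by simp
  qed
  have "((\<lambda>q. 2 * ?l + 2 * D * q) \<longlongrightarrow> 2 * ?l + 2 * D * 1) (at_left 1)"
    by (intro tendsto_intros)
  moreover have "\<forall>\<^sub>F q in at_left (1::real). 2 * ?l + 2 * D * q \<le> onorm (A_comb :: 'd comb_vertex ell2 \<Rightarrow> _)"
    using eventually_at_left_real[of 0 1] by (rule eventually_mono) (auto intro: lower)
  ultimately have "2 * ?l + 2 * D * 1 \<le> onorm (A_comb :: 'd comb_vertex ell2 \<Rightarrow> _)"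
    by (intro tendsto_upperbound) auto
  then show "2 * sqrt ((real CARD('d))\<^sup>2 + 1) \<le> onorm (A_comb :: 'd comb_vertex ell2 \<Rightarrow> _)"
    using l(4) by (simp add: D_def)
qed

section \<open>Transience\<close>

text \<open>The Taylor coefficient of t^2 is 5/32; the larger 3/16 pays for the higher order terms.
  Taking fourth powers makes the claim polynomial.\<close>

lemma powr_minus_quarter_le:
  fixes t :: real
  assumes "\<bar>t\<bar> \<le> 1/8"
  shows "(1 + t) powr (-1/4) \<le> 1 - t / 4 + 3 / 16 * t\<^sup>2"
proof -
  define p where "p = 1 - t / 4 + 3 / 16 * t\<^sup>2"
  have t: "-1/8 \<le> t" "t \<le> 1/8" using assms by (simp_all add: abs_le_iff)
  have p0: "0 \<le> p" using t zero_le_power2[of t] unfolding p_def by linarith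
  have "p ^ 4 * (1 + t) \<ge> 1"
  proof -
    have t3: "\<bar>t ^ n\<bar> \<le> (1/8) ^ n" for n
      using power_mono[OF assms, of n] by (simp add: power_abs)
    \<comment> \<open>The factor 65536 = 16^4 clears the denominators of p^4; the constant 8192
      dominates the rest of the cofactor for |t| <= 1/8.\<close>
    have "65536 * (p ^ 4 * (1 + t) - 1) = t\<^sup>2 * (8192 + 32768 * t - 17664 * t ^ 2 + 15616 * t ^ 3 - 5088 * t ^ 4
        + 2160 * t ^ 5 - 351 * t ^ 6 + 81 * t ^ 7)"
      unfolding p_def by algebra
    moreover have "0 \<le> 8192 + 32768 * t - 17664 * t ^ 2 + 15616 * t ^ 3 - 5088 * t ^ 4
        + 2160 * t ^ 5 - 351 * t ^ 6 + 81 * t ^ 7"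
      using t t3[of 2] t3[of 3] t3[of 4] t3[of 5] t3[of 6] t3[of 7]
      by (simp add: abs_le_iff power_divide)
    ultimately have "0 \<le> 65536 * (p ^ 4 * (1 + t) - 1)" by simp
    then show ?thesis by simp
  qed
  then have "((1 + t) powr (-1/4)) ^ 4 \<le> p ^ 4"
    using t by (simp add: powr_realpow[symmetric] powr_powr powr_minus field_simps)
  then show ?thesis
    using p0 unfolding p_def[symmetric] by (simp add: power_mono_iff)
qed

lemma powr_minus_quarter_ge:
  fixes s :: real
  assumes "0 < s" "s < 1"
  shows "1 + s / 4 \<le> (1 - s) powr (-1/4)"
proof -
  have "ln (1 - s) \<le> - s"
    using ln_le_minus_one[of "1 - s"] assms by simp
  then have "s / 4 \<le> -1/4 * ln (1 - s)"
    by simp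
  then have "exp (s / 4) \<le> (1 - s) powr (-1/4)"
    using assms by (simp add: powr_def)
  then show ?thesis
    using exp_ge_add_one_self[of "s / 4"] by linarith
qed

text \<open>The constant 63 ensures \<open>2|j\<^sub>i| / (64 + |j|\<^sup>2) \<le> 1/8\<close>, the range of the quadratic bound for \<open>(1 + t)\<^bsup>-1/4\<^esup>\<close>.\<close>

definition sq :: "int ^ 'd::finite \<Rightarrow> real" where
  "sq j = (\<Sum>i\<in>UNIV. (real_of_int (j $ i))\<^sup>2)"

text \<open>Modelled on |x|^(-1/2), whose Laplacian in R^d is (1/2) (5/2 - d) |x|^(-5/2), negative
  for d >= 3.\<close>

definition super :: "int ^ 'd::finite \<Rightarrow> real" where
  "super j = (63 + sq j) powr (-1/4)"

lemma sq_nonneg: "0 \<le> sq j"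
  unfolding sq_def by (intro sum_nonneg) simp

lemma super_pos: "0 < super j"
  using sq_nonneg[of j] by (simp add: super_def)

lemma sq_axis:
  "sq (j + axis i 1) = sq j + 2 * real_of_int (j $ i) + 1" "sq (j - axis i 1) = sq j - 2 * real_of_int (j $ i) + 1"
proof -
  have "sq (j + axis i 1) = (\<Sum>l\<in>UNIV. (real_of_int (j $ l))\<^sup>2 + (if l = i then 2 * real_of_int (j $ i) + 1 else 0))"
    unfolding sq_def by (intro sum.cong) (auto simp: axis_def power2_sum)
  then show "sq (j + axis i 1) = sq j + 2 * real_of_int (j $ i) + 1"
    by (simp add: sum.distrib sq_def)
  have "sq (j - axis i 1) = (\<Sum>l\<in>UNIV. (real_of_int (j $ l))\<^sup>2 + (if l = i then 1 - 2 * real_of_int (j $ i) else 0))"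
    unfolding sq_def by (intro sum.cong) (auto simp: axis_def power2_diff)
  then show "sq (j - axis i 1) = sq j - 2 * real_of_int (j $ i) + 1"
    by (simp add: sum.distrib sq_def)
qed

text \<open>Opposite neighbours are paired: 63 plus their squared length is y (1 + t) and y (1 - t),
  so the linear terms cancel. The quadratic terms are of order 1/y in total and are absorbed by the
  step from y down to y - 1 at the centre.\<close>

lemma superharmonic:
  fixes j :: "int ^ 'd::finite"
  assumes "CARD('d) \<ge> 3"
  shows "(\<Sum>j'\<in>{j'. adj_Zd j j'}. super j') \<le> 2 * real CARD('d) * super j"
proof -
  define D where "D = real CARD('d)"
  define y where "y = 64 + sq j"
  have y: "y \<ge> 64" using sq_nonneg[of j] by (simp add: y_def)
  have pair: "super (j + axis i 1) + super (j - axis i 1) \<le>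
      y powr (-1/4) * (2 + 3/2 * ((real_of_int (j $ i))\<^sup>2 / y\<^sup>2))" for i
  proof -
    define t where "t = 2 * real_of_int (j $ i) / y"
    have "(real_of_int (j $ i))\<^sup>2 \<le> sq j"
      unfolding sq_def by (intro member_le_sum) auto
    moreover have "0 \<le> (\<bar>real_of_int (j $ i)\<bar> - 8)\<^sup>2" by simp
    ultimately have "16 * \<bar>real_of_int (j $ i)\<bar> \<le> y"
      by (simp add: y_def power2_diff)
    then have t: "\<bar>t\<bar> \<le> 1/8" using y by (simp add: t_def field_simps)
    have eq: "63 + sq (j + axis i 1) = y * (1 + t)" "63 + sq (j - axis i 1) = y * (1 + (- t))"
      unfolding sq_axis using y by (simp_all add: t_def y_def field_simps)
    have "super (j + axis i 1) + super (j - axis i 1) =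
        y powr (-1/4) * ((1 + t) powr (-1/4) + (1 + (- t)) powr (-1/4))"
      unfolding super_def eq powr_mult by (rule distrib_left[symmetric])
    also have "\<dots> \<le> y powr (-1/4) * ((1 - t / 4 + 3 / 16 * t\<^sup>2) + (1 - (- t) / 4 + 3 / 16 * (- t)\<^sup>2))"
      using t by (intro mult_left_mono add_mono powr_minus_quarter_le) auto
    also have "(1 - t / 4 + 3 / 16 * t\<^sup>2) + (1 - (- t) / 4 + 3 / 16 * (- t)\<^sup>2) =
        2 + 3/2 * ((real_of_int (j $ i))\<^sup>2 / y\<^sup>2)"
      by (simp add: t_def power_divide power_mult_distrib)
    finally show ?thesis .
  qed
  have "(\<Sum>j'\<in>{j'. adj_Zd j j'}. super j') \<le> (\<Sum>i\<in>(UNIV :: 'd set). y powr (-1/4) * (2 + 3/2 * ((real_of_int (j $ i))\<^sup>2 / y\<^sup>2)))"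
    unfolding sum_nb_Zd by (intro sum_mono pair)
  also have "\<dots> = y powr (-1/4) * (2 * D + 3/2 * (sq j / y\<^sup>2))"
    by (simp add: sum_distrib_left[symmetric] sum.distrib sum_divide_distrib[symmetric] sq_def D_def
        del: sum_divide_distrib)
  also have "\<dots> \<le> y powr (-1/4) * (2 * D * (1 + (1 / y) / 4))"
  proof (rule mult_left_mono)
    have "sq j / y\<^sup>2 \<le> y / y\<^sup>2"
      using y by (intro divide_right_mono) (auto simp: y_def)
    also have "y / y\<^sup>2 = 1 / y" using y by (simp add: power2_eq_square)
    finally have "3/2 * (sq j / y\<^sup>2) \<le> 3/2 * (1 / y)" by simp
    \<comment> \<open>Here d >= 3 enters: 3/2 must not exceed D / 2.\<close>
    also have "\<dots> \<le> D / 2 * (1 / y)"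
      using assms y by (intro mult_right_mono) (auto simp: D_def)
    finally show "2 * D + 3/2 * (sq j / y\<^sup>2) \<le> 2 * D * (1 + (1 / y) / 4)"
      by (simp add: distrib_left)
  qed simp
  also have "\<dots> \<le> y powr (-1/4) * (2 * D * (1 - 1 / y) powr (-1/4))"
    using y by (intro mult_left_mono powr_minus_quarter_ge) (auto simp: D_def)
  also have "\<dots> = 2 * D * super j"
  proof -
    have "y * (1 - 1 / y) = 63 + sq j" using y by (simp add: y_def field_simps)
    then have "y powr (-1/4) * (1 - 1 / y) powr (-1/4) = super j"
      using y by (simp add: super_def powr_mult[symmetric])
    then show ?thesis by (simp add: mult_ac)
  qed
  finally show ?thesis by (simp add: D_def)
qed

text \<open>All neighbours of 0 have the value 64^(-1/4), strictly below the value 63^(-1/4) at 0;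
  \<epsilon> measures this relative drop.\<close>

lemma superharmonic_strict:
  obtains \<epsilon> where "\<epsilon> > 0"
    "(\<Sum>j'\<in>{j' :: int ^ 'd::finite. adj_Zd 0 j'}. super j') = (2 * real CARD('d) - \<epsilon>) * super (0 :: int ^ 'd)"
proof -
  have z: "sq (0 :: int ^ 'd) = 0" by (simp add: sq_def)
  have "(\<Sum>j'\<in>{j' :: int ^ 'd. adj_Zd 0 j'}. super j') = 2 * real CARD('d) * 64 powr (-1/4)"
    unfolding sum_nb_Zd by (simp add: super_def sq_axis z del: add_0_left diff_0)
  moreover have "64 powr (-1/4) < super (0 :: int ^ 'd)"
    by (simp add: super_def z powr_less_mono2_neg)
  ultimately show thesis
    using super_pos[of "0 :: int ^ 'd"]
    by (intro that[of "2 * real CARD('d) * (1 - 64 powr (-1/4) / super (0 :: int ^ 'd))"])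
      (auto simp: field_simps)
qed

lemma infsum_diff:
  fixes f g :: "'a \<Rightarrow> 'b::{topological_ab_group_add,t2_space}"
  assumes "f summable_on A" "g summable_on A"
  shows "(\<Sum>\<^sub>\<infinity>x\<in>A. f x - g x) = (\<Sum>\<^sub>\<infinity>x\<in>A. f x) - (\<Sum>\<^sub>\<infinity>x\<in>A. g x)"
  using infsum_add[OF assms(1), of "\<lambda>x. - g x"] assms(2) by (simp add: infsum_uminus summable_on_uminus)

lemma norm_slice_square: "(norm (slice \<psi> j))\<^sup>2 = (\<Sum>\<^sub>\<infinity>x. if fst x = j then (cmod (apply_ell2 \<psi> x))\<^sup>2 else 0)"
  and slice_square_summable: "(\<lambda>x. if fst x = j then (cmod (apply_ell2 \<psi> x))\<^sup>2 else 0) summable_on UNIV"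
proof -
  have inj: "inj_on (Pair j) UNIV" by (simp add: inj_on_def)
  have "(norm (slice \<psi> j))\<^sup>2 = (\<Sum>\<^sub>\<infinity>x\<in>range (Pair j). (cmod (apply_ell2 \<psi> x))\<^sup>2)"
    unfolding norm_ell2_square apply_slice infsum_reindex[OF inj] by (simp add: o_def)
  also have "\<dots> = (\<Sum>\<^sub>\<infinity>x. if fst x = j then (cmod (apply_ell2 \<psi> x))\<^sup>2 else 0)"
    by (rule infsum_cong_neutral) auto
  finally show "(norm (slice \<psi> j))\<^sup>2 = (\<Sum>\<^sub>\<infinity>x. if fst x = j then (cmod (apply_ell2 \<psi> x))\<^sup>2 else 0)" .
  show "(\<lambda>x. if fst x = j then (cmod (apply_ell2 \<psi> x))\<^sup>2 else 0) summable_on UNIV"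
    by (rule summable_on_comparison_test[OF ell2_summable[of \<psi>]]) auto
qed

text \<open>The weight below is \<open>super (j - j0) \<lambda>\<^bsup>|k|\<^esup>\<close>, with \<open>\<lambda>\<close> replaced by a slightly larger \<open>\<lambda>'\<close>
  on the tooth at \<open>j0\<close>: the strict superharmonicity at the base point then spreads over this tooth.\<close>

lemma form_H_comb_ge:
  assumes "CARD('d::finite) \<ge> 3"
  obtains c where "c > 0"
    "\<And>(\<psi> :: 'd comb_vertex ell2) j. c * (norm (slice \<psi> j))\<^sup>2 \<le> Re (cinner \<psi> (H_comb \<psi>))"
proof -
  define D where "D = real CARD('d)"
  have D: "D > 0" by (simp add: D_def)
  define l where "l = comb_lambda D"
  define a where "a = 2 * sqrt (D\<^sup>2 + 1)"
  note l = comb_lambda[OF D, folded l_def a_def]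
  obtain e where e: "e > 0"
    "(\<Sum>j'\<in>{j' :: int ^ 'd. adj_Zd 0 j'}. super j') = (2 * D - e) * super (0 :: int ^ 'd)"
    unfolding D_def by (rule superharmonic_strict)
  \<comment> \<open>Half of the gain e at the root of the tooth pays for raising 2 l to 2 l', the
    other half is kept for c. The second bound keeps l' below 1.\<close>
  define m where "m = min (e / 4) ((1 - l) / 2)"
  have m: "0 < m" "m \<le> e / 4" "m \<le> (1 - l) / 2"
    using l(1,2) e(1) min.cobounded1[of "e / 4" "(1 - l) / 2"] min.cobounded2[of "e / 4" "(1 - l) / 2"]
    unfolding m_def by simp_all
  define l' where "l' = l + m"
  have l': "l < l'" "l' < 1" "2 * l' \<le> 2 * l + e / 2" "l' > 0"
    unfolding l'_def using l(1,2) m by (simp_all add: field_simps)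
  \<comment> \<open>The function x + 1/x decreases on (0, 1), so the larger base l' gains at every
    height of the tooth.\<close>
  have gap: "0 < a - (l' + 1 / l')"
  proof -
    have "l * l' < 1 * 1"
      using l l' by (intro mult_strict_mono) auto
    then have "0 < (l' - l) * (1 - l * l') / (l * l')"
      using l l' by (intro divide_pos_pos mult_pos_pos) auto
    also have "\<dots> = (l + 1 / l) - (l' + 1 / l')"
      using l(1) l'(4) by (simp add: field_simps)
    finally show ?thesis using l(3) by simp
  qed
  define c where "c = min (e / 2) (a - (l' + 1 / l'))"
  have c: "c > 0" "c \<le> e / 2" "c \<le> a - (l' + 1 / l')"
    using e(1) gap min.cobounded1[of "e / 2" "a - (l' + 1 / l')"]
      min.cobounded2[of "e / 2" "a - (l' + 1 / l')"]
    unfolding c_def by simp_all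
  have "c * (norm (slice \<psi> j0))\<^sup>2 \<le> Re (cinner \<psi> (H_comb \<psi>))" for \<psi> :: "'d comb_vertex ell2" and j0
  proof -
    \<comment> \<open>Translating the weight to the tooth j0 keeps all constants, so c is the same
      for all teeth.\<close>
    define U where "U j = super (j - j0)" for j
    define X where "X j = (if j = j0 then l' else l)" for j
    define u where "u x = U (fst x) * X (fst x) ^ nat \<bar>snd x\<bar>" for x :: "'d comb_vertex"
    define \<mu> where "\<mu> x = (if fst x = j0 then a - c else a)" for x :: "'d comb_vertex"
    have X: "X j > 0" for j using l l' by (simp add: X_def)
    have U: "U j > 0" for j by (simp add: U_def super_pos)
    have U_sum: "(\<Sum>j'\<in>{j'. adj_Zd j j'}. U j') = (\<Sum>j'\<in>{j'. adj_Zd (j - j0) j'}. super j')" for j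
      unfolding sum_nb_Zd U_def by (simp add: algebra_simps)
    have u\<mu>: "(\<Sum>y\<in>{y. comb adj_Zd adj_Z 0 x y}. u y) \<le> \<mu> x * u x" for x
    proof -
      obtain j k where x: "x = (j, k)" by (cases x)
      have u: "u x > 0" using U X by (simp add: u_def)
      show ?thesis
      proof (cases "k = 0")
        case True
        have "2 * X j * U j + (\<Sum>j'\<in>{j'. adj_Zd j j'}. U j') \<le> \<mu> x * U j"
        proof (cases "j = j0")
          case True
          have "2 * X j * U j + (\<Sum>j'\<in>{j'. adj_Zd j j'}. U j') = (2 * l' + (2 * D - e)) * U j"
            using True e(2) unfolding U_sum by (simp add: U_def X_def distrib_right)
          also have "\<dots> \<le> (a - c) * U j"
            using l' l c U[of j] by (intro mult_right_mono) auto
          finally show ?thesis using True by (simp add: \<mu>_def x)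
        next
          case False
          have "2 * X j * U j + (\<Sum>j'\<in>{j'. adj_Zd j j'}. U j') \<le> 2 * l * U j + 2 * D * U j"
            using superharmonic[OF assms, of "j - j0"] False unfolding U_sum
            by (simp add: U_def X_def D_def)
          also have "\<dots> = a * U j" using l(4) by (simp add: distrib_right[symmetric])
          finally show ?thesis using False by (simp add: \<mu>_def x)
        qed
        then show ?thesis
          using comb_weight_sum[where X = X and U = U and j = j and k = k, OF X] True unfolding u_def x by simp
      next
        case False
        have "X j + 1 / X j \<le> \<mu> x"
          using l(3) c(3) by (auto simp: X_def \<mu>_def x)
        then have "(X j + 1 / X j) * u x \<le> \<mu> x * u x"
          using u by (intro mult_right_mono) auto
        then show ?thesis
          using comb_weight_sum[where X = X and U = U and j = j and k = k, OF X] False unfolding u_def x by simp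
      qed
    qed
    have u_pos: "u x > 0" for x using U X by (simp add: u_def)
    have \<mu>_le: "\<mu> x \<le> a" for x using c by (simp add: \<mu>_def)
    have "Re (cinner \<psi> (A_comb \<psi>)) \<le> (\<Sum>\<^sub>\<infinity>x. \<mu> x * (cmod (apply_ell2 \<psi> x))\<^sup>2)"
      unfolding A_comb_def by (rule G.adj_op_form_le(1)[OF u_pos u\<mu> \<mu>_le])
    also have "\<dots> = (\<Sum>\<^sub>\<infinity>x. a * (cmod (apply_ell2 \<psi> x))\<^sup>2 - c * (if fst x = j0 then (cmod (apply_ell2 \<psi> x))\<^sup>2 else 0))"
      by (rule infsum_cong) (simp add: \<mu>_def left_diff_distrib)
    also have "\<dots> = a * (norm \<psi>)\<^sup>2 - c * (norm (slice \<psi> j0))\<^sup>2"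
      unfolding norm_slice_square norm_ell2_square[of \<psi>]
      by (subst infsum_diff) (auto intro!: summable_on_cmult_right ell2_summable slice_square_summable
          simp: infsum_cmult_right')
    finally show ?thesis
      unfolding H_comb_def onorm_A_comb D_def[symmetric] a_def[symmetric]
      by (simp add: cinner_diff_right cinner_scaleR_right cinner_self)
  qed
  then show thesis using that c(1) by blast
qed

section \<open>Rapidly decreasing vectors\<close>

definition weight :: "int ^ 'd::finite \<Rightarrow> real" where
  "weight j = 1 + norm (\<chi> i. real_of_int (j $ i))"

text \<open>The constant is explicit, because exponential series are summed in these seminorms and
  their tails have to be estimated.\<close>

definition decay :: "nat \<Rightarrow> real \<Rightarrow> 'd::finite comb_vertex ell2 \<Rightarrow> bool" where
  "decay n C \<xi> \<longleftrightarrow> (\<forall>j. weight j ^ n * norm (slice \<xi> j) \<le> C)"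

lemma S0_iff: "\<xi> \<in> S0 \<longleftrightarrow> (\<forall>n. \<exists>C. decay n C \<xi>)"
  by (simp add: S0_def decay_def weight_def)

lemma weight_ge_1: "1 \<le> weight j"
  by (simp add: weight_def)

lemma weight_pos: "0 < weight j"
  using weight_ge_1[of j] by linarith

lemma weight_adj:
  fixes j j' :: "int ^ 'a::finite"
  assumes "adj_Zd j j'"
  shows "weight j \<le> 2 * weight j'"
proof -
  let ?v = "\<lambda>j :: int ^ 'a. (\<chi> i. real_of_int (j $ i)) :: real ^ 'a"
  have "norm (?v j - ?v j') \<le> (\<Sum>i\<in>UNIV. \<bar>(?v j - ?v j') $ i\<bar>)"
    by (rule norm_le_l1_cart)
  also have "\<dots> = real_of_int (\<Sum>i\<in>UNIV. \<bar>j $ i - j' $ i\<bar>)"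
    by simp
  also have "\<dots> = 1" using assms by (simp add: adj_Zd_def)
  finally have "norm (?v j) \<le> norm (?v j') + 1"
    using norm_triangle_ineq2[of "?v j" "?v j'"] by linarith
  then have "weight j \<le> weight j' + 1"
    by (simp add: weight_def)
  then show ?thesis
    using weight_ge_1[of j'] by linarith
qed

lemma slice_add: "slice (\<xi> + \<eta>) j = slice \<xi> j + slice \<eta> j"
  by (rule ell2_eqI) (simp add: apply_slice plus_ell2.rep_eq)

lemma slice_diff: "slice (\<xi> - \<eta>) j = slice \<xi> j - slice \<eta> j"
  by (rule ell2_eqI) (simp add: apply_slice minus_ell2.rep_eq)

lemma slice_scaleC: "slice (c *\<^sub>C \<xi>) j = c *\<^sub>C slice \<xi> j"
  by (rule ell2_eqI) (simp add: apply_slice scaleC_ell2.rep_eq)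

lemma slice_scaleR: "slice (r *\<^sub>R \<xi>) j = r *\<^sub>R slice \<xi> j"
  by (simp add: scaleR_scaleC slice_scaleC)

lemma norm_slice_le: "norm (slice \<xi> j) \<le> norm \<xi>"
proof (rule power2_le_imp_le)
  show "(norm (slice \<xi> j))\<^sup>2 \<le> (norm \<xi>)\<^sup>2"
    unfolding norm_slice_square norm_ell2_square[of \<xi>]
    by (rule infsum_mono[OF slice_square_summable ell2_summable]) auto
qed simp

lemma bounded_linear_slice: "bounded_linear (\<lambda>\<xi>. slice \<xi> j)"
  by (rule bounded_linear_intro[where K = 1]) (simp_all add: slice_add slice_scaleR norm_slice_le)

lemma decay_add: "decay n C \<xi> \<Longrightarrow> decay n C' \<eta> \<Longrightarrow> decay n (C + C') (\<xi> + \<eta>)"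
  unfolding decay_def slice_add
proof
  fix j assume a: "\<forall>j. weight j ^ n * norm (slice \<xi> j) \<le> C" "\<forall>j. weight j ^ n * norm (slice \<eta> j) \<le> C'"
  have "weight j ^ n * norm (slice \<xi> j + slice \<eta> j) \<le> weight j ^ n * (norm (slice \<xi> j) + norm (slice \<eta> j))"
    using weight_pos[of j] by (intro mult_left_mono norm_triangle_ineq) simp
  also have "\<dots> \<le> C + C'" using a by (simp add: distrib_left add_mono)
  finally show "weight j ^ n * norm (slice \<xi> j + slice \<eta> j) \<le> C + C'" .
qed

lemma decay_scaleC: "decay n C \<xi> \<Longrightarrow> decay n (cmod c * C) (c *\<^sub>C \<xi>)"
  unfolding decay_def slice_scaleC norm_scaleC_ell2
  by (metis mult.left_commute mult_left_mono norm_ge_zero)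

lemma S0_add: "\<xi> \<in> S0 \<Longrightarrow> \<eta> \<in> S0 \<Longrightarrow> \<xi> + \<eta> \<in> S0"
  unfolding S0_iff using decay_add by blast

lemma S0_scaleC: "\<xi> \<in> S0 \<Longrightarrow> c *\<^sub>C \<xi> \<in> S0"
  unfolding S0_iff using decay_scaleC by blast

lemma S0_zero: "0 \<in> S0"
  unfolding S0_iff
proof (intro allI exI)
  have "slice (0 :: 'a comb_vertex ell2) j = 0" for j
    by (rule ell2_eqI) (simp add: apply_slice zero_ell2.rep_eq)
  then show "decay n 0 (0 :: 'a comb_vertex ell2)" for n
    by (simp add: decay_def)
qed

lemma apply_A_comb:
  "apply_ell2 (A_comb \<psi>) (j, k) = apply_ell2 \<psi> (j, k + 1) + apply_ell2 \<psi> (j, k - 1) +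
     (if k = 0 then \<Sum>j'\<in>{j'. adj_Zd j j'}. apply_ell2 \<psi> (j', 0) else 0)"
  by (simp add: A_comb_def G.apply_adj_op sum_nb_comb)

lemma slice_A_comb:
  "slice (A_comb \<psi>) j = adj_op adj_Z (slice \<psi> j) +
     (\<Sum>j'\<in>{j'. adj_Zd j j'}. apply_ell2 \<psi> (j', 0)) *\<^sub>C delta 0"
  by (rule ell2_eqI)
    (simp add: apply_slice plus_ell2.rep_eq scaleC_ell2.rep_eq delta.rep_eq Z.apply_adj_op nb_Z apply_A_comb)

lemma norm_adj_Z_le: "norm (adj_op adj_Z \<psi>) \<le> 2 * norm \<psi>"
  by (rule Z.norm_adj_op_le[where u = "\<lambda>_. 1"]) (auto simp: nb_Z)

text \<open>Weights of adjacent lattice points differ at most by a factor 2; this gives the 2^n for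
  each of the 2d horizontal edges.\<close>

lemma decay_A_comb:
  fixes \<psi> :: "'d::finite comb_vertex ell2"
  assumes "decay n C \<psi>"
  shows "decay n ((2 + 2 * real CARD('d) * 2 ^ n) * C) (A_comb \<psi>)"
  unfolding decay_def
proof
  fix j :: "int ^ 'd"
  have C: "weight j ^ n * norm (slice \<psi> j) \<le> C" for j
    using assms by (simp add: decay_def)
  have "cmod (\<Sum>j'\<in>{j'. adj_Zd j j'}. apply_ell2 \<psi> (j', 0)) \<le> (\<Sum>j'\<in>{j'. adj_Zd j j'}. norm (slice \<psi> j'))"
    by (intro sum_norm_le) (metis apply_slice cmod_apply_ell2_le)
  then have "norm (slice (A_comb \<psi>) j) \<le> 2 * norm (slice \<psi> j) + (\<Sum>j'\<in>{j'. adj_Zd j j'}. norm (slice \<psi> j'))"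
    unfolding slice_A_comb
    by (intro norm_triangle_le add_mono norm_adj_Z_le) (simp add: norm_scaleC_ell2)
  then have "weight j ^ n * norm (slice (A_comb \<psi>) j) \<le>
      weight j ^ n * (2 * norm (slice \<psi> j) + (\<Sum>j'\<in>{j'. adj_Zd j j'}. norm (slice \<psi> j')))"
    using weight_pos[of j] by (intro mult_left_mono) auto
  also have "\<dots> = 2 * (weight j ^ n * norm (slice \<psi> j)) + (\<Sum>j'\<in>{j'. adj_Zd j j'}. weight j ^ n * norm (slice \<psi> j'))"
    by (simp add: distrib_left sum_distrib_left)
  also have "\<dots> \<le> 2 * C + (\<Sum>j'\<in>{j'. adj_Zd j j'}. 2 ^ n * C)"
  proof (intro add_mono mult_left_mono C sum_mono)
    fix j' assume "j' \<in> {j'. adj_Zd j j'}"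
    then have "weight j ^ n \<le> (2 * weight j') ^ n"
      using weight_adj weight_pos[of j] by (intro power_mono) auto
    then have "weight j ^ n * norm (slice \<psi> j') \<le> (2 * weight j') ^ n * norm (slice \<psi> j')"
      by (rule mult_right_mono) simp
    also have "\<dots> \<le> 2 ^ n * C"
      using mult_left_mono[OF C[of j'], of "2 ^ n"] by (simp add: power_mult_distrib mult.assoc)
    finally show "weight j ^ n * norm (slice \<psi> j') \<le> 2 ^ n * C" .
  qed auto
  also have "\<dots> = (2 + 2 * real CARD('d) * 2 ^ n) * C"
    by (simp add: card_nb_Zd algebra_simps)
  finally show "weight j ^ n * norm (slice (A_comb \<psi>) j) \<le> (2 + 2 * real CARD('d) * 2 ^ n) * C" .
qed

text \<open>The exponent 2d lets the weight dominate the product of (1 + |j_i|)^2 over all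
  coordinates, which reduces the sum to dimension one.\<close>

lemma summable_on_weight:
  "(\<lambda>j :: int ^ 'd::finite. 1 / weight j ^ (2 * CARD('d))) summable_on UNIV"
proof (rule summable_on_comparison_test)
  have sq: "summable (\<lambda>n. 1 / (1 + real n)\<^sup>2)"
    using summable_Suc_iff[of "\<lambda>n. 1 / (real n)\<^sup>2"] inverse_power_summable[of 2]
    by (simp add: add.commute inverse_eq_divide)
  then have "(\<lambda>k :: int. 1 / (1 + \<bar>real_of_int k\<bar>)\<^sup>2) summable_on UNIV"
    by (intro summable_on_int) auto
  then show "(\<lambda>j :: int ^ 'd. \<Prod>i\<in>UNIV. 1 / (1 + \<bar>real_of_int (j $ i)\<bar>)\<^sup>2) summable_on UNIV"
    by (intro summable_on_vec_prod) auto
  fix j :: "int ^ 'd"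
  have "(\<Prod>i\<in>(UNIV :: 'd set). (1 + \<bar>real_of_int (j $ i)\<bar>)\<^sup>2) \<le> (\<Prod>i\<in>(UNIV :: 'd set). (weight j)\<^sup>2)"
  proof (intro prod_mono conjI power_mono)
    show "1 + \<bar>real_of_int (j $ i)\<bar> \<le> weight j" for i
      using component_le_norm_cart[of "\<chi> i. real_of_int (j $ i)" i] by (simp add: weight_def)
  qed auto
  also have "\<dots> = weight j ^ (2 * CARD('d))" by (simp add: power_mult)
  finally have "(\<Prod>i\<in>(UNIV :: 'd set). (1 + \<bar>real_of_int (j $ i)\<bar>)\<^sup>2) \<le> weight j ^ (2 * CARD('d))" .
  moreover have "0 < (\<Prod>i\<in>(UNIV :: 'd set). (1 + \<bar>real_of_int (j $ i)\<bar>)\<^sup>2)"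
    by (intro prod_pos) (auto intro: add_pos_nonneg)
  ultimately show "1 / weight j ^ (2 * CARD('d)) \<le> (\<Prod>i\<in>(UNIV :: 'd set). 1 / (1 + \<bar>real_of_int (j $ i)\<bar>)\<^sup>2)"
    using weight_pos[of j] by (simp add: prod_dividef frac_le)
qed (simp add: weight_pos less_imp_le)

lemma norm_slice_le_weight:
  assumes "decay n C \<xi>"
  shows "norm (slice \<xi> j) \<le> C * (1 / weight j ^ n)"
  using assms weight_pos[of j] by (simp add: decay_def field_simps)

lemma summable_on_norm_slice:
  fixes \<xi> :: "'d::finite comb_vertex ell2"
  assumes "decay (2 * CARD('d)) C \<xi>"
  shows "(\<lambda>j. norm (slice \<xi> j)) summable_on UNIV"
    "(\<Sum>\<^sub>\<infinity>j. norm (slice \<xi> j)) \<le> C * (\<Sum>\<^sub>\<infinity>j :: int ^ 'd. 1 / weight j ^ (2 * CARD('d)))"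
proof -
  have s: "(\<lambda>j :: int ^ 'd. C * (1 / weight j ^ (2 * CARD('d)))) summable_on UNIV"
    by (intro summable_on_cmult_right summable_on_weight)
  show 1: "(\<lambda>j. norm (slice \<xi> j)) summable_on UNIV"
    by (rule summable_on_comparison_test[OF s norm_slice_le_weight[OF assms]]) simp
  show "(\<Sum>\<^sub>\<infinity>j. norm (slice \<xi> j)) \<le> C * (\<Sum>\<^sub>\<infinity>j :: int ^ 'd. 1 / weight j ^ (2 * CARD('d)))"
    unfolding infsum_cmult_right'[symmetric] by (rule infsum_mono[OF 1 s norm_slice_le_weight[OF assms]])
qed

lemma cinner_eq_infsum_slice:
  "cinner \<xi> \<psi> = (\<Sum>\<^sub>\<infinity>j. cinner (slice \<xi> j) (slice \<psi> j))"
  using infsum_Sigma_banach[of "\<lambda>x. cnj (apply_ell2 \<xi> x) * apply_ell2 \<psi> x" UNIV "\<lambda>_. UNIV"]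
    cinner_ell2_summable[of \<xi> \<psi>]
  by (simp add: cinner_ell2_def apply_slice)

section \<open>The Hamiltonian\<close>

definition comb_norm :: "'d::finite itself \<Rightarrow> real" where
  "comb_norm _ = 2 * sqrt ((real CARD('d))\<^sup>2 + 1)"

lemma H_comb_eq: "H_comb \<psi> = comb_norm TYPE('d) *\<^sub>R \<psi> - A_comb \<psi>"
  for \<psi> :: "'d::finite comb_vertex ell2"
  by (simp add: H_comb_def onorm_A_comb comb_norm_def)

lemma comb_norm_gt_2: "2 < comb_norm TYPE('d::finite)"
  unfolding comb_norm_def using real_less_rsqrt[of 1 "(real CARD('d))\<^sup>2 + 1"] by simp

definition comb_H :: "'d::finite comb_vertex bop" where
  "comb_H = (SOME H. app H = H_comb)"

lemma app_comb_H: "app (comb_H :: 'd::finite comb_vertex bop) = H_comb"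
proof -
  have "bounded_linear (\<lambda>\<psi> :: 'd comb_vertex ell2. comb_norm TYPE('d) *\<^sub>R \<psi> - A_comb \<psi>)"
    by (intro bounded_linear_sub bounded_linear_scaleR_right bounded_linear_A_comb)
  then have "bounded_linear (H_comb :: 'd comb_vertex ell2 \<Rightarrow> _)"
    unfolding H_comb_eq[abs_def] .
  from bop_exists[OF this] show ?thesis
    unfolding comb_H_def by (metis (mono_tags, lifting) someI_ex)
qed

lemma A_comb_scaleC: "A_comb (c *\<^sub>C \<psi>) = c *\<^sub>C A_comb \<psi>"
  unfolding A_comb_def by (rule G.adj_op_scaleC)

lemma A_comb_symmetric: "cinner \<phi> (A_comb \<psi>) = cinner (A_comb \<phi>) \<psi>"
  unfolding A_comb_def by (rule G.adj_op_symmetric)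

lemma pos_comb_H:
  assumes "CARD('d::finite) \<ge> 3"
  shows "pos (comb_H :: 'd comb_vertex bop)"
  unfolding pos_def complex_linear_def adjoint_pair_def app_comb_H
proof (intro conjI allI)
  fix c and \<phi> \<psi> :: "'d comb_vertex ell2"
  show "H_comb (c *\<^sub>C \<psi>) = c *\<^sub>C H_comb \<psi>"
    by (simp add: H_comb_eq A_comb_scaleC CV.scale_right_diff_distrib scaleR_scaleC scaleC_scaleC mult.commute)
  show "cinner \<phi> (H_comb \<psi>) = cinner (H_comb \<phi>) \<psi>"
    by (simp add: H_comb_eq cinner_diff_left cinner_diff_right cinner_scaleR_left cinner_scaleR_right A_comb_symmetric)
  obtain e where e: "e > 0" "\<And>(\<psi> :: 'd comb_vertex ell2) j. e * (norm (slice \<psi> j))\<^sup>2 \<le> Re (cinner \<psi> (H_comb \<psi>))"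
    using form_H_comb_ge[OF assms] by blast
  show "0 \<le> Re (cinner \<psi> (H_comb \<psi>))"
    using e(2)[of \<psi> 0] e(1) by (meson mult_nonneg_nonneg less_imp_le order_trans zero_le_power2)
qed

lemma comb_H_definite:
  fixes \<psi> :: "'d::finite comb_vertex ell2"
  assumes "CARD('d) \<ge> 3" "Re (cinner \<psi> (H_comb \<psi>)) = 0"
  shows "\<psi> = 0"
proof -
  obtain e where e: "e > 0" "\<And>(\<psi> :: 'd comb_vertex ell2) j. e * (norm (slice \<psi> j))\<^sup>2 \<le> Re (cinner \<psi> (H_comb \<psi>))"
    using form_H_comb_ge[OF assms(1)] by blast
  have "slice \<psi> j = 0" for j
    using e(1) e(2)[where \<psi> = \<psi> and j = j] assms(2) by (simp add: mult_le_0_iff)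
  then have "apply_ell2 \<psi> (j, k) = 0" for j k
    by (metis apply_slice zero_ell2.rep_eq)
  then show ?thesis
    by (intro ell2_eqI) (auto simp: zero_ell2.rep_eq)
qed

text \<open>The form of H controls all slices of \<psi> uniformly in j, so summability of the slice
  norms of \<xi> is enough.\<close>

lemma S0_form_bounded:
  fixes \<xi> :: "'d::finite comb_vertex ell2"
  assumes "CARD('d) \<ge> 3" "\<xi> \<in> S0"
  shows "\<exists>C. \<forall>\<psi>. cmod (cinner \<xi> \<psi>) \<le> C * sqrt (Re (cinner \<psi> (H_comb \<psi>)))"
proof -
  obtain e where e: "e > 0" "\<And>(\<psi> :: 'd comb_vertex ell2) j. e * (norm (slice \<psi> j))\<^sup>2 \<le> Re (cinner \<psi> (H_comb \<psi>))"
    using form_H_comb_ge[OF assms(1)] by blast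
  obtain C where C: "decay (2 * CARD('d)) C \<xi>"
    using assms(2) by (auto simp: S0_iff)
  note s = summable_on_norm_slice(1)[OF C]
  define N where "N = (\<Sum>\<^sub>\<infinity>j. norm (slice \<xi> j))"
  have "cmod (cinner \<xi> \<psi>) \<le> N / sqrt e * sqrt (Re (cinner \<psi> (H_comb \<psi>)))" for \<psi>
  proof -
    define F where "F = sqrt (Re (cinner \<psi> (H_comb \<psi>))) / sqrt e"
    have "norm (slice \<psi> j) \<le> F" for j
    proof -
      have "sqrt (e * (norm (slice \<psi> j))\<^sup>2) \<le> sqrt (Re (cinner \<psi> (H_comb \<psi>)))"
        using e(2) by simp
      then show ?thesis using e(1) by (simp add: F_def real_sqrt_mult field_simps)
    qed
    then have le: "norm (cinner (slice \<xi> j) (slice \<psi> j)) \<le> norm (slice \<xi> j) * F" for j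
      using cauchy_schwarz_ell2[of "slice \<xi> j" "slice \<psi> j"]
      by (meson mult_left_mono norm_ge_zero order_trans)
    have sF: "(\<lambda>j. norm (slice \<xi> j) * F) summable_on UNIV"
      by (intro summable_on_cmult_left s)
    have abs: "(\<lambda>j. norm (cinner (slice \<xi> j) (slice \<psi> j))) summable_on UNIV"
      by (rule summable_on_comparison_test[OF sF]) (auto intro: le)
    have "cmod (cinner \<xi> \<psi>) \<le> (\<Sum>\<^sub>\<infinity>j. norm (cinner (slice \<xi> j) (slice \<psi> j)))"
      unfolding cinner_eq_infsum_slice[of \<xi> \<psi>] by (rule norm_infsum_bound[OF abs])
    also have "\<dots> \<le> (\<Sum>\<^sub>\<infinity>j. norm (slice \<xi> j) * F)"
      by (rule infsum_mono[OF abs sF le])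
    also have "\<dots> = N * F"
      unfolding N_def by (rule infsum_cmult_left')
    finally show ?thesis by (simp add: F_def)
  qed
  then show ?thesis by blast
qed

definition decay_const :: "'d::finite itself \<Rightarrow> nat \<Rightarrow> real" where
  "decay_const _ n = comb_norm TYPE('d) + (2 + 2 * real CARD('d) * 2 ^ n)"

lemma decay_H_comb:
  fixes \<psi> :: "'d::finite comb_vertex ell2"
  assumes "decay n C \<psi>"
  shows "decay n (decay_const TYPE('d) n * C) (H_comb \<psi>)"
proof -
  have "H_comb \<psi> = complex_of_real (comb_norm TYPE('d)) *\<^sub>C \<psi> + (-1) *\<^sub>C A_comb \<psi>"
    by (simp add: H_comb_eq scaleR_scaleC CV_minus_one)
  moreover have "cmod (complex_of_real (comb_norm TYPE('d))) = comb_norm TYPE('d)"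
    using comb_norm_gt_2[where 'd = 'd] by simp
  ultimately show ?thesis
    using decay_add[OF decay_scaleC[OF assms, of "complex_of_real (comb_norm TYPE('d))"]
        decay_scaleC[OF decay_A_comb[OF assms], of "-1"]]
    by (simp add: decay_const_def distrib_right)
qed

lemma decay_comb_H_power:
  fixes \<psi> :: "'d::finite comb_vertex ell2"
  assumes "decay n C \<psi>"
  shows "decay n (decay_const TYPE('d) n ^ m * C) (app (comb_H ^ m) \<psi>)"
proof (induction m)
  case (Suc m)
  then show ?case
    using decay_H_comb[OF Suc] by (simp add: app_comb_H mult.assoc)
qed (simp add: assms)

lemma H_comb_S0: "\<xi> \<in> S0 \<Longrightarrow> H_comb \<xi> \<in> S0"
  unfolding S0_iff using decay_H_comb by blast

text \<open>H enlarges each decay seminorm by a fixed factor at most, so the exponential series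
  converges in that seminorm. M = 0 gives invariance of \<open>S0\<close>; general M is needed to
  exchange the series with the pairing.\<close>

lemma decay_cexp_tail:
  fixes \<xi> :: "'d::finite comb_vertex ell2" and t :: real
  assumes H: "pos (comb_H :: 'd comb_vertex bop)" and C: "decay n C \<xi>"
  defines "g \<equiv> \<lambda>m. (decay_const TYPE('d) n * \<bar>t\<bar>) ^ m / fact m"
  shows "decay n (C * (\<Sum>m. g (m + M)))
    (app (cexp comb_H (of_real t)) \<xi> - (\<Sum>m<M. (\<i> * of_real t) ^ m *\<^sub>C app (comb_H ^ m) \<xi> /\<^sub>R fact m))"
    and "summable g"
proof -
  define f where "f m = (\<i> * of_real t) ^ m *\<^sub>C app (comb_H ^ m) \<xi> /\<^sub>R fact m" for m
  have "f sums app (cexp comb_H (of_real t)) \<xi>"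
    using exp_sums_app[of "cexp_gen comb_H (of_real t)" \<xi>]
    by (simp add: f_def[abs_def] cexp_def app_cexp_gen_power[OF H])
  then have tail: "(\<lambda>m. f (m + M)) sums (app (cexp comb_H (of_real t)) \<xi> - (\<Sum>m<M. f m))"
    by (simp add: sums_iff_shift)
  show g: "summable g"
    unfolding g_def using summable_exp[of "decay_const TYPE('d) n * \<bar>t\<bar>"] by (simp add: divide_inverse mult.commute)
  have le: "weight j ^ n * norm (slice (f m) j) \<le> C * g m" for m j
  proof -
    have "weight j ^ n * norm (slice (f m) j) = \<bar>t\<bar> ^ m / fact m * (weight j ^ n * norm (slice (app (comb_H ^ m) \<xi>) j))"
      by (simp add: f_def slice_scaleR slice_scaleC norm_scaleC_ell2 norm_mult norm_power divide_inverse mult_ac)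
    also have "\<dots> \<le> \<bar>t\<bar> ^ m / fact m * (decay_const TYPE('d) n ^ m * C)"
      using decay_comb_H_power[OF C, of m] by (intro mult_left_mono) (auto simp: decay_def)
    also have "\<dots> = C * g m" by (simp add: g_def power_mult_distrib mult_ac)
    finally show ?thesis .
  qed
  show "decay n (C * (\<Sum>m. g (m + M)))
    (app (cexp comb_H (of_real t)) \<xi> - (\<Sum>m<M. (\<i> * of_real t) ^ m *\<^sub>C app (comb_H ^ m) \<xi> /\<^sub>R fact m))"
    unfolding decay_def f_def[symmetric]
  proof
    fix j :: "int ^ 'd"
    have w: "weight j ^ n > 0" using weight_pos[of j] by simp
    have "(\<lambda>m. weight j ^ n *\<^sub>R slice (f (m + M)) j) sums
        (weight j ^ n *\<^sub>R slice (app (cexp comb_H (of_real t)) \<xi> - (\<Sum>m<M. f m)) j)"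
      by (intro sums_scaleR_right bounded_linear.sums[OF bounded_linear_slice] tail)
    then have eq: "weight j ^ n *\<^sub>R slice (app (cexp comb_H (of_real t)) \<xi> - (\<Sum>m<M. f m)) j =
        (\<Sum>m. weight j ^ n *\<^sub>R slice (f (m + M)) j)"
      by (simp add: sums_iff)
    have sg: "summable (\<lambda>m. C * g (m + M))"
      by (intro summable_mult summable_ignore_initial_segment g)
    have "norm (\<Sum>m. weight j ^ n *\<^sub>R slice (f (m + M)) j) \<le> (\<Sum>m. C * g (m + M))"
      by (rule norm_suminf_le[OF _ sg]) (use le w in simp)
    also have "\<dots> = C * (\<Sum>m. g (m + M))"
      by (rule suminf_mult) (intro summable_ignore_initial_segment g)
    finally show "weight j ^ n * norm (slice (app (cexp comb_H (of_real t)) \<xi> - (\<Sum>m<M. f m)) j) \<le>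
        C * (\<Sum>m. g (m + M))"
      unfolding eq[symmetric] using w by simp
  qed
qed

lemma cexp_S0:
  fixes \<xi> :: "'d::finite comb_vertex ell2"
  assumes "pos (comb_H :: 'd comb_vertex bop)" "\<xi> \<in> S0"
  shows "app (cexp comb_H (of_real t)) \<xi> \<in> S0"
  unfolding S0_iff
proof
  fix n
  obtain C where "decay n C \<xi>" using assms(2) by (auto simp: S0_iff)
  from decay_cexp_tail(1)[OF assms(1) this, of t 0]
  show "\<exists>C. decay n C (app (cexp comb_H (of_real t)) \<xi>)" by auto
qed

section \<open>The Perron--Frobenius pairing\<close>

text \<open>As v is not square-summable, the pairing is controlled by the decay seminorm of order 2d
  instead of the norm.\<close>

lemma pf_pairing_bound:
  fixes \<xi> :: "'d::finite comb_vertex ell2"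
  assumes "decay (2 * CARD('d)) C \<xi>"
  defines "w \<equiv> pf_w (onorm (A_comb :: 'd comb_vertex ell2 \<Rightarrow> _))"
  shows "(\<lambda>j. cinner w (slice \<xi> j)) summable_on UNIV"
    "cmod (pf_pairing \<xi>) \<le> norm w * (C * (\<Sum>\<^sub>\<infinity>j :: int ^ 'd. 1 / weight j ^ (2 * CARD('d))))"
proof -
  have s: "(\<lambda>j. norm w * norm (slice \<xi> j)) summable_on UNIV"
    by (intro summable_on_cmult_right summable_on_norm_slice(1)[OF assms(1)])
  have abs: "(\<lambda>j. norm (cinner w (slice \<xi> j))) summable_on UNIV"
    by (rule summable_on_comparison_test[OF s]) (auto intro: cauchy_schwarz_ell2)
  show "(\<lambda>j. cinner w (slice \<xi> j)) summable_on UNIV"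
    using abs by (rule Infinite_Sum.abs_summable_summable)
  have "cmod (pf_pairing \<xi>) \<le> (\<Sum>\<^sub>\<infinity>j. norm (cinner w (slice \<xi> j)))"
    unfolding pf_pairing_def w_def[symmetric] by (rule norm_infsum_bound[OF abs])
  also have "\<dots> \<le> (\<Sum>\<^sub>\<infinity>j. norm w * norm (slice \<xi> j))"
    by (rule infsum_mono[OF abs s cauchy_schwarz_ell2])
  also have "\<dots> = norm w * (\<Sum>\<^sub>\<infinity>j. norm (slice \<xi> j))"
    by (rule infsum_cmult_right')
  also have "\<dots> \<le> norm w * (C * (\<Sum>\<^sub>\<infinity>j :: int ^ 'd. 1 / weight j ^ (2 * CARD('d))))"
    by (intro mult_left_mono summable_on_norm_slice(2)[OF assms(1)]) simp
  finally show "cmod (pf_pairing \<xi>) \<le> norm w * (C * (\<Sum>\<^sub>\<infinity>j :: int ^ 'd. 1 / weight j ^ (2 * CARD('d))))" .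
qed

lemma pf_pairing_summable:
  fixes \<xi> :: "'d::finite comb_vertex ell2"
  assumes "\<xi> \<in> S0"
  shows "(\<lambda>j. cinner (pf_w (onorm (A_comb :: 'd comb_vertex ell2 \<Rightarrow> _))) (slice \<xi> j)) summable_on UNIV"
  using assms pf_pairing_bound(1) by (auto simp: S0_iff)

lemma pf_pairing_add: "\<xi> \<in> S0 \<Longrightarrow> \<eta> \<in> S0 \<Longrightarrow> pf_pairing (\<xi> + \<eta>) = pf_pairing \<xi> + pf_pairing \<eta>"
  unfolding pf_pairing_def slice_add cinner_add_right
  by (rule infsum_add) (rule pf_pairing_summable, assumption)+

lemma pf_pairing_scaleC: "pf_pairing (c *\<^sub>C \<xi>) = c * pf_pairing \<xi>"
  unfolding pf_pairing_def slice_scaleC cinner_scaleC_right by (rule infsum_cmult_right')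

text \<open>With \<open>a = \<parallel>A\<parallel>\<close> and \<open>\<lambda> + 1/\<lambda> = a = 2\<lambda> + 2d\<close>, the vector \<open>r = (a - A\<^sub>\<int>)\<^sup>-\<^sup>1 \<delta>\<^sub>0\<close> is
  \<open>r k = \<lambda>\<^bsup>|k|\<^esup> / (2d)\<close>. The value \<open>2d r 0 = 1\<close> says that \<open>u \<otimes> r\<close> is annihilated by \<open>a - A\<close>.\<close>

lemma pf_resolvent:
  fixes D :: real
  assumes D: "D > 0"
  defines "a \<equiv> 2 * sqrt (D\<^sup>2 + 1)"
  obtains r where "pf_w a = r /\<^sub>R norm r" "a *\<^sub>R r - adj_op adj_Z r = delta 0"
    "apply_ell2 r 0 = of_real (1 / (2 * D))"
proof -
  define l where "l = comb_lambda D"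
  note l = comb_lambda[OF D, folded l_def a_def]
  define f where "f k = complex_of_real (l ^ nat \<bar>k\<bar> / (2 * D))" for k
  have "(\<lambda>k. (1 / (2 * D))\<^sup>2 * (l\<^sup>2) ^ nat \<bar>k\<bar>) summable_on UNIV"
    using l by (intro summable_on_cmult_right summable_on_geometric_int) (auto simp: power_less_one_iff)
  moreover have "(cmod (f k))\<^sup>2 = (1 / (2 * D))\<^sup>2 * (l\<^sup>2) ^ nat \<bar>k\<bar>" for k
    unfolding f_def norm_of_real power2_abs
    by (simp only: power_divide power_mult[symmetric] mult.commute times_divide_eq_right mult_1_left power_one)
  ultimately have rep: "apply_ell2 (Abs_ell2 f) = f"
    by (intro Abs_ell2_inverse) simp
  define r where "r = Abs_ell2 f"
  have r: "apply_ell2 r k = f k" for k by (simp add: r_def rep)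
  have eq: "a *\<^sub>R r - adj_op adj_Z r = delta 0"
  proof (rule ell2_eqI)
    fix k
    have "a * (l ^ nat \<bar>k\<bar> / (2 * D)) - (l ^ nat \<bar>k + 1\<bar> / (2 * D) + l ^ nat \<bar>k - 1\<bar> / (2 * D)) = (if k = 0 then 1 else 0)"
    proof (cases "k = 0")
      case True
      then show ?thesis using D l(4) by (simp add: field_simps)
    next
      case False
      then show ?thesis
        using tooth_sum[OF l(1) False] l(3) by (simp add: add_divide_distrib[symmetric])
    qed
    then have "complex_of_real (a * (l ^ nat \<bar>k\<bar> / (2 * D)) - (l ^ nat \<bar>k + 1\<bar> / (2 * D) + l ^ nat \<bar>k - 1\<bar> / (2 * D))) =
        complex_of_real (if k = 0 then 1 else 0)"
      by (rule arg_cong)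
    then show "apply_ell2 (a *\<^sub>R r - adj_op adj_Z r) k = apply_ell2 (delta 0) k"
      by (simp add: minus_ell2.rep_eq scaleR_ell2.rep_eq Z.apply_adj_op nb_Z r f_def delta.rep_eq)
  qed
  have "sqrt 1 < sqrt (D\<^sup>2 + 1)" using D by (subst real_sqrt_less_iff) simp
  then have a2: "a > 2" by (simp add: a_def)
  \<comment> \<open>The spectral bound a > 2 for the integers makes a - A_Z injective, so
    \<open>inv\<close> returns exactly the explicit solution r.\<close>
  have inj: "inj (\<lambda>\<psi>. a *\<^sub>R \<psi> - adj_op adj_Z \<psi>)"
  proof (rule injI)
    fix x y assume "a *\<^sub>R x - adj_op adj_Z x = a *\<^sub>R y - adj_op adj_Z y"
    then have "a *\<^sub>R (x - y) = adj_op adj_Z (x - y)"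
      by (simp add: linear_simps[OF Z.bounded_linear_adj_op] scaleR_diff_right algebra_simps)
    then have "a * norm (x - y) \<le> 2 * norm (x - y)"
      using norm_adj_Z_le[of "x - y"] a2 by (metis abs_of_pos less_trans norm_scaleR zero_less_numeral)
    then have "norm (x - y) = 0"
      using a2 by (simp add: mult_le_cancel_right)
    then show "x = y" by simp
  qed
  have "inv (\<lambda>\<psi>. a *\<^sub>R \<psi> - adj_op adj_Z \<psi>) (delta 0) = r"
    using inv_f_f[OF inj, of r] by (simp add: eq)
  then have "pf_w a = r /\<^sub>R norm r"
    by (simp add: pf_w_def Let_def)
  moreover have "apply_ell2 r 0 = of_real (1 / (2 * D))"
    unfolding r by (simp add: f_def)
  ultimately show thesis
    using eq that by blast
qed

text \<open>Formally H v = 0. On each tooth, moving a - A_Z over to r leaves z j minus the mean of z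
  over the 2d neighbours of j; summed over the lattice these differences cancel.\<close>

lemma pf_pairing_H_comb:
  fixes \<xi> :: "'d::finite comb_vertex ell2"
  assumes \<xi>: "\<xi> \<in> S0"
  shows "pf_pairing (H_comb \<xi>) = 0"
proof -
  define D where "D = real CARD('d)"
  have D: "D > 0" by (simp add: D_def)
  let ?a = "2 * sqrt (D\<^sup>2 + 1)"
  obtain r where r: "pf_w ?a = r /\<^sub>R norm r" "?a *\<^sub>R r - adj_op adj_Z r = delta 0"
    "apply_ell2 r 0 = of_real (1 / (2 * D))"
    using pf_resolvent[OF D] by blast
  have delta: "cinner (delta 0) \<psi> = apply_ell2 \<psi> 0" for \<psi> :: "int ell2"
  proof -
    have "cinner (delta 0) \<psi> = (\<Sum>\<^sub>\<infinity>x\<in>{0}. cnj (apply_ell2 (delta 0) x) * apply_ell2 \<psi> x)"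
      unfolding cinner_ell2_def by (rule infsum_cong_neutral) (auto simp: delta.rep_eq)
    then show ?thesis by (simp add: delta.rep_eq)
  qed
  have r_delta: "cinner r (delta 0) = of_real (1 / (2 * D))"
    using delta[of r] by (subst cinner_commute) (simp add: r(3))
  define z where "z j = apply_ell2 \<xi> (j, 0)" for j
  have slice: "cinner r (slice (H_comb \<xi>) j) = z j - of_real (1 / (2 * D)) * (\<Sum>j'\<in>{j'. adj_Zd j j'}. z j')" for j
  proof -
    have "cinner r (slice (H_comb \<xi>) j) =
        cinner (?a *\<^sub>R r - adj_op adj_Z r) (slice \<xi> j) - (\<Sum>j'\<in>{j'. adj_Zd j j'}. z j') * cinner r (delta 0)"
      unfolding H_comb_eq comb_norm_def D_def[symmetric]
      by (simp add: slice_diff slice_scaleR slice_A_comb cinner_diff_left cinner_diff_right cinner_add_right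
          cinner_scaleR_left cinner_scaleR_right cinner_scaleC_right Z.adj_op_symmetric z_def)
    then show ?thesis
      unfolding r(2) delta r_delta by (simp add: apply_slice z_def)
  qed
  obtain C where C: "decay (2 * CARD('d)) C \<xi>" using \<xi> by (auto simp: S0_iff)
  have nz: "norm (z j) \<le> norm (slice \<xi> j)" for j
    unfolding z_def by (metis apply_slice cmod_apply_ell2_le)
  have abs: "(\<lambda>j. norm (z j)) summable_on UNIV"
    by (rule summable_on_comparison_test[OF summable_on_norm_slice(1)[OF C]]) (auto intro: nz)
  then have sz: "z summable_on UNIV" by (rule Infinite_Sum.abs_summable_summable)
  interpret Zd: bounded_graph "adj_Zd :: int ^ 'd \<Rightarrow> int ^ 'd \<Rightarrow> bool" "2 * CARD('d)"
    by unfold_locales (auto simp: adj_Zd_sym finite_nb_Zd card_nb_Zd)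
  have cond: "(\<lambda>j'. \<Sum>j\<in>{j. adj_Zd j' j}. norm (z j')) summable_on UNIV"
    by (simp add: card_nb_Zd summable_on_cmult_right abs)
  have sn: "(\<lambda>j. \<Sum>j'\<in>{j'. adj_Zd j j'}. z j') summable_on UNIV"
    by (rule Zd.edge_swap_summable[OF cond])
  have "(\<Sum>\<^sub>\<infinity>j. \<Sum>j'\<in>{j'. adj_Zd j j'}. z j') = (\<Sum>\<^sub>\<infinity>j. of_real (2 * D) * z j)"
    unfolding Zd.edge_swap[OF cond] by (simp add: card_nb_Zd D_def)
  also have "\<dots> = of_real (2 * D) * (\<Sum>\<^sub>\<infinity>j. z j)" by (rule infsum_cmult_right')
  finally have sum: "(\<Sum>\<^sub>\<infinity>j. \<Sum>j'\<in>{j'. adj_Zd j j'}. z j') = of_real (2 * D) * (\<Sum>\<^sub>\<infinity>j. z j)" .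
  have "pf_pairing (H_comb \<xi>) = (\<Sum>\<^sub>\<infinity>j. of_real (inverse (norm r)) * cinner r (slice (H_comb \<xi>) j))"
    unfolding pf_pairing_def onorm_A_comb D_def[symmetric] r(1) cinner_scaleR_left ..
  also have "\<dots> = of_real (inverse (norm r)) * (\<Sum>\<^sub>\<infinity>j. z j - of_real (1 / (2 * D)) * (\<Sum>j'\<in>{j'. adj_Zd j j'}. z j'))"
    unfolding slice by (rule infsum_cmult_right')
  also have "(\<Sum>\<^sub>\<infinity>j. z j - of_real (1 / (2 * D)) * (\<Sum>j'\<in>{j'. adj_Zd j j'}. z j')) =
      (\<Sum>\<^sub>\<infinity>j. z j) - of_real (1 / (2 * D)) * (of_real (2 * D) * (\<Sum>\<^sub>\<infinity>j. z j))"
    by (subst infsum_diff[OF sz summable_on_cmult_right[OF sn]]) (simp only: infsum_cmult_right' sum)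
  also have "\<dots> = 0" using D by simp
  finally show ?thesis by simp
qed

text \<open>Only the term m = 0 of the exponential series survives the pairing, and the remainder
  tends to 0 in the seminorm that controls the pairing.\<close>

lemma pf_pairing_cexp:
  fixes \<xi> :: "'d::finite comb_vertex ell2"
  assumes H: "pos (comb_H :: 'd comb_vertex bop)" and \<xi>: "\<xi> \<in> S0"
  shows "pf_pairing (app (cexp comb_H (of_real t)) \<xi>) = pf_pairing \<xi>"
proof -
  define f where "f m = (\<i> * of_real t) ^ m *\<^sub>C app (comb_H ^ m) \<xi> /\<^sub>R fact m" for m
  have Hm: "app (comb_H ^ m) \<xi> \<in> S0" for m
    by (induction m) (simp_all add: \<xi> app_comb_H H_comb_S0)
  have f_mem: "f m \<in> S0" for m
    unfolding f_def scaleR_scaleC by (intro S0_scaleC Hm)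
  have pf_f: "pf_pairing (f m) = (if m = 0 then pf_pairing \<xi> else 0)" for m
  proof (cases m)
    case 0
    then show ?thesis by (simp add: f_def)
  next
    case (Suc k)
    then have "f m = (complex_of_real (inverse (fact m)) * (\<i> * of_real t) ^ m) *\<^sub>C H_comb (app (comb_H ^ k) \<xi>)"
      by (simp add: f_def scaleR_scaleC scaleC_scaleC app_comb_H)
    then show ?thesis
      using Suc by (simp only: pf_pairing_scaleC pf_pairing_H_comb[OF Hm]) simp
  qed
  have sum: "(\<Sum>m<M. f m) \<in> S0 \<and> pf_pairing (\<Sum>m<M. f m) = (if M = 0 then 0 else pf_pairing \<xi>)" for M
  proof (induction M)
    case 0
    show ?case using pf_pairing_scaleC[of 0 "0 :: 'd comb_vertex ell2"] by (simp add: S0_zero)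
  next
    case (Suc M)
    then show ?case using f_mem[of M] by (simp add: S0_add pf_pairing_add pf_f)
  qed
  let ?U = "app (cexp comb_H (of_real t)) \<xi>"
  obtain C where C: "decay (2 * CARD('d)) C \<xi>" using \<xi> by (auto simp: S0_iff)
  define g where "g m = (decay_const TYPE('d) (2 * CARD('d)) * \<bar>t\<bar>) ^ m / fact m" for m
  define N where "N = norm (pf_w (onorm (A_comb :: 'd comb_vertex ell2 \<Rightarrow> _)))"
  define s where "s = (\<Sum>\<^sub>\<infinity>j :: int ^ 'd. 1 / weight j ^ (2 * CARD('d)))"
  have bound: "cmod (pf_pairing ?U - pf_pairing \<xi>) \<le> N * (C * (\<Sum>m. g (m + M)) * s)" if "M > 0" for M
  proof -
    have mem: "?U - (\<Sum>m<M. f m) \<in> S0"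
      using S0_add[OF cexp_S0[OF H \<xi>, of t] S0_scaleC[OF conjunct1[OF sum[of M]], of "-1"]]
      by (simp add: CV_minus_one)
    have "pf_pairing ?U = pf_pairing (?U - (\<Sum>m<M. f m)) + pf_pairing (\<Sum>m<M. f m)"
      using pf_pairing_add[OF mem conjunct1[OF sum[of M]]] by simp
    then have "pf_pairing ?U - pf_pairing \<xi> = pf_pairing (?U - (\<Sum>m<M. f m))"
      using that sum[of M] by simp
    then show ?thesis
      using pf_pairing_bound(2)[OF decay_cexp_tail(1)[OF H C, of t M]]
      by (simp add: N_def s_def g_def f_def)
  qed
  have summ: "summable g"
    unfolding g_def by (rule decay_cexp_tail(2)[OF H C])
  have "(\<lambda>M. suminf g - (\<Sum>m<M. g m)) \<longlonglongrightarrow> suminf g - suminf g"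
    by (intro tendsto_diff tendsto_const summable_LIMSEQ summ)
  then have "(\<lambda>M. \<Sum>m. g (m + M)) \<longlonglongrightarrow> 0"
    by (simp add: suminf_minus_initial_segment[OF summ])
  then have lim: "(\<lambda>M. N * (C * (\<Sum>m. g (m + M)) * s)) \<longlonglongrightarrow> N * (C * 0 * s)"
    by (intro tendsto_mult tendsto_const)
  have "cmod (pf_pairing ?U - pf_pairing \<xi>) \<le> N * (C * 0 * s)"
    by (rule LIMSEQ_le_const[OF lim]) (use bound in \<open>auto intro!: exI[of _ 1]\<close>)
  then show ?thesis by simp
qed

text \<open>Existence and uniqueness of the state and of the evolution are part of the claim, so the
  KMS statement is not vacuous and concerns one definite state and one definite evolution.\<close>

theorem theorem10p16:
  fixes W :: "'d::finite comb_vertex ell2 \<Rightarrow> 'a::cstar_algebra"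
    and \<beta> c :: real
  assumes "CARD('d) \<ge> 3" and "\<beta> > 0" and "c \<ge> 0"
    and "is_CCR S0 W"
  shows "(\<exists>!\<omega>. quasi_free_state S0 W (two_point \<beta> c) \<omega>) \<and>
         (\<exists>!\<alpha>. induced_evolution S0 W T_comb \<alpha>) \<and>
         (\<forall>\<omega> \<alpha>. quasi_free_state S0 W (two_point \<beta> c) \<omega> \<longrightarrow>
            induced_evolution S0 W T_comb \<alpha> \<longrightarrow> kms_state \<beta> \<alpha> \<omega>)"
proof -
  note H = pos_comb_H[OF assms(1)]
  interpret bose_system S0 W comb_H \<beta> "c / \<beta>" pf_pairing
    by unfold_locales
      (use assms H in \<open>auto simp: S0_zero S0_add S0_scaleC app_comb_H comb_H_definite S0_form_bounded
        cexp_S0 pf_pairing_add pf_pairing_scaleC pf_pairing_cexp\<close>)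
  have T: "T_comb = T"
    unfolding T_comb_def[abs_def] T_def[abs_def] exp_op_cexp[OF H, symmetric] app_comb_H ..
  have "(bose_op \<beta> :: 'd comb_vertex ell2 \<Rightarrow> _) = app (bose comb_H \<beta>)"
  proof
    fix \<psi> :: "'d comb_vertex ell2"
    have "(\<lambda>\<phi>. \<beta> *\<^sub>R H_comb \<phi>) = app (\<beta> *\<^sub>R (comb_H :: 'd comb_vertex bop))"
      by (simp add: fun_eq_iff app_comb_H)
    then show "bose_op \<beta> \<psi> = app (bose comb_H \<beta>) \<psi>"
      by (simp add: bose_op_def exp_op_app bose_def[OF H])
  qed
  then have q: "two_point \<beta> c = q"
    unfolding two_point_def[abs_def] q_def[abs_def] r_def by (simp only:)
  show ?thesis
    unfolding T q using quasi_free_unique_exists evolution_unique_exists quasi_free_kms by blast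
qed

end
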